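(* Suppose that the Unique Games Conjecture is true. Then for all $\epsilon$ with $\frac14>\epsilon>0$ there exists a finite alphabet $\Sigma_\epsilon$ such that it is NP-hard to distinguish between the following two cases of crossword instances over alphabet $\Sigma_\epsilon$: (Yes case) there exists a valid (feasible) solution that fills a $(1-\epsilon)$-fraction of all cells; (No case) no valid solution can fill more than a $(\frac12+\epsilon)$-fraction of all cells. Moreover, this still holds if all slots have distinct lengths (so reusing words is trivially impossible).
   Context: A crossword instance consists of a dictionary $\mathcal{D}$ of words over an alphabet, and a grid of cells containing slots; a slot is a set of consecutive cells in a row (horizontal) or column (vertical). Horizontal slots are pairwise disjoint, vertical slots are pairwise disjoint; a cell in two slots is shared. A valid solution assigns to each slot $S$ either a word of $\mathcal{D}$ of length exactly $|S|$ or nothing; horizontal words left to right, vertical words top to bottom; intersecting filled slots must agree on their shared cell. The cells of the instance are the cells belonging to at least one slot; a cell is filled if it lies in a slot that received a word. \textsc{Unique Label Cover}: given a graph $G=(V,E)$ with a total order on $V$, an integer $R$, and for each edge $(u,v)$ with $u\prec v$ a permutation $\pi_{(u,v)}$ of $[R]$, assign values in $[R]$ to vertices; the constraint on $(u,v)$ is satisfied if the value of $v$ is the image under $\pi_{(u,v)}$ of the value of $u$. The Unique Games Conjecture states that for every $\epsilon>0$ there exists $R$ such that it is NP-hard to distinguish instances of \textsc{Unique Label Cover} in which a $(1-\epsilon)$-fraction of the constraints can be satisfied from instances in which no assignment satisfies more than an $\epsilon$-fraction of the constraints. *)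

theory Defs
  imports
    Complex_Main
    "HOL-Computational_Algebra.Polynomial"
begin

section \<open>Polynomial time and NP\<close>

text \<open>
  Deterministic multi-tape Turing machines. The active states are \<open>0, \<dots>, tm_states - 1\<close>, with
  \<open>0\<close> the initial one; state \<open>tm_states\<close> is the halting state. The tape symbols are
  \<open>0, \<dots>, tm_symbols - 1\<close>: \<open>0\<close> is the blank, \<open>1\<close> and \<open>2\<close> are the bits. Tapes are
  infinite in both directions.
\<close>

datatype move = MoveLeft | Stay | MoveRight

record tm =
  tm_tapes :: nat
  tm_states :: nat
  tm_symbols :: nat
  tm_delta :: "nat \<Rightarrow> nat list \<Rightarrow> nat \<times> (nat \<times> move) list"

definition wf_tm :: "tm \<Rightarrow> bool" where
  "wf_tm M \<longleftrightarrow> tm_tapes M \<ge> 1 \<and> tm_symbols M \<ge> 3 \<and>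
     (\<forall>q syms. q < tm_states M \<and> length syms = tm_tapes M \<and> set syms \<subseteq> {..<tm_symbols M} \<longrightarrow>
        (case tm_delta M q syms of (q', acts) \<Rightarrow>
           q' \<le> tm_states M \<and> length acts = tm_tapes M \<and> fst ` set acts \<subseteq> {..<tm_symbols M}))"

text \<open>A tape is its contents together with the head position.\<close>

type_synonym tape = "(int \<Rightarrow> nat) \<times> int"

type_synonym config = "nat \<times> tape list"

fun move_head :: "move \<Rightarrow> int \<Rightarrow> int" where
  "move_head MoveLeft h = h - 1"
| "move_head Stay h = h"
| "move_head MoveRight h = h + 1"

definition tape_read :: "tape \<Rightarrow> nat" where
  "tape_read = (\<lambda>(c, h). c h)"

definition tape_act :: "nat \<times> move \<Rightarrow> tape \<Rightarrow> tape" where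
  "tape_act = (\<lambda>(s, d) (c, h). (c(h := s), move_head d h))"

definition tm_step :: "tm \<Rightarrow> config \<Rightarrow> config" where
  "tm_step M = (\<lambda>(q, tps).
     if q < tm_states M
     then (case tm_delta M q (map tape_read tps) of (q', acts) \<Rightarrow> (q', map2 tape_act acts tps))
     else (q, tps))"

definition word_tape :: "bool list \<Rightarrow> tape" where
  "word_tape x =
     ((\<lambda>i. if 0 \<le> i \<and> i < int (length x) then (if x ! nat i then 2 else 1) else 0), 0)"

definition init_config :: "tm \<Rightarrow> bool list \<Rightarrow> config" where
  "init_config M x = (0, word_tape x # replicate (tm_tapes M - 1) (word_tape []))"

text \<open>
  The first tape holds the input and, on halting, the output (with the head returned to its
  first symbol); nothing is required of the other tapes on halting.
\<close>

definition computes_within :: "tm \<Rightarrow> (bool list \<Rightarrow> bool list) \<Rightarrow> (nat \<Rightarrow> nat) \<Rightarrow> bool" where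
  "computes_within M f b \<longleftrightarrow>
     (\<forall>x. \<exists>t \<le> b (length x). \<exists>tps.
        (tm_step M ^^ t) (init_config M x) = (tm_states M, word_tape (f x) # tps))"

definition polytime :: "(bool list \<Rightarrow> bool list) \<Rightarrow> bool" where
  "polytime f \<longleftrightarrow> (\<exists>M (p :: nat poly). wf_tm M \<and> computes_within M f (poly p))"

text \<open>
  Encodings of data as bit strings. Numbers are encoded in unary; all the encodings are
  prefix-free, so a tuple is encoded by concatenating the encodings of its components.
\<close>

definition enc_nat :: "nat \<Rightarrow> bool list" where
  "enc_nat n = replicate n True @ [False]"

definition enc_list :: "('a \<Rightarrow> bool list) \<Rightarrow> 'a list \<Rightarrow> bool list" where
  "enc_list e xs = concat (map (\<lambda>x. True # e x) xs) @ [False]"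

definition enc_pair :: "bool list \<Rightarrow> bool list \<Rightarrow> bool list" where
  "enc_pair x w = enc_list (\<lambda>b. [b]) x @ w"

definition NP :: "bool list set set" where
  "NP = {L. \<exists>V (p :: nat poly). polytime V \<and>
     (\<forall>x. x \<in> L \<longleftrightarrow> (\<exists>w. length w \<le> poly p (length x) \<and> V (enc_pair x w) = [True]))}"

text \<open>
  NP-hardness, under polynomial-time many-one reductions, of distinguishing the strings in
  \<open>Y\<close> from those in \<open>N\<close>.
\<close>

definition np_hard_to_distinguish :: "bool list set \<Rightarrow> bool list set \<Rightarrow> bool" where
  "np_hard_to_distinguish Y N \<longleftrightarrow>
     (\<forall>L \<in> NP. \<exists>f. polytime f \<and> (\<forall>x. (x \<in> L \<longrightarrow> f x \<in> Y) \<and> (x \<notin> L \<longrightarrow> f x \<in> N)))"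


section \<open>Unique Label Cover\<close>

text \<open>
  The vertices are \<open>0, \<dots>, ulc_verts - 1\<close> in their natural order, and \<open>[R]\<close> is
  \<open>{0, \<dots>, R - 1}\<close>. An edge \<open>(u, v, \<pi>)\<close> carries its permutation as the list of its values.
\<close>

type_synonym ulc_edge = "nat \<times> nat \<times> nat list"

record ulc =
  ulc_verts :: nat
  ulc_labels :: nat
  ulc_edges :: "ulc_edge list"

text \<open>Edgeless graphs are excluded, as fractions of their constraints are meaningless.\<close>

definition wf_ulc :: "ulc \<Rightarrow> bool" where
  "wf_ulc I \<longleftrightarrow> ulc_edges I \<noteq> [] \<and>
     distinct (map (\<lambda>(u, v, \<pi>). (u, v)) (ulc_edges I)) \<and>
     (\<forall>(u, v, \<pi>) \<in> set (ulc_edges I).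
        u < v \<and> v < ulc_verts I \<and> length \<pi> = ulc_labels I \<and>
        bij_betw (\<lambda>i. \<pi> ! i) {..<ulc_labels I} {..<ulc_labels I})"

definition ulc_assignment :: "ulc \<Rightarrow> (nat \<Rightarrow> nat) \<Rightarrow> bool" where
  "ulc_assignment I a \<longleftrightarrow> (\<forall>v < ulc_verts I. a v < ulc_labels I)"

definition ulc_fraction :: "ulc \<Rightarrow> (nat \<Rightarrow> nat) \<Rightarrow> real" where
  "ulc_fraction I a =
     real (card {(u, v, \<pi>). (u, v, \<pi>) \<in> set (ulc_edges I) \<and> a v = \<pi> ! a u}) /
     real (card (set (ulc_edges I)))"

definition enc_ulc :: "ulc \<Rightarrow> bool list" where
  "enc_ulc I = enc_nat (ulc_verts I) @ enc_nat (ulc_labels I) @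
     enc_list (\<lambda>(u, v, \<pi>). enc_nat u @ enc_nat v @ enc_list enc_nat \<pi>) (ulc_edges I)"

definition ulc_yes :: "nat \<Rightarrow> real \<Rightarrow> ulc set" where
  "ulc_yes R \<epsilon> = {I. wf_ulc I \<and> ulc_labels I = R \<and>
     (\<exists>a. ulc_assignment I a \<and> ulc_fraction I a \<ge> 1 - \<epsilon>)}"

definition ulc_no :: "nat \<Rightarrow> real \<Rightarrow> ulc set" where
  "ulc_no R \<epsilon> = {I. wf_ulc I \<and> ulc_labels I = R \<and>
     (\<forall>a. ulc_assignment I a \<longrightarrow> ulc_fraction I a \<le> \<epsilon>)}"

definition unique_games_conjecture :: bool where
  "unique_games_conjecture \<longleftrightarrow>
     (\<forall>\<epsilon> > 0. \<exists>R. np_hard_to_distinguish (enc_ulc ` ulc_yes R \<epsilon>) (enc_ulc ` ulc_no R \<epsilon>))"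


section \<open>Crosswords\<close>

datatype direction = Horizontal | Vertical

record slot =
  slot_dir :: direction
  slot_row :: nat
  slot_col :: nat
  slot_len :: nat

text \<open>The \<open>i\<close>-th cell of a slot, as a pair of row and column; rows are numbered downwards.\<close>

definition slot_cell :: "slot \<Rightarrow> nat \<Rightarrow> nat \<times> nat" where
  "slot_cell s i = (case slot_dir s of
      Horizontal \<Rightarrow> (slot_row s, slot_col s + i)
    | Vertical \<Rightarrow> (slot_row s + i, slot_col s))"

definition slot_cells :: "slot \<Rightarrow> (nat \<times> nat) set" where
  "slot_cells s = slot_cell s ` {..<slot_len s}"

record crossword =
  cw_rows :: nat
  cw_cols :: nat
  cw_dict :: "nat list list"
  cw_slots :: "slot list"

text \<open>Instances without cells are excluded, as fractions of their cells are meaningless.\<close>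

definition wf_crossword :: "nat set \<Rightarrow> crossword \<Rightarrow> bool" where
  "wf_crossword \<Sigma> C \<longleftrightarrow>
     (\<forall>w \<in> set (cw_dict C). set w \<subseteq> \<Sigma>) \<and>
     cw_slots C \<noteq> [] \<and> distinct (cw_slots C) \<and>
     (\<forall>s \<in> set (cw_slots C). slot_len s \<ge> 1 \<and>
        slot_cells s \<subseteq> {..<cw_rows C} \<times> {..<cw_cols C}) \<and>
     (\<forall>s \<in> set (cw_slots C). \<forall>t \<in> set (cw_slots C).
        s \<noteq> t \<and> slot_dir s = slot_dir t \<longrightarrow> slot_cells s \<inter> slot_cells t = {})"

definition distinct_lengths :: "crossword \<Rightarrow> bool" where
  "distinct_lengths C \<longleftrightarrow> inj_on slot_len (set (cw_slots C))"

definition valid_solution :: "crossword \<Rightarrow> (slot \<Rightarrow> nat list option) \<Rightarrow> bool" where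
  "valid_solution C a \<longleftrightarrow>
     (\<forall>s \<in> set (cw_slots C). \<forall>w. a s = Some w \<longrightarrow> w \<in> set (cw_dict C) \<and> length w = slot_len s) \<and>
     (\<forall>s \<in> set (cw_slots C). \<forall>t \<in> set (cw_slots C). \<forall>w w' i j.
        a s = Some w \<and> a t = Some w' \<and> i < slot_len s \<and> j < slot_len t \<and>
        slot_cell s i = slot_cell t j \<longrightarrow> w ! i = w' ! j)"

definition cw_cells :: "crossword \<Rightarrow> (nat \<times> nat) set" where
  "cw_cells C = (\<Union>s \<in> set (cw_slots C). slot_cells s)"

definition filled_cells :: "crossword \<Rightarrow> (slot \<Rightarrow> nat list option) \<Rightarrow> (nat \<times> nat) set" where
  "filled_cells C a = (\<Union>s \<in> {s \<in> set (cw_slots C). a s \<noteq> None}. slot_cells s)"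

definition filled_fraction :: "crossword \<Rightarrow> (slot \<Rightarrow> nat list option) \<Rightarrow> real" where
  "filled_fraction C a = real (card (filled_cells C a)) / real (card (cw_cells C))"

definition enc_slot :: "slot \<Rightarrow> bool list" where
  "enc_slot s = (slot_dir s = Vertical) #
     enc_nat (slot_row s) @ enc_nat (slot_col s) @ enc_nat (slot_len s)"

definition enc_crossword :: "crossword \<Rightarrow> bool list" where
  "enc_crossword C = enc_nat (cw_rows C) @ enc_nat (cw_cols C) @
     enc_list (enc_list enc_nat) (cw_dict C) @ enc_list enc_slot (cw_slots C)"

definition crossword_yes :: "nat set \<Rightarrow> real \<Rightarrow> crossword set" where
  "crossword_yes \<Sigma> \<epsilon> = {C. wf_crossword \<Sigma> C \<and>
     (\<exists>a. valid_solution C a \<and> filled_fraction C a \<ge> 1 - \<epsilon>)}"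

definition crossword_no :: "nat set \<Rightarrow> real \<Rightarrow> crossword set" where
  "crossword_no \<Sigma> \<epsilon> = {C. wf_crossword \<Sigma> C \<and>
     (\<forall>a. valid_solution C a \<longrightarrow> filled_fraction C a \<le> 1 / 2 + \<epsilon>)}"

end

(*
  Let e_0, ..., e_(m-1) be the constraints of a label cover instance. Constraint i gets a
  row slot and a column slot which cross in the cell (i, i), and each label a of its first vertex
  gives one word for either slot: its j-th letter, for j < m, is the label that a and the permutation
  assign to the vertex which e_i shares with e_j (and a itself for j = i), and padding follows. The
  slots have distinct lengths, about K m for a large constant K, so that words cannot migrate between
  slots and almost all cells lie in a single slot.

  An assignment satisfying all but a delta-fraction of the constraints fills both slots of each
  satisfied one. Conversely, if both slots are filled for the constraints in a set D, then the
  crossings force the words of D to agree on all vertices, so they define an assignment satisfying D;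
  in the No case thus |D| <= delta m, and at most (1 + delta) m of the 2 m slots are filled. This
  needs neither expansion nor a strengthened form of the conjecture.

  For polynomial time, a while language over stacks is compiled to Turing machines, and the machine
  of the reduction is run after the one provided by the conjecture.
*)

theory Submission
  imports Defs "HOL-Library.Cardinality"
begin

text \<open>The bound 1/2 comes from the geometry. Row slots never meet each other, so whenever
  there is a label at all, every one of them can be filled whatever the constraints say, and they
  hold about half of the cells. Soundness has to come from constraints with both slots filled, which
  is why each constraint is written down twice. The crossing on the diagonal ties the two copies to
  one label; the crossing of row i with column j then compares what constraints i and j say about
  their common vertex. This vertex is unique for distinct edges of a simple graph, so one letter per
  pair suffices. Edges without a common vertex both write 0 there, which is always consistent.

  A slot has at most (K + 3) m cells and the grid at least (2 K + 2) m^2, so c m slots cover at most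
  the fraction c (K + 3) / (2 K + 2) of the cells, close to c / 2 for large K. Only labels occur as
  letters, so the alphabet depends on R alone and hence on \<epsilon>; the dictionary is of
  polynomial size because it has two words per constraint and label.\<close>

section \<open>Composing Turing machines\<close>

lemma tm_step_halted: "q \<ge> tm_states M \<Longrightarrow> (tm_step M ^^ t) (q, tps) = (q, tps)"
  by (induction t) (auto simp: tm_step_def)

text \<open>In a sequential composition the halting state of the first machine is the initial state
  of the second, so the first machine can be followed only up to the first time it halts. Since a
  halted machine stays put, the tapes at that time are already the final ones.\<close>

lemma steps_until_halt:
  assumes "(tm_step M ^^ t) c = (tm_states M, tps)"
  obtains t' where "t' \<le> t" "(tm_step M ^^ t') c = (tm_states M, tps)"
    "\<And>j. j < t' \<Longrightarrow> fst ((tm_step M ^^ j) c) \<noteq> tm_states M"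
proof -
  define t' where "t' = (LEAST j. fst ((tm_step M ^^ j) c) = tm_states M)"
  have ex: "fst ((tm_step M ^^ t) c) = tm_states M" using assms by simp
  have h: "fst ((tm_step M ^^ t') c) = tm_states M"
    unfolding t'_def using ex by (rule LeastI)
  have le: "t' \<le> t" unfolding t'_def using ex by (rule Least_le)
  obtain tps' where tps': "(tm_step M ^^ t') c = (tm_states M, tps')"
    using h by (metis prod.collapse)
  have "(tm_step M ^^ t) c = (tm_step M ^^ (t - t')) ((tm_step M ^^ t') c)"
    using le by (metis add_diff_inverse_nat funpow_add linorder_not_less o_apply add.commute)
  hence "tps' = tps" using assms tps' by (simp add: tm_step_halted)
  moreover have "fst ((tm_step M ^^ j) c) \<noteq> tm_states M" if "j < t'" for j
    using not_less_Least[of j "\<lambda>j. fst ((tm_step M ^^ j) c) = tm_states M"] that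
    unfolding t'_def by blast
  ultimately show ?thesis using that le tps' by blast
qed

section \<open>Valid configurations and the length of the output\<close>

definition valid_config :: "tm \<Rightarrow> config \<Rightarrow> bool" where
  "valid_config M = (\<lambda>(q, tps). q \<le> tm_states M \<and> length tps = tm_tapes M \<and>
     (\<forall>(c, h) \<in> set tps. \<forall>i. c i < tm_symbols M))"

lemma valid_config_read:
  "valid_config M (q, tps) \<Longrightarrow>
    length (map tape_read tps) = tm_tapes M \<and> set (map tape_read tps) \<subseteq> {..<tm_symbols M}"
  by (auto simp: valid_config_def tape_read_def)

lemma wf_tmI:
  assumes "tm_tapes M \<ge> 1" "tm_symbols M \<ge> 3"
    and "\<And>q syms q' acts. q < tm_states M \<Longrightarrow> length syms = tm_tapes M \<Longrightarrow>
      set syms \<subseteq> {..<tm_symbols M} \<Longrightarrow> tm_delta M q syms = (q', acts) \<Longrightarrow>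
      q' \<le> tm_states M \<and> length acts = tm_tapes M \<and> fst ` set acts \<subseteq> {..<tm_symbols M}"
  shows "wf_tm M"
proof -
  have "case tm_delta M q syms of (q', acts) \<Rightarrow>
      q' \<le> tm_states M \<and> length acts = tm_tapes M \<and> fst ` set acts \<subseteq> {..<tm_symbols M}"
    if "q < tm_states M \<and> length syms = tm_tapes M \<and> set syms \<subseteq> {..<tm_symbols M}" for q syms
    using assms(3)[OF _ _ _ prod.collapse[symmetric], of q syms] that by (simp add: case_prod_beta)
  thus ?thesis using assms(1,2) unfolding wf_tm_def by blast
qed

lemma wf_tm_delta:
  assumes "wf_tm M" "q < tm_states M" "length syms = tm_tapes M" "set syms \<subseteq> {..<tm_symbols M}"
    and "tm_delta M q syms = (q', acts)"
  shows "q' \<le> tm_states M" "length acts = tm_tapes M" "fst ` set acts \<subseteq> {..<tm_symbols M}"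
  using assms(1)[unfolded wf_tm_def, THEN conjunct2, THEN conjunct2, THEN spec, THEN spec,
      of q syms] assms(2-)
  by simp_all

lemma valid_config_step:
  assumes "wf_tm M" "valid_config M c"
  shows "valid_config M (tm_step M c)"
proof -
  obtain q tps where c: "c = (q, tps)" by force
  show ?thesis
  proof (cases "q < tm_states M")
    case True
    obtain q' acts where d: "tm_delta M q (map tape_read tps) = (q', acts)" by force
    have r: "length (map tape_read tps) = tm_tapes M" "set (map tape_read tps) \<subseteq> {..<tm_symbols M}"
      using valid_config_read assms(2) c by blast+
    note w = wf_tm_delta[OF assms(1) True r d]
    have "\<forall>(c, h) \<in> set (map2 tape_act acts tps). \<forall>i. c i < tm_symbols M"
    proof -
      have "\<forall>i. fst (tape_act a tp) i < tm_symbols M"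
        if "(a, tp) \<in> set (zip acts tps)" for a tp
      proof -
        have "a \<in> set acts" "tp \<in> set tps" using that by (auto dest: set_zip_leftD set_zip_rightD)
        hence "fst a < tm_symbols M" "\<forall>i. fst tp i < tm_symbols M"
          using w(3) assms(2) unfolding c valid_config_def by auto
        thus ?thesis by (auto simp: tape_act_def split: prod.splits)
      qed
      hence "\<forall>tp \<in> set (map2 tape_act acts tps). \<forall>i. fst tp i < tm_symbols M" by auto
      thus ?thesis by (simp add: case_prod_beta)
    qed
    then show ?thesis using True w d assms(2) r unfolding c tm_step_def valid_config_def by simp
  next
    case False
    then show ?thesis using assms c by (simp add: tm_step_def)
  qed
qed

lemma valid_config_steps:
  "wf_tm M \<Longrightarrow> valid_config M c \<Longrightarrow> valid_config M ((tm_step M ^^ t) c)"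
  by (induction t) (auto intro: valid_config_step)

lemma valid_init_config: "wf_tm M \<Longrightarrow> valid_config M (init_config M x)"
  by (auto simp: valid_config_def init_config_def wf_tm_def word_tape_def)

text \<open>The head moves at most one cell per step, which bounds the length of the output.\<close>

lemma first_tape_support:
  "case snd ((tm_step M ^^ t) (0, word_tape x # tps)) of [] \<Rightarrow> True
     | (c, h) # _ \<Rightarrow> h \<le> int t \<and> (\<forall>i. i \<ge> int (length x + t) \<longrightarrow> c i = 0)"
proof (induction t)
  case 0
  then show ?case by (auto simp: word_tape_def)
next
  case (Suc t)
  obtain q tps' where c: "(tm_step M ^^ t) (0, word_tape x # tps) = (q, tps')" by force
  show ?case
  proof (cases "q < tm_states M \<and> tps' \<noteq> []")
    case True
    then obtain cc h rest where tps': "tps' = (cc, h) # rest" by (cases tps') auto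
    obtain q' acts where d: "tm_delta M q (map tape_read tps') = (q', acts)" by force
    have IH: "h \<le> int t" "\<And>i. i \<ge> int (length x + t) \<Longrightarrow> cc i = 0"
      using Suc c tps' by auto
    show ?thesis
    proof (cases acts)
      case Nil
      then show ?thesis using c d True by (simp add: tm_step_def)
    next
      case (Cons a as)
      obtain s m where a: "a = (s, m)" by force
      have "move_head m h \<le> int (Suc t)" using IH(1) by (cases m) auto
      then show ?thesis using c d True Cons a IH tps' by (simp add: tm_step_def tape_act_def)
    qed
  next
    case False
    then have "snd ((tm_step M ^^ Suc t) (0, word_tape x # tps)) = tps'"
      using c by (auto simp: tm_step_def split: prod.splits)
    then show ?thesis using Suc c by (cases tps') auto
  qed
qed

text \<open>If \<open>y\<close> were longer, its last bit would lie in a cell that is still blank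
  after \<open>t\<close> steps, and the symbols of the bits differ from the blank.\<close>

lemma length_output_le:
  assumes "(tm_step M ^^ t) (init_config M x) = (q, word_tape y # tps)"
  shows "length y \<le> length x + t"
proof (rule ccontr)
  assume "\<not> ?thesis"
  hence l: "int (length x + t) \<le> int (length y) - 1" "length y > 0" by auto
  have "fst (word_tape y) (int (length y) - 1) = 0"
    using first_tape_support[where t = t and M = M and x = x
        and tps = "replicate (tm_tapes M - 1) (word_tape [])"] assms l
    by (auto simp: init_config_def split: prod.splits)
  thus False using l by (auto simp: word_tape_def split: if_splits)
qed

lemma poly_nat_mono: "m \<le> n \<Longrightarrow> poly p m \<le> poly (p :: nat poly) n"
  by (induction p) (auto intro: add_mono mult_mono)

section \<open>Sequential composition of two machines\<close>

definition keep_acts :: "nat list \<Rightarrow> (nat \<times> move) list" where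
  "keep_acts = map (\<lambda>s. (s, Stay))"

lemma tape_act_keep [simp]: "tape_act (tape_read tp, Stay) tp = tp"
  by (cases tp) (auto simp: tape_act_def tape_read_def)

lemma map2_keep_acts [simp]: "map2 tape_act (keep_acts (map tape_read tps)) tps = tps"
  by (induction tps) (auto simp: keep_acts_def)

lemma length_keep_acts [simp]: "length (keep_acts syms) = length syms"
  by (simp add: keep_acts_def)

lemma fst_keep_acts [simp]: "fst ` set (keep_acts syms) = set syms"
  by (force simp: keep_acts_def)

text \<open>Well-formedness of a composed machine concerns all tuples over the larger of the two
  alphabets, and \<open>wf_tm\<close> says nothing about a component on symbols foreign to it. On
  those the component is made to halt.\<close>

definition safe_delta :: "tm \<Rightarrow> nat \<Rightarrow> nat list \<Rightarrow> nat \<times> (nat \<times> move) list" where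
  "safe_delta M q syms =
     (if q < tm_states M \<and> set syms \<subseteq> {..<tm_symbols M} then tm_delta M q syms
      else (tm_states M, keep_acts syms))"

lemma safe_delta_wf:
  assumes "wf_tm M" "length syms = tm_tapes M" "safe_delta M q syms = (q', acts)"
  shows "q' \<le> tm_states M" "length acts = tm_tapes M"
    "fst ` set acts \<subseteq> {..<tm_symbols M} \<union> set syms"
proof -
  have "q' \<le> tm_states M \<and> length acts = tm_tapes M \<and> fst ` set acts \<subseteq> {..<tm_symbols M} \<union> set syms"
  proof (cases "q < tm_states M \<and> set syms \<subseteq> {..<tm_symbols M}")
    case True
    hence "tm_delta M q syms = (q', acts)" using assms(3) by (simp add: safe_delta_def)
    from wf_tm_delta[OF assms(1) _ assms(2) _ this] True show ?thesis by blast
  next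
    case False
    hence "q' = tm_states M" "acts = keep_acts syms"
      using assms(3) unfolding safe_delta_def by (simp_all only: if_False prod.inject)
    thus ?thesis using assms(2) by simp
  qed
  thus "q' \<le> tm_states M" "length acts = tm_tapes M"
    "fst ` set acts \<subseteq> {..<tm_symbols M} \<union> set syms" by blast+
qed

text \<open>The first tape is shared; the second machine uses fresh work tapes, as nothing is known
  about the contents the first one leaves on its own.\<close>

definition seq_tm :: "tm \<Rightarrow> tm \<Rightarrow> tm" where
  "seq_tm M N = \<lparr>tm_tapes = tm_tapes M + tm_tapes N - 1,
     tm_states = tm_states M + tm_states N,
     tm_symbols = max (tm_symbols M) (tm_symbols N),
     tm_delta = (\<lambda>q syms.
       if q < tm_states M
       then (case safe_delta M q (take (tm_tapes M) syms) of (q', acts) \<Rightarrow>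
         (q', acts @ keep_acts (drop (tm_tapes M) syms)))
       else (case safe_delta N (q - tm_states M) (hd syms # drop (tm_tapes M) syms) of (q', acts) \<Rightarrow>
         (q' + tm_states M,
          hd acts # keep_acts (tl (take (tm_tapes M) syms)) @ tl acts)))\<rparr>"

lemma wf_seq_tm:
  assumes "wf_tm M" "wf_tm N"
  shows "wf_tm (seq_tm M N)"
proof -
  have M: "tm_tapes M \<ge> 1" "tm_symbols M \<ge> 3" and N: "tm_tapes N \<ge> 1"
    using assms by (auto simp: wf_tm_def)
  have "q' \<le> tm_states (seq_tm M N) \<and> length acts = tm_tapes (seq_tm M N) \<and>
      fst ` set acts \<subseteq> {..<tm_symbols (seq_tm M N)}"
    if q: "q < tm_states (seq_tm M N)" and l: "length syms = tm_tapes (seq_tm M N)"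
      and s: "set syms \<subseteq> {..<tm_symbols (seq_tm M N)}"
      and d: "tm_delta (seq_tm M N) q syms = (q', acts)" for q syms q' acts
  proof -
    obtain s0 ss where syms: "syms = s0 # ss" using l M N by (cases syms) (auto simp: seq_tm_def)
    show ?thesis
    proof (cases "q < tm_states M")
      case True
      obtain q1 a1 where 1: "safe_delta M q (take (tm_tapes M) syms) = (q1, a1)" by force
      have len: "length (take (tm_tapes M) syms) = tm_tapes M"
        using l N by (simp add: seq_tm_def)
      note w = safe_delta_wf[OF assms(1) len 1]
      have q': "q' = q1" and acts: "acts = a1 @ keep_acts (drop (tm_tapes M) syms)"
        using d True 1 by (auto simp: seq_tm_def)
      have "set (take (tm_tapes M) syms) \<subseteq> set syms" "set (drop (tm_tapes M) syms) \<subseteq> set syms"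
        by (rule set_take_subset set_drop_subset)+
      moreover have "{..<tm_symbols M} \<subseteq> {..<tm_symbols (seq_tm M N)}" by (simp add: seq_tm_def)
      ultimately have "fst ` set a1 \<union> set (drop (tm_tapes M) syms) \<subseteq> {..<tm_symbols (seq_tm M N)}"
        using w(3) s by (meson Un_least subset_trans)
      moreover have "fst ` set acts = fst ` set a1 \<union> set (drop (tm_tapes M) syms)"
        by (simp add: acts image_Un)
      moreover have "length acts = tm_tapes (seq_tm M N)"
        unfolding acts using w(2) l M N by (simp add: seq_tm_def)
      ultimately show ?thesis using w(1) q' by (simp add: seq_tm_def)
    next
      case False
      obtain q1 a1 where 1: "safe_delta N (q - tm_states M) (hd syms # drop (tm_tapes M) syms) = (q1, a1)"
        by force
      have len: "length (hd syms # drop (tm_tapes M) syms) = tm_tapes N"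
        using l N M by (simp add: seq_tm_def)
      note w = safe_delta_wf[OF assms(2) len 1]
      obtain b bs where a1: "a1 = b # bs" using w N by (cases a1) auto
      have q': "q' = q1 + tm_states M" and
        acts: "acts = b # keep_acts (tl (take (tm_tapes M) syms)) @ bs"
        using d False 1 a1 by (auto simp: seq_tm_def)
      have "set (tl (take (tm_tapes M) syms)) \<subseteq> set syms"
        using set_take_subset[of "tm_tapes M - 1" ss] unfolding syms by (auto simp: tl_take)
      moreover have "set (hd syms # drop (tm_tapes M) syms) \<subseteq> set syms"
        using set_drop_subset[of "tm_tapes M" syms] unfolding syms by auto
      moreover have "{..<tm_symbols N} \<subseteq> {..<tm_symbols (seq_tm M N)}" by (simp add: seq_tm_def)
      ultimately have "fst ` set a1 \<union> set (tl (take (tm_tapes M) syms)) \<subseteq> {..<tm_symbols (seq_tm M N)}"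
        using w(3) s by (meson Un_least subset_trans)
      moreover have "fst ` set acts = fst ` set a1 \<union> set (tl (take (tm_tapes M) syms))"
        unfolding acts a1 by (simp add: image_Un Un_commute)
      moreover have "length acts = tm_tapes (seq_tm M N)"
        unfolding acts using w(2) a1 l M N by (simp add: seq_tm_def)
      ultimately show ?thesis using w(1) q' by (simp add: seq_tm_def)
    qed
  qed
  moreover have "tm_tapes (seq_tm M N) \<ge> 1" "tm_symbols (seq_tm M N) \<ge> 3"
    using M N by (auto simp: seq_tm_def)
  ultimately show ?thesis by (intro wf_tmI) blast+
qed

lemma safe_delta_valid:
  "valid_config M (q, tps) \<Longrightarrow> q < tm_states M \<Longrightarrow>
    safe_delta M q (map tape_read tps) = tm_delta M q (map tape_read tps)"
  using valid_config_read[of M q tps] by (simp add: safe_delta_def)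

lemma seq_tm_step_left:
  assumes "wf_tm M" "valid_config M (q, tps)" "q < tm_states M" "tm_step M (q, tps) = (q', tps')"
  shows "tm_step (seq_tm M N) (q, tps @ rest) = (q', tps' @ rest)"
proof -
  obtain q1 acts where d: "tm_delta M q (map tape_read tps) = (q1, acts)" by force
  have l: "length tps = tm_tapes M" using assms(2) by (simp add: valid_config_def)
  have "length acts = length tps"
    using wf_tm_delta(2)[OF assms(1,3) _ _ d] valid_config_read[OF assms(2)] by simp
  thus ?thesis using assms d l safe_delta_valid[OF assms(2,3)]
    by (auto simp: tm_step_def seq_tm_def)
qed

text \<open>\<open>junk\<close> stands for the work tapes of the first machine with whatever it left
  on them; they lie between the shared tape and the work tapes of the second machine and are written
  back unchanged.\<close>

lemma seq_tm_step_right: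
  assumes "wf_tm M" "wf_tm N" "valid_config N (q, tp # tps)" "length junk = tm_tapes M - 1"
    "tm_step N (q, tp # tps) = (q', tps')"
  shows "\<exists>tp'' tps''. tps' = tp'' # tps'' \<and>
    tm_step (seq_tm M N) (q + tm_states M, tp # junk @ tps) = (q' + tm_states M, tp'' # junk @ tps'')"
proof (cases "q < tm_states N")
  case True
  obtain q1 acts where d: "tm_delta N q (map tape_read (tp # tps)) = (q1, acts)" by force
  have "length acts = Suc (length tps)"
    using wf_tm_delta(2)[OF assms(2) True _ _ d] valid_config_read[OF assms(3)] by simp
  then obtain a as where acts: "acts = a # as" "length as = length tps" by (cases acts) auto
  have M: "tm_tapes M = Suc (length junk)" using assms by (auto simp: wf_tm_def)
  show ?thesis using assms(5) d True acts M safe_delta_valid[OF assms(3) True]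
    by (auto simp: tm_step_def seq_tm_def)
next
  case False
  hence "q = tm_states N" using assms(3) by (simp add: valid_config_def)
  then show ?thesis using assms(5) by (auto simp: tm_step_def seq_tm_def)
qed

lemma seq_tm_steps_right:
  assumes "wf_tm M" "wf_tm N" "valid_config N (q, tp # tps)" "length junk = tm_tapes M - 1"
  shows "\<exists>q' tp' tps'. (tm_step N ^^ t) (q, tp # tps) = (q', tp' # tps') \<and>
    (tm_step (seq_tm M N) ^^ t) (q + tm_states M, tp # junk @ tps) =
      (q' + tm_states M, tp' # junk @ tps')"
proof (induction t)
  case (Suc t)
  then obtain q1 tp1 tps1 where 1: "(tm_step N ^^ t) (q, tp # tps) = (q1, tp1 # tps1)"
    "(tm_step (seq_tm M N) ^^ t) (q + tm_states M, tp # junk @ tps) =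
      (q1 + tm_states M, tp1 # junk @ tps1)" by blast
  have v: "valid_config N (q1, tp1 # tps1)"
    using valid_config_steps[OF assms(2,3), of t] 1 by simp
  obtain q2 tps2 where 2: "tm_step N (q1, tp1 # tps1) = (q2, tps2)" by force
  show ?case using seq_tm_step_right[OF assms(1,2) v assms(4) 2] 1 2 by auto
qed auto

lemma seq_tm_computes:
  assumes wf: "wf_tm M" "wf_tm N"
    and M: "(tm_step M ^^ s) (init_config M x) = (tm_states M, word_tape y # tps)"
    and N: "(tm_step N ^^ t) (init_config N y) = (tm_states N, word_tape z # tps')"
  shows "\<exists>r \<le> s + t. \<exists>tps. (tm_step (seq_tm M N) ^^ r) (init_config (seq_tm M N) x) =
    (tm_states (seq_tm M N), word_tape z # tps)"
proof -
  let ?blank = "replicate (tm_tapes N - 1) (word_tape [])"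
  obtain s' where s': "s' \<le> s" "(tm_step M ^^ s') (init_config M x) = (tm_states M, word_tape y # tps)"
    "\<And>j. j < s' \<Longrightarrow> fst ((tm_step M ^^ j) (init_config M x)) \<noteq> tm_states M"
    using steps_until_halt[OF M] by blast
  have valid: "valid_config M ((tm_step M ^^ j) (init_config M x))" for j
    by (intro valid_config_steps valid_init_config wf)
  have tapes: "tm_tapes M \<ge> 1" "tm_tapes N \<ge> 1" using wf by (auto simp: wf_tm_def)
  have init: "init_config (seq_tm M N) x =
      (fst (init_config M x), snd (init_config M x) @ ?blank)"
  proof -
    have "tm_tapes M + tm_tapes N - 1 - 1 = (tm_tapes M - 1) + (tm_tapes N - 1)"
      using tapes by simp
    thus ?thesis by (simp add: init_config_def seq_tm_def replicate_add)
  qed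
  have left: "(tm_step (seq_tm M N) ^^ j) (init_config (seq_tm M N) x) =
      (fst ((tm_step M ^^ j) (init_config M x)), snd ((tm_step M ^^ j) (init_config M x)) @ ?blank)"
    if "j \<le> s'" for j
    using that
  proof (induction j)
    case 0
    then show ?case by (simp add: init)
  next
    case (Suc j)
    obtain q tps where c: "(tm_step M ^^ j) (init_config M x) = (q, tps)" by force
    have v: "valid_config M (q, tps)" using valid[of j] c by simp
    have "q < tm_states M" using v s'(3)[of j] Suc.prems c by (auto simp: valid_config_def)
    from seq_tm_step_left[OF wf(1) v this prod.collapse[symmetric]] show ?case
      using Suc c by simp
  qed
  \<comment> \<open>The assumption on \<open>M\<close> leaves the number of remaining tapes open; it
    follows from the invariance of valid configurations.\<close>
  have "valid_config M (tm_states M, word_tape y # tps)" using valid[of s'] s'(2) by simp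
  hence len: "length tps = tm_tapes M - 1" unfolding valid_config_def by auto
  have "valid_config N (0, word_tape y # ?blank)"
    using valid_init_config[OF wf(2), of y] by (simp add: init_config_def)
  from seq_tm_steps_right[OF wf this len, of t] N
  have "(tm_step (seq_tm M N) ^^ t) (tm_states M, word_tape y # tps @ ?blank) =
      (tm_states (seq_tm M N), word_tape z # tps @ tps')"
    by (auto simp: init_config_def seq_tm_def)
  moreover have "(tm_step (seq_tm M N) ^^ s') (init_config (seq_tm M N) x) =
      (tm_states M, word_tape y # tps @ ?blank)"
    using left[of s'] s'(2) by simp
  ultimately have "(tm_step (seq_tm M N) ^^ (t + s')) (init_config (seq_tm M N) x) =
      (tm_states (seq_tm M N), word_tape z # tps @ tps')"
    by (simp add: funpow_add)
  thus ?thesis using s'(1) by (intro exI[of _ "t + s'"]) auto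
qed

text \<open>Composition in which the second machine has to be correct only on values of
  \<open>f\<close>. The reduction thus never has to cope with malformed input.\<close>

theorem polytime_compose:
  assumes f: "polytime f" and wf: "wf_tm N"
    and N: "\<And>x. \<exists>t \<le> poly p (length (f x)). \<exists>tps.
      (tm_step N ^^ t) (init_config N (f x)) = (tm_states N, word_tape (h x) # tps)"
  shows "polytime h"
proof -
  obtain M q where M: "wf_tm M" "computes_within M f (poly q)"
    using f unfolding polytime_def by blast
  \<comment> \<open>The intermediate word has length at most n + q(n), the input plus the running
    time of the first machine.\<close>
  let ?r = "q + pcompose p ([:0, 1:] + q)"
  have "\<exists>t \<le> poly ?r (length x). \<exists>tps. (tm_step (seq_tm M N) ^^ t) (init_config (seq_tm M N) x) =
      (tm_states (seq_tm M N), word_tape (h x) # tps)" for x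
  proof -
    obtain s tps where s: "s \<le> poly q (length x)"
      "(tm_step M ^^ s) (init_config M x) = (tm_states M, word_tape (f x) # tps)"
      using M(2) unfolding computes_within_def by blast
    obtain t tps' where t: "t \<le> poly p (length (f x))"
      "(tm_step N ^^ t) (init_config N (f x)) = (tm_states N, word_tape (h x) # tps')"
      using N by blast
    have "length (f x) \<le> length x + poly q (length x)"
      using length_output_le[OF s(2)] s(1) by simp
    from poly_nat_mono[OF this, of p] have "s + t \<le> poly ?r (length x)"
      using s(1) t(1) by (simp add: poly_pcompose)
    thus ?thesis using seq_tm_computes[OF M(1) wf s(2) t(2)] by (meson le_trans)
  qed
  thus ?thesis unfolding polytime_def computes_within_def using wf_seq_tm[OF M(1) wf] by blast
qed

section \<open>Compiling while programs to Turing machines\<close>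

text \<open>Actions and tests are arbitrary functions of all symbols under the heads, so that each
  of them takes exactly one machine step.\<close>

datatype com =
    Act nat "nat list \<Rightarrow> nat \<times> move"
  | Seq com com (infixr ";;" 60)
  | Cond "nat list \<Rightarrow> bool" com com
  | Loop "nat list \<Rightarrow> bool" com

inductive exec :: "com \<Rightarrow> tape list \<Rightarrow> nat \<Rightarrow> tape list \<Rightarrow> bool" where
  exec_Act: "exec (Act i f) tps 1 (tps[i := tape_act (f (map tape_read tps)) (tps ! i)])"
| exec_Seq: "exec a tps s tps1 \<Longrightarrow> exec b tps1 t tps2 \<Longrightarrow> exec (a ;; b) tps (s + t) tps2"
| exec_Cond_True: "P (map tape_read tps) \<Longrightarrow> exec a tps t tps' \<Longrightarrow> exec (Cond P a b) tps (Suc t) tps'"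
| exec_Cond_False: "\<not> P (map tape_read tps) \<Longrightarrow> exec b tps t tps' \<Longrightarrow> exec (Cond P a b) tps (Suc t) tps'"
| exec_Loop_False: "\<not> P (map tape_read tps) \<Longrightarrow> exec (Loop P a) tps 1 tps"
| exec_Loop_True: "P (map tape_read tps) \<Longrightarrow> exec a tps s tps1 \<Longrightarrow> exec (Loop P a) tps1 t tps2 \<Longrightarrow>
    exec (Loop P a) tps (Suc (s + t)) tps2"

fun csize :: "com \<Rightarrow> nat" where
  "csize (Act i f) = 1"
| "csize (a ;; b) = csize a + csize b"
| "csize (Cond P a b) = Suc (csize a + csize b)"
| "csize (Loop P a) = Suc (csize a)"

text \<open>The states of the compiled command start at \<open>q\<close>, its entry, and control leaves to the
  state \<open>e\<close>.\<close>

fun compile :: "com \<Rightarrow> nat \<Rightarrow> nat \<Rightarrow> nat \<Rightarrow> nat list \<Rightarrow> nat \<times> (nat \<times> move) list" where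
  "compile (Act i f) q e st syms = (e, (keep_acts syms)[i := f syms])"
| "compile (a ;; b) q e st syms =
     (if st < q + csize a then compile a q (q + csize a) st syms
      else compile b (q + csize a) e st syms)"
| "compile (Cond P a b) q e st syms =
     (if st = q then (if P syms then Suc q else Suc q + csize a, keep_acts syms)
      else if st < Suc q + csize a then compile a (Suc q) e st syms
      else compile b (Suc q + csize a) e st syms)"
| "compile (Loop P a) q e st syms =
     (if st = q then (if P syms then Suc q else e, keep_acts syms)
      else compile a (Suc q) q st syms)"

lemma map2_keep_acts_update:
  "map2 tape_act ((keep_acts (map tape_read tps))[i := a]) tps = tps[i := tape_act a (tps ! i)]"
proof (rule nth_equalityI)
  fix j assume j: "j < length (map2 tape_act ((keep_acts (map tape_read tps))[i := a]) tps)"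
  show "map2 tape_act ((keep_acts (map tape_read tps))[i := a]) tps ! j = tps[i := tape_act a (tps ! i)] ! j"
    using j by (cases "i = j") (auto simp: keep_acts_def)
qed simp

text \<open>Only the block of states of \<open>c\<close> is constrained. The property therefore
  passes to subcommands, each with its own entry and exit, which is what the induction over
  executions needs.\<close>

definition simulates :: "tm \<Rightarrow> com \<Rightarrow> nat \<Rightarrow> nat \<Rightarrow> bool" where
  "simulates M c q e \<longleftrightarrow> q + csize c \<le> tm_states M \<and>
    (\<forall>st syms. q \<le> st \<longrightarrow> st < q + csize c \<longrightarrow> tm_delta M st syms = compile c q e st syms)"

lemma simulates_step:
  "simulates M c q e \<Longrightarrow> q \<le> st \<Longrightarrow> st < q + csize c \<Longrightarrow>
    tm_step M (st, tps) = (case compile c q e st (map tape_read tps) of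
      (q', acts) \<Rightarrow> (q', map2 tape_act acts tps))"
  by (auto simp: simulates_def tm_step_def)

lemma simulates_Seq:
  assumes "simulates M (a ;; b) q e"
  shows "simulates M a q (q + csize a)" "simulates M b (q + csize a) e"
  using assms by (auto simp: simulates_def)

lemma simulates_Cond:
  assumes "simulates M (Cond P a b) q e"
  shows "simulates M a (Suc q) e" "simulates M b (Suc q + csize a) e"
  using assms by (auto simp: simulates_def)

lemma simulates_Loop:
  assumes "simulates M (Loop P a) q e"
  shows "simulates M a (Suc q) q"
  using assms by (auto simp: simulates_def)

text \<open>\<open>exec\<close> counts machine steps exactly, so runs are joined by adding
  exponents. The body of a loop exits to the entry of the loop, where the induction hypothesis for
  the remaining rounds applies.\<close>

lemma exec_simulated:
  "exec c tps t tps' \<Longrightarrow> simulates M c q e \<Longrightarrow> (tm_step M ^^ t) (q, tps) = (e, tps')"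
proof (induction arbitrary: q e rule: exec.induct)
  case (exec_Act i f tps)
  show ?case by (simp add: simulates_step[OF exec_Act] map2_keep_acts_update)
next
  case (exec_Seq a tps s tps1 b t tps2)
  show ?case
    using exec_Seq.IH(1)[OF simulates_Seq(1)[OF exec_Seq.prems]]
      exec_Seq.IH(2)[OF simulates_Seq(2)[OF exec_Seq.prems]]
    by (simp add: funpow_add add.commute[of s t])
next
  case (exec_Cond_True P tps a t tps' b)
  show ?case using exec_Cond_True.hyps
      exec_Cond_True.IH[OF simulates_Cond(1)[OF exec_Cond_True.prems]]
    by (simp add: simulates_step[OF exec_Cond_True.prems] funpow_Suc_right del: funpow.simps)
next
  case (exec_Cond_False P tps b t tps' a)
  show ?case using exec_Cond_False.hyps
      exec_Cond_False.IH[OF simulates_Cond(2)[OF exec_Cond_False.prems]]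
    by (simp add: simulates_step[OF exec_Cond_False.prems] funpow_Suc_right del: funpow.simps)
next
  case (exec_Loop_False P tps a)
  then show ?case by (simp add: simulates_step[OF exec_Loop_False.prems])
next
  case (exec_Loop_True P tps a s tps1 t tps2)
  have "(tm_step M ^^ (t + s)) (Suc q, tps) = (e, tps2)"
    using exec_Loop_True.IH(1)[OF simulates_Loop[OF exec_Loop_True.prems]]
      exec_Loop_True.IH(2)[OF exec_Loop_True.prems] by (simp add: funpow_add)
  then show ?case using exec_Loop_True.hyps
    by (simp add: simulates_step[OF exec_Loop_True.prems] funpow_Suc_right add.commute[of s t]
        del: funpow.simps)
qed

section \<open>Well-formedness of the compiled machines\<close>

fun wf_com :: "nat \<Rightarrow> nat \<Rightarrow> com \<Rightarrow> bool" where
  "wf_com k G (Act i f) \<longleftrightarrow> (\<forall>syms. length syms = k \<longrightarrow> set syms \<subseteq> {..<G} \<longrightarrow> fst (f syms) < G)"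
| "wf_com k G (a ;; b) \<longleftrightarrow> wf_com k G a \<and> wf_com k G b"
| "wf_com k G (Cond P a b) \<longleftrightarrow> wf_com k G a \<and> wf_com k G b"
| "wf_com k G (Loop P a) \<longleftrightarrow> wf_com k G a"

lemma compile_wf:
  assumes "wf_com k G c" "q \<le> st" "st < q + csize c" "length syms = k" "set syms \<subseteq> {..<G}"
    "q + csize c \<le> n" "e \<le> n"
  shows "fst (compile c q e st syms) \<le> n \<and> length (snd (compile c q e st syms)) = k \<and>
    fst ` set (snd (compile c q e st syms)) \<subseteq> {..<G}"
  using assms
proof (induction c arbitrary: q e)
  case (Act i f)
  have "fst ` set ((keep_acts syms)[i := f syms]) \<subseteq> fst ` insert (f syms) (set (keep_acts syms))"
    by (rule image_mono) (rule set_update_subset_insert)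
  moreover have "fst (f syms) < G" using Act by simp
  ultimately show ?case using Act by auto
next
  case (Seq a b)
  then show ?case using Seq.IH(1)[of q "q + csize a"] Seq.IH(2)[of "q + csize a" e] by auto
next
  case (Cond P a b)
  then show ?case
    using Cond.IH(1)[of "Suc q" e] Cond.IH(2)[of "Suc q + csize a" e] by auto
next
  case (Loop P a)
  then show ?case using Loop.IH[of "Suc q" q] by auto
qed

definition com_tm :: "nat \<Rightarrow> nat \<Rightarrow> com \<Rightarrow> tm" where
  "com_tm k G c = \<lparr>tm_tapes = k, tm_states = csize c, tm_symbols = G,
     tm_delta = compile c 0 (csize c)\<rparr>"

lemma wf_com_tm:
  assumes "k \<ge> 1" "G \<ge> 3" "wf_com k G c"
  shows "wf_tm (com_tm k G c)"
proof (rule wf_tmI)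
  fix q syms q' acts
  assume "q < tm_states (com_tm k G c)" "length syms = tm_tapes (com_tm k G c)"
    "set syms \<subseteq> {..<tm_symbols (com_tm k G c)}" "tm_delta (com_tm k G c) q syms = (q', acts)"
  thus "q' \<le> tm_states (com_tm k G c) \<and> length acts = tm_tapes (com_tm k G c) \<and>
      fst ` set acts \<subseteq> {..<tm_symbols (com_tm k G c)}"
    using compile_wf[OF assms(3), of 0 q syms "csize c" "csize c"] by (simp add: com_tm_def)
qed (use assms in \<open>auto simp: com_tm_def\<close>)

lemma exec_com_tm:
  "exec c tps t tps' \<Longrightarrow> (tm_step (com_tm k G c) ^^ t) (0, tps) = (csize c, tps')"
  by (rule exec_simulated) (auto simp: simulates_def com_tm_def)


section \<open>Stacks on tapes\<close>

text \<open>A register holds a stack of symbols, kept on a tape whose head is on the top and which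
  grows to the left. Tape \<open>0\<close> is no register, since there absolute positions matter.\<close>

definition reg_tape :: "'r :: finite \<Rightarrow> nat" where
  "reg_tape = (SOME f. bij_betw f UNIV {1..<Suc CARD('r)})"

lemma bij_reg_tape: "bij_betw (reg_tape :: 'r :: finite \<Rightarrow> nat) UNIV {1..<Suc CARD('r)}"
proof -
  have "\<exists>f :: 'r \<Rightarrow> nat. bij_betw f UNIV {1..<Suc CARD('r)}"
    by (rule finite_same_card_bij) auto
  thus ?thesis unfolding reg_tape_def by (rule someI_ex)
qed

lemma reg_tape_bounds: "reg_tape (r :: 'r :: finite) < Suc CARD('r)" "reg_tape r \<noteq> 0"
  using bij_betwE[OF bij_reg_tape, rule_format, of r] by auto

lemma reg_tape_neq_0 [simp]: "reg_tape r \<noteq> 0" "0 < reg_tape r"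
  using reg_tape_bounds(2)[of r] by auto

lemma reg_tape_eq_iff [simp]: "reg_tape r = reg_tape s \<longleftrightarrow> r = s"
  using bij_reg_tape by (metis bij_betw_imp_inj_on injD)

definition stack_tape :: "nat list \<Rightarrow> int \<Rightarrow> tape" where
  "stack_tape xs h =
     ((\<lambda>i. if h \<le> i \<and> i < h + int (length xs) then xs ! nat (i - h) else 0), h)"

definition top_of :: "nat list \<Rightarrow> nat" where
  "top_of xs = (case xs of [] \<Rightarrow> 0 | x # _ \<Rightarrow> x)"

lemma top_of_simps [simp]: "top_of [] = 0" "top_of (x # xs) = x"
  by (auto simp: top_of_def)

lemma read_stack_tape [simp]: "tape_read (stack_tape xs h) = top_of xs"
  by (cases xs) (auto simp: tape_read_def stack_tape_def)

lemma stack_tape_push: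
  "tape_act (s, Stay) (tape_act (top_of xs, MoveLeft) (stack_tape xs h)) = stack_tape (s # xs) (h - 1)"
proof -
  have "nat (i - (h - 1)) = Suc (nat (i - h))" if "h \<le> i" for i
    using that by simp
  moreover have "i = h - 1" if "h - 1 \<le> i" "\<not> h \<le> i" for i
    using that by simp
  ultimately show ?thesis
    by (cases xs) (auto simp: tape_act_def stack_tape_def fun_eq_iff)
qed

lemma stack_tape_pop: "tape_act (0, MoveRight) (stack_tape xs h) = stack_tape (tl xs) (h + 1)"
proof (cases xs)
  case (Cons y ys)
  have "nat (i - h) = Suc (nat (i - (h + 1)))" if "h + 1 \<le> i" for i
    using that by simp
  then show ?thesis using Cons by (auto simp: tape_act_def stack_tape_def fun_eq_iff)
qed (auto simp: tape_act_def stack_tape_def fun_eq_iff)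

lemma word_tape_Nil: "word_tape [] = stack_tape [] 0"
  by (auto simp: word_tape_def stack_tape_def)

text \<open>The position of the top drifts with pushes and pops and is therefore quantified away. A
  tape is blank outside its stack, so an empty stack reads as 0 and emptiness can be tested as long
  as no 0 is pushed.\<close>

definition represents :: "tape list \<Rightarrow> tape \<times> ('r :: finite \<Rightarrow> nat list) \<Rightarrow> bool" where
  "represents tps = (\<lambda>(tp, \<sigma>). length tps = Suc CARD('r) \<and> tps ! 0 = tp \<and>
     (\<forall>r. \<exists>h. tps ! reg_tape r = stack_tape (\<sigma> r) h))"

lemma represents_read:
  "represents tps (tp, \<sigma>) \<Longrightarrow> map tape_read tps ! 0 = tape_read tp"
  "represents tps (tp, \<sigma>) \<Longrightarrow> map tape_read tps ! reg_tape r = top_of (\<sigma> r)"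
proof -
  assume a: "represents tps (tp, \<sigma>)"
  show "map tape_read tps ! 0 = tape_read tp" using a by (auto simp: represents_def)
  obtain h where "tps ! reg_tape r = stack_tape (\<sigma> r) h" using a by (auto simp: represents_def)
  thus "map tape_read tps ! reg_tape r = top_of (\<sigma> r)"
    using a reg_tape_bounds[of r] by (auto simp: represents_def)
qed

lemma represents_update:
  assumes "represents tps (tp, \<sigma>)" "tps ! reg_tape r = stack_tape (\<sigma> r) h \<Longrightarrow> tp' = stack_tape xs h'"
    "tps ! reg_tape r = stack_tape (\<sigma> r) h"
  shows "represents (tps[reg_tape r := tp']) (tp, \<sigma>(r := xs))"
proof -
  have "\<exists>h. tps[reg_tape r := tp'] ! reg_tape s = stack_tape ((\<sigma>(r := xs)) s) h" for s
    using assms reg_tape_bounds[of r] by (cases "r = s") (auto simp: represents_def nth_list_update)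
  thus ?thesis using assms reg_tape_bounds[of r] by (auto simp: represents_def nth_list_update)
qed

text \<open>In contrast to \<open>exec\<close>, the time is only an upper bound. Costs that depend
  on the data can be rounded up to polynomials in one size parameter, usually called
  \<open>L\<close>.\<close>

definition run :: "com \<Rightarrow> tape \<times> ('r :: finite \<Rightarrow> nat list) \<Rightarrow> nat \<Rightarrow> tape \<times> ('r \<Rightarrow> nat list) \<Rightarrow> bool" where
  "run c S T S' \<longleftrightarrow>
     (\<forall>tps. represents tps S \<longrightarrow> (\<exists>t \<le> T. \<exists>tps'. exec c tps t tps' \<and> represents tps' S'))"

lemma run_weaken: "run c S T S' \<Longrightarrow> T \<le> T' \<Longrightarrow> S' = S'' \<Longrightarrow> run c S T' S''"
  unfolding run_def by (meson le_trans)

lemma run_Seq: "run a S s S1 \<Longrightarrow> run b S1 t S2 \<Longrightarrow> run (a ;; b) S (s + t) S2"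
  unfolding run_def by (meson add_mono exec_Seq)

definition reg_cond :: "(('r :: finite \<Rightarrow> nat) \<Rightarrow> bool) \<Rightarrow> nat list \<Rightarrow> bool" where
  "reg_cond P syms = P (\<lambda>r. syms ! reg_tape r)"

lemma reg_cond_represents:
  "represents tps (tp, \<sigma>) \<Longrightarrow> reg_cond P (map tape_read tps) = P (\<lambda>r. top_of (\<sigma> r))"
  unfolding reg_cond_def using represents_read(2)[of tps tp \<sigma>] by presburger

definition tape0_cond :: "nat list \<Rightarrow> bool" where
  "tape0_cond syms \<longleftrightarrow> syms ! 0 \<noteq> 0"

lemma tape0_cond_represents:
  "represents tps (tp, \<sigma>) \<Longrightarrow> tape0_cond (map tape_read tps) \<longleftrightarrow> tape_read tp \<noteq> 0"
  unfolding tape0_cond_def using represents_read(1)[of tps tp \<sigma>] by presburger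

abbreviation "IfR P \<equiv> Cond (reg_cond P)"
abbreviation "WhileR P \<equiv> Loop (reg_cond P)"

lemma run_Cond:
  fixes \<sigma> :: "'r :: finite \<Rightarrow> nat list"
  assumes Q: "\<And>tps. represents tps (tp, \<sigma>) \<Longrightarrow> P (map tape_read tps) \<longleftrightarrow> Q"
    and a: "Q \<Longrightarrow> run a (tp, \<sigma>) T S'" and b: "\<not> Q \<Longrightarrow> run b (tp, \<sigma>) T S'"
  shows "run (Cond P a b) (tp, \<sigma>) (Suc T) S'"
  unfolding run_def
proof (intro allI impI)
  fix tps assume r: "represents tps (tp, \<sigma>)"
  show "\<exists>t\<le>Suc T. \<exists>tps'. exec (Cond P a b) tps t tps' \<and> represents tps' S'"
  proof (cases Q)
    case True
    with a r obtain t tps' where "t \<le> T" "exec a tps t tps'" "represents tps' S'"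
      unfolding run_def by blast
    thus ?thesis using exec_Cond_True[of P tps a t tps' b] Q[OF r] True by (meson Suc_le_mono)
  next
    case False
    with b r obtain t tps' where "t \<le> T" "exec b tps t tps'" "represents tps' S'"
      unfolding run_def by blast
    thus ?thesis using exec_Cond_False[of P tps b t tps' a] Q[OF r] False by (meson Suc_le_mono)
  qed
qed

lemma run_IfR:
  assumes "P (\<lambda>r. top_of (\<sigma> r)) \<Longrightarrow> run a (tp, \<sigma>) T S'" "\<not> P (\<lambda>r. top_of (\<sigma> r)) \<Longrightarrow> run b (tp, \<sigma>) T S'"
  shows "run (IfR P a b) (tp, \<sigma>) (Suc T) S'"
proof (rule run_Cond)
  show "reg_cond P (map tape_read tps) \<longleftrightarrow> P (\<lambda>r. top_of (\<sigma> r))" if "represents tps (tp, \<sigma>)" for tps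
    by (rule reg_cond_represents[OF that])
qed (use assms in auto)

text \<open>\<open>S i\<close> is the state after \<open>i\<close> rounds and \<open>n\<close> their
  number, which is known in every application; termination and cost then need no further
  measure.\<close>

lemma run_Loop:
  fixes S :: "nat \<Rightarrow> tape \<times> ('r :: finite \<Rightarrow> nat list)"
  assumes "\<And>i tps. i \<le> n \<Longrightarrow> represents tps (S i) \<Longrightarrow> P (map tape_read tps) \<longleftrightarrow> i < n"
    and "\<And>i. i < n \<Longrightarrow> run a (S i) T (S (Suc i))"
  shows "run (Loop P a) (S 0) (n * Suc T + 1) (S n)"
proof -
  have "run (Loop P a) (S i) ((n - i) * Suc T + 1) (S n)" if "i \<le> n" for i
    using that
  proof (induction "n - i" arbitrary: i)
    case 0
    hence "i = n" by simp
    show ?case unfolding run_def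
      using assms(1)[of n] exec_Loop_False[of P _ a] \<open>i = n\<close> by fastforce
  next
    case (Suc k)
    hence i: "i < n" by simp
    have IH: "run (Loop P a) (S (Suc i)) ((n - Suc i) * Suc T + 1) (S n)"
      using Suc.hyps(1)[of "Suc i"] Suc.hyps(2) i by simp
    show ?case unfolding run_def
    proof (intro allI impI)
      fix tps assume r: "represents tps (S i)"
      obtain s tps1 where 1: "s \<le> T" "exec a tps s tps1" "represents tps1 (S (Suc i))"
        using assms(2)[OF i] r unfolding run_def by blast
      obtain t tps2 where 2: "t \<le> (n - Suc i) * Suc T + 1" "exec (Loop P a) tps1 t tps2"
        "represents tps2 (S n)" using IH 1(3) unfolding run_def by blast
      have "exec (Loop P a) tps (Suc (s + t)) tps2"
        using assms(1)[OF less_imp_le[OF i] r] i 1 2 by (intro exec_Loop_True) auto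
      moreover have "n - i = Suc (n - Suc i)" using i by simp
      hence "Suc (s + t) \<le> (n - i) * Suc T + 1" using 1(1) 2(1) by simp
      ultimately show "\<exists>t\<le>(n - i) * Suc T + 1. \<exists>tps'. exec (Loop P a) tps t tps' \<and> represents tps' (S n)"
        using 2(3) by blast
    qed
  qed
  from this[of 0] show ?thesis by simp
qed

lemma run_WhileR:
  fixes \<sigma> :: "nat \<Rightarrow> 'r :: finite \<Rightarrow> nat list"
  assumes "\<And>i. i < n \<Longrightarrow> P (\<lambda>r. top_of (\<sigma> i r))" "\<not> P (\<lambda>r. top_of (\<sigma> n r))"
    and "\<And>i. i < n \<Longrightarrow> run a (tp i, \<sigma> i) T (tp (Suc i), \<sigma> (Suc i))"
  shows "run (WhileR P a) (tp 0, \<sigma> 0) (n * Suc T + 1) (tp n, \<sigma> n)"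
  using run_Loop[of n "\<lambda>i. (tp i, \<sigma> i)" "reg_cond P" a T] assms reg_cond_represents
  by (metis le_neq_implies_less less_irrefl)

text \<open>A tape action writes before it moves, so a push takes two steps: rewrite the old top
  while stepping left, then write the new symbol.\<close>

definition push :: "'r :: finite \<Rightarrow> nat \<Rightarrow> com" where
  "push r s = Act (reg_tape r) (\<lambda>syms. (syms ! reg_tape r, MoveLeft)) ;;
     Act (reg_tape r) (\<lambda>_. (s, Stay))"

definition push_top :: "'r :: finite \<Rightarrow> 'r \<Rightarrow> com" where
  "push_top a b = Act (reg_tape b) (\<lambda>syms. (syms ! reg_tape b, MoveLeft)) ;;
     Act (reg_tape b) (\<lambda>syms. (syms ! reg_tape a, Stay))"

definition pop :: "'r :: finite \<Rightarrow> com" where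
  "pop r = Act (reg_tape r) (\<lambda>_. (0, MoveRight))"

definition skip :: com where
  "skip = Act 0 (\<lambda>syms. (syms ! 0, Stay))"

lemma run_Act0:
  "run (Act 0 f) (tp, \<sigma>) 1 (tape_act (s, m) tp, \<sigma>)"
  if "\<And>tps. represents tps (tp, \<sigma>) \<Longrightarrow> f (map tape_read tps) = (s, m)"
  unfolding run_def
proof (intro allI impI)
  fix tps assume r: "represents tps (tp, \<sigma>)"
  hence "represents (tps[0 := tape_act (s, m) tp]) (tape_act (s, m) tp, \<sigma>)"
    by (auto simp: represents_def nth_list_update)
  moreover have "tps ! 0 = tp" using r by (simp add: represents_def)
  ultimately show "\<exists>t\<le>1. \<exists>tps'. exec (Act 0 f) tps t tps' \<and> represents tps' (tape_act (s, m) tp, \<sigma>)"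
    using exec_Act[of 0 f tps] that[OF r] by auto
qed

lemma run_skip: "run skip (tp, \<sigma>) 1 (tp, \<sigma>)"
proof -
  have "run skip (tp, \<sigma>) 1 (tape_act (tape_read tp, Stay) tp, \<sigma>)"
    unfolding skip_def by (rule run_Act0) (metis represents_read(1))
  thus ?thesis by simp
qed

lemma run_pop: "run (pop r) (tp, \<sigma>) 1 (tp, \<sigma>(r := tl (\<sigma> r)))"
  unfolding run_def
proof (intro allI impI)
  fix tps assume r: "represents tps (tp, \<sigma>)"
  then obtain h where h: "tps ! reg_tape r = stack_tape (\<sigma> r) h" by (auto simp: represents_def)
  have "represents (tps[reg_tape r := tape_act (0, MoveRight) (tps ! reg_tape r)]) (tp, \<sigma>(r := tl (\<sigma> r)))"
    by (rule represents_update[OF r _ h]) (simp add: stack_tape_pop)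
  thus "\<exists>t\<le>1. \<exists>tps'. exec (pop r) tps t tps' \<and> represents tps' (tp, \<sigma>(r := tl (\<sigma> r)))"
    using exec_Act[of "reg_tape r" "\<lambda>_. (0, MoveRight)" tps] unfolding pop_def by auto
qed

text \<open>Between the two steps of a push the head of \<open>r\<close> stands on a new cell, so
  the symbol to be pushed must not depend on what tape \<open>r\<close> shows. This is the
  assumption on \<open>f\<close>; it admits constants, tops of other registers and the symbol on
  tape 0.\<close>

lemma exec_push:
  assumes r: "represents tps (tp, \<sigma>)" and s: "\<And>syms. f (syms[reg_tape r := 0]) = f syms"
  shows "\<exists>tps'. exec (Act (reg_tape r) (\<lambda>syms. (syms ! reg_tape r, MoveLeft)) ;;
      Act (reg_tape r) (\<lambda>syms. (f syms, Stay))) tps 2 tps' \<and>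
    represents tps' (tp, \<sigma>(r := f (map tape_read tps) # \<sigma> r))"
proof -
  let ?i = "reg_tape r"
  obtain h where h: "tps ! ?i = stack_tape (\<sigma> r) h" using r by (auto simp: represents_def)
  have i: "?i < length tps" using r reg_tape_bounds by (auto simp: represents_def)
  let ?tp1 = "tape_act (top_of (\<sigma> r), MoveLeft) (tps ! ?i)"
  let ?tps1 = "tps[?i := ?tp1]"
  have "f (map tape_read ?tps1) = f ((map tape_read ?tps1)[?i := 0])" by (rule s[symmetric])
  also have "(map tape_read ?tps1)[?i := 0] = (map tape_read tps)[?i := 0]"
    by (simp add: map_update)
  also have "f \<dots> = f (map tape_read tps)" by (rule s)
  finally have f: "f (map tape_read ?tps1) = f (map tape_read tps)" .
  have "exec (Act ?i (\<lambda>syms. (syms ! ?i, MoveLeft))) tps 1 ?tps1"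
    using exec_Act[of ?i "\<lambda>syms. (syms ! ?i, MoveLeft)" tps] represents_read(2)[OF r] by simp
  moreover have "exec (Act ?i (\<lambda>syms. (f syms, Stay))) ?tps1 1
      (tps[?i := tape_act (f (map tape_read tps), Stay) ?tp1])"
    using exec_Act[of ?i "\<lambda>syms. (f syms, Stay)" ?tps1] i f by simp
  ultimately have "exec (Act ?i (\<lambda>syms. (syms ! ?i, MoveLeft)) ;; Act ?i (\<lambda>syms. (f syms, Stay))) tps (1 + 1)
      (tps[?i := tape_act (f (map tape_read tps), Stay) ?tp1])" by (rule exec_Seq)
  moreover have "represents (tps[?i := tape_act (f (map tape_read tps), Stay) ?tp1])
      (tp, \<sigma>(r := f (map tape_read tps) # \<sigma> r))"
    by (rule represents_update[OF r _ h]) (simp add: stack_tape_push)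
  ultimately show ?thesis by (auto simp: numeral_2_eq_2)
qed

lemma run_push: "run (push r s) (tp, \<sigma>) 2 (tp, \<sigma>(r := s # \<sigma> r))"
  unfolding run_def push_def using exec_push[where f = "\<lambda>_. s"] by blast

lemma run_push_top:
  assumes "a \<noteq> b"
  shows "run (push_top a b) (tp, \<sigma>) 2 (tp, \<sigma>(b := top_of (\<sigma> a) # \<sigma> b))"
  unfolding run_def push_top_def
proof (intro allI impI)
  fix tps assume r: "represents tps (tp, \<sigma>)"
  show "\<exists>t\<le>2. \<exists>tps'. exec (Act (reg_tape b) (\<lambda>syms. (syms ! reg_tape b, MoveLeft)) ;;
      Act (reg_tape b) (\<lambda>syms. (syms ! reg_tape a, Stay))) tps t tps' \<and>
      represents tps' (tp, \<sigma>(b := top_of (\<sigma> a) # \<sigma> b))"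
    using exec_push[OF r, of "\<lambda>syms. syms ! reg_tape a" b] assms represents_read(2)[OF r, of a]
    by auto
qed

lemma wf_com_push [simp]: "s < G \<Longrightarrow> wf_com (Suc CARD('r)) G (push (r :: 'r :: finite) s)"
  using reg_tape_bounds[of r] by (auto simp: push_def subset_iff)

lemma wf_com_push_top [simp]: "wf_com (Suc CARD('r)) G (push_top (a :: 'r :: finite) b)"
  using reg_tape_bounds[of a] reg_tape_bounds[of b] by (auto simp: push_top_def subset_iff)

lemma wf_com_pop [simp]: "0 < G \<Longrightarrow> wf_com k G (pop r)"
  by (auto simp: pop_def)

lemma wf_com_skip [simp]: "wf_com (Suc k) G skip"
  by (auto simp: skip_def subset_iff)


section \<open>Input and output of register programs\<close>

definition bit_sym :: "bool \<Rightarrow> nat" where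
  "bit_sym b = (if b then 2 else 1)"

text \<open>The marks let the head find its way back; the reversed input ends up in register \<open>r\<close>.\<close>

definition load :: "'r :: finite \<Rightarrow> com" where
  "load r =
     Loop tape0_cond
       ((Act (reg_tape r) (\<lambda>syms. (syms ! reg_tape r, MoveLeft)) ;;
         Act (reg_tape r) (\<lambda>syms. (syms ! 0, Stay))) ;;
        Act 0 (\<lambda>_. (3, MoveRight))) ;;
     Act 0 (\<lambda>_. (0, MoveLeft)) ;;
     Loop tape0_cond (Act 0 (\<lambda>_. (0, MoveLeft))) ;;
     Act 0 (\<lambda>_. (0, MoveRight))"

text \<open>Popping produces the output from left to right. The final walk back is needed because an
  output tape must have its head on cell 0, and the program must start on the blank tape that
  \<open>load\<close> leaves behind.\<close>

definition store :: "'r :: finite \<Rightarrow> com" where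
  "store r =
     WhileR (\<lambda>t. t r \<noteq> 0) (Act 0 (\<lambda>syms. (syms ! reg_tape r, MoveRight)) ;; pop r) ;;
     Act 0 (\<lambda>_. (0, MoveLeft)) ;;
     Loop tape0_cond (Act 0 (\<lambda>syms. (syms ! 0, MoveLeft))) ;;
     Act 0 (\<lambda>_. (0, MoveRight))"

lemma run_load:
  assumes "\<sigma> r = []"
  shows "run (load r) (word_tape x, \<sigma>) (7 * length x + 4) (word_tape [], \<sigma>(r := map bit_sym (rev x)))"
proof -
  let ?n = "length x"
  let ?tp = "\<lambda>i. ((\<lambda>j. if 0 \<le> j \<and> j < int ?n then (if j < int i then 3 else bit_sym (x ! nat j)) else 0), int i) :: tape"
  let ?S = "\<lambda>i. (?tp i, \<sigma>(r := map bit_sym (rev (take i x))))"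
  let ?body = "(Act (reg_tape r) (\<lambda>syms. (syms ! reg_tape r, MoveLeft)) ;;
         Act (reg_tape r) (\<lambda>syms. (syms ! 0, Stay))) ;; Act 0 (\<lambda>_. (3, MoveRight))"
  have body: "run ?body (?S i) (2 + 1) (?S (Suc i))" if i: "i < ?n" for i
  proof (rule run_Seq)
    show "run (Act (reg_tape r) (\<lambda>syms. (syms ! reg_tape r, MoveLeft)) ;;
         Act (reg_tape r) (\<lambda>syms. (syms ! 0, Stay))) (?S i) 2
         (?tp i, \<sigma>(r := map bit_sym (rev (take (Suc i) x))))"
      unfolding run_def
    proof (intro allI impI)
      fix tps assume r: "represents tps (?S i)"
      have "map tape_read tps ! 0 = bit_sym (x ! i)"
        using represents_read(1)[OF r] i by (simp add: tape_read_def)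
      thus "\<exists>t\<le>2. \<exists>tps'. exec (Act (reg_tape r) (\<lambda>syms. (syms ! reg_tape r, MoveLeft)) ;;
         Act (reg_tape r) (\<lambda>syms. (syms ! 0, Stay))) tps t tps' \<and>
         represents tps' (?tp i, \<sigma>(r := map bit_sym (rev (take (Suc i) x))))"
        using exec_push[OF r, of "\<lambda>syms. syms ! 0" r] reg_tape_bounds[of r] i
        by (auto simp: take_Suc_conv_app_nth)
    qed
    have tp: "tape_act (3, MoveRight) (?tp i) = ?tp (Suc i)"
      using i by (auto simp: tape_act_def fun_eq_iff)
    show "run (Act 0 (\<lambda>_. (3, MoveRight))) (?tp i, \<sigma>(r := map bit_sym (rev (take (Suc i) x)))) 1 (?S (Suc i))"
      unfolding tp[symmetric] by (rule run_Act0) simp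
  qed
  have 1: "run (Loop tape0_cond ?body) (?S 0) (?n * Suc (2 + 1) + 1) (?S ?n)"
  proof (rule run_Loop[where S = ?S])
    fix i tps assume i: "i \<le> ?n" and r: "represents tps (?S i)"
    show "tape0_cond (map tape_read tps) \<longleftrightarrow> i < ?n"
      unfolding tape0_cond_represents[OF r] using i by (auto simp: tape_read_def bit_sym_def)
  qed (rule body)
  let ?\<sigma> = "\<sigma>(r := map bit_sym (rev x))"
  \<comment> \<open>The state with \<open>i\<close> marks erased. The walk stops on the blank cell
    -1, which the last action corrects by one move to the right.\<close>
  let ?tq = "\<lambda>i. ((\<lambda>j. if 0 \<le> j \<and> j < int ?n - int i then 3 else 0), int ?n - int i - 1) :: tape"
  have 2: "run (Act 0 (\<lambda>_. (0, MoveLeft))) (?S ?n) 1 (?tq 0, ?\<sigma>)"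
  proof -
    have tp: "tape_act (0, MoveLeft) (?tp ?n) = ?tq 0"
      by (auto simp: tape_act_def fun_eq_iff)
    have "run (Act 0 (\<lambda>_. (0, MoveLeft))) (?S ?n) 1 (tape_act (0, MoveLeft) (?tp ?n), \<sigma>(r := map bit_sym (rev (take ?n x))))"
      by (rule run_Act0) simp
    thus ?thesis unfolding tp by simp
  qed
  have 3: "run (Loop tape0_cond (Act 0 (\<lambda>_. (0, MoveLeft)))) (?tq 0, ?\<sigma>) (?n * Suc 1 + 1) (?tq ?n, ?\<sigma>)"
  proof (rule run_Loop[where S = "\<lambda>i. (?tq i, ?\<sigma>)"])
    fix i tps assume i: "i \<le> ?n" and r: "represents tps (?tq i, ?\<sigma>)"
    show "tape0_cond (map tape_read tps) \<longleftrightarrow> i < ?n"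
      unfolding tape0_cond_represents[OF r] using i by (auto simp: tape_read_def)
  next
    fix i assume "i < ?n"
    hence tp: "tape_act (0, MoveLeft) (?tq i) = ?tq (Suc i)"
      by (auto simp: tape_act_def fun_eq_iff)
    show "run (Act 0 (\<lambda>_. (0, MoveLeft))) (?tq i, ?\<sigma>) 1 (?tq (Suc i), ?\<sigma>)"
      unfolding tp[symmetric] by (rule run_Act0) simp
  qed
  have 4: "run (Act 0 (\<lambda>_. (0, MoveRight))) (?tq ?n, ?\<sigma>) 1 (word_tape [], ?\<sigma>)"
  proof -
    have tp: "tape_act (0, MoveRight) (?tq ?n) = word_tape []"
      by (auto simp: tape_act_def fun_eq_iff word_tape_def)
    show ?thesis unfolding tp[symmetric] by (rule run_Act0) simp
  qed
  have "?S 0 = (word_tape x, \<sigma>)"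
    using assms by (auto simp: word_tape_def fun_eq_iff bit_sym_def)
  hence "run (load r) (word_tape x, \<sigma>) (?n * Suc (2 + 1) + 1 + (1 + (?n * Suc 1 + 1 + 1))) (word_tape [], ?\<sigma>)"
    unfolding load_def using run_Seq[OF 1 run_Seq[OF 2 run_Seq[OF 3 4]]] by simp
  thus ?thesis by (rule run_weaken) auto
qed

lemma run_store:
  assumes "\<sigma> r = map bit_sym y"
  shows "run (store r) (word_tape [], \<sigma>) (6 * length y + 4) (word_tape y, \<sigma>(r := []))"
proof -
  let ?n = "length y"
  let ?tp = "\<lambda>i. ((\<lambda>j. if 0 \<le> j \<and> j < int i then bit_sym (y ! nat j) else 0), int i) :: tape"
  let ?\<sigma> = "\<lambda>i. \<sigma>(r := map bit_sym (drop i y))"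
  have 1: "run (WhileR (\<lambda>t. t r \<noteq> 0) (Act 0 (\<lambda>syms. (syms ! reg_tape r, MoveRight)) ;; pop r))
     (?tp 0, ?\<sigma> 0) (?n * Suc (1 + 1) + 1) (?tp ?n, ?\<sigma> ?n)"
  proof (rule run_WhileR)
    fix i assume i: "i < ?n"
    have drop: "drop i y = y ! i # drop (Suc i) y" using i by (simp add: Cons_nth_drop_Suc)
    show "top_of (?\<sigma> i r) \<noteq> 0" by (simp add: drop bit_sym_def)
    have tp: "tape_act (bit_sym (y ! i), MoveRight) (?tp i) = ?tp (Suc i)"
      using i by (auto simp: tape_act_def fun_eq_iff)
    show "run (Act 0 (\<lambda>syms. (syms ! reg_tape r, MoveRight)) ;; pop r) (?tp i, ?\<sigma> i) (1 + 1)
        (?tp (Suc i), ?\<sigma> (Suc i))"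
    proof (rule run_Seq)
      show "run (Act 0 (\<lambda>syms. (syms ! reg_tape r, MoveRight))) (?tp i, ?\<sigma> i) 1 (?tp (Suc i), ?\<sigma> i)"
        unfolding tp[symmetric]
        by (rule run_Act0) (subst represents_read(2), assumption, simp add: drop)
      show "run (pop r) (?tp (Suc i), ?\<sigma> i) 1 (?tp (Suc i), ?\<sigma> (Suc i))"
        by (rule run_weaken[OF run_pop]) (auto simp: drop)
    qed
  qed simp
  let ?tq = "\<lambda>i. ((\<lambda>j. if 0 \<le> j \<and> j < int ?n then bit_sym (y ! nat j) else 0), int ?n - int i - 1) :: tape"
  let ?\<sigma>' = "\<sigma>(r := [])"
  have 2: "run (Act 0 (\<lambda>_. (0, MoveLeft))) (?tp ?n, ?\<sigma>') 1 (?tq 0, ?\<sigma>')"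
  proof -
    have tp: "tape_act (0, MoveLeft) (?tp ?n) = ?tq 0"
      by (auto simp: tape_act_def fun_eq_iff)
    show ?thesis unfolding tp[symmetric] by (rule run_Act0) simp
  qed
  have 3: "run (Loop tape0_cond (Act 0 (\<lambda>syms. (syms ! 0, MoveLeft)))) (?tq 0, ?\<sigma>') (?n * Suc 1 + 1) (?tq ?n, ?\<sigma>')"
  proof (rule run_Loop[where S = "\<lambda>i. (?tq i, ?\<sigma>')"])
    fix i tps assume i: "i \<le> ?n" and r: "represents tps (?tq i, ?\<sigma>')"
    show "tape0_cond (map tape_read tps) \<longleftrightarrow> i < ?n"
      unfolding tape0_cond_represents[OF r] using i by (auto simp: tape_read_def bit_sym_def)
  next
    fix i assume "i < ?n"
    have tp: "tape_act (tape_read (?tq i), MoveLeft) (?tq i) = ?tq (Suc i)"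
      by (auto simp: tape_act_def fun_eq_iff tape_read_def)
    show "run (Act 0 (\<lambda>syms. (syms ! 0, MoveLeft))) (?tq i, ?\<sigma>') 1 (?tq (Suc i), ?\<sigma>')"
      unfolding tp[symmetric] by (rule run_Act0) (subst represents_read(1), assumption, rule refl)
  qed
  have 4: "run (Act 0 (\<lambda>_. (0, MoveRight))) (?tq ?n, ?\<sigma>') 1 (word_tape y, ?\<sigma>')"
  proof -
    have tp: "tape_act (0, MoveRight) (?tq ?n) = word_tape y"
      by (auto simp: tape_act_def fun_eq_iff word_tape_def bit_sym_def)
    show ?thesis unfolding tp[symmetric] by (rule run_Act0) simp
  qed
  have "(?tp 0, ?\<sigma> 0) = (word_tape [], \<sigma>)"
    using assms by (auto simp: word_tape_def fun_eq_iff)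
  moreover have "?\<sigma> ?n = ?\<sigma>'" by simp
  ultimately have "run (store r) (word_tape [], \<sigma>) (?n * Suc (1 + 1) + 1 + (1 + (?n * Suc 1 + 1 + 1))) (word_tape y, ?\<sigma>')"
    unfolding store_def using run_Seq[OF 1 run_Seq[OF 2[folded \<open>?\<sigma> ?n = ?\<sigma>'\<close>]  run_Seq[OF 3 4, folded \<open>?\<sigma> ?n = ?\<sigma>'\<close>]]] by simp
  thus ?thesis by (rule run_weaken) auto
qed

text \<open>The fourth symbol is the mark that \<open>load\<close> writes. The input arrives
  reversed, with its last bit on top, and the other registers may end with any contents since only
  the first tape counts on halting. The output length is bounded separately because
  \<open>store\<close> takes time proportional to it.\<close>

theorem polytime_register_program:
  fixes c :: com and inp out :: "'r :: finite"
  assumes f: "polytime f" and G: "G \<ge> 4" and wf: "wf_com (Suc CARD('r)) G c"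
    and c: "\<And>x. \<exists>\<sigma>. run c (word_tape [], (\<lambda>_. [])(inp := map bit_sym (rev (f x)))) (poly p (length (f x)))
        (word_tape [], \<sigma>) \<and> \<sigma> out = map bit_sym (h x)"
    and len: "\<And>x. length (h x) \<le> poly q (length (f x))"
  shows "polytime h"
proof -
  let ?c = "load inp ;; c ;; store out"
  let ?k = "Suc CARD('r)"
  let ?p = "[:4, 7:] + p + smult 6 q + [:4:]"
  have "wf_com ?k G ?c"
    using wf G reg_tape_bounds[of inp] reg_tape_bounds[of out]
    by (auto simp: load_def store_def pop_def subset_iff)
  hence "wf_tm (com_tm ?k G ?c)" using G by (intro wf_com_tm) auto
  moreover have "\<exists>t\<le>poly ?p (length (f x)). \<exists>tps. (tm_step (com_tm ?k G ?c) ^^ t)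
      (init_config (com_tm ?k G ?c) (f x)) = (tm_states (com_tm ?k G ?c), word_tape (h x) # tps)" for x
  proof -
    let ?tps = "word_tape (f x) # replicate (CARD('r)) (word_tape [])"
    let ?\<sigma> = "(\<lambda>_. []) :: 'r \<Rightarrow> nat list"
    obtain \<sigma> where \<sigma>: "run c (word_tape [], ?\<sigma>(inp := map bit_sym (rev (f x)))) (poly p (length (f x)))
        (word_tape [], \<sigma>)" "\<sigma> out = map bit_sym (h x)" using c by blast
    have "represents ?tps (word_tape (f x), ?\<sigma>)"
    proof -
      have "?tps ! reg_tape (r :: 'r) = stack_tape [] 0" for r
        using reg_tape_bounds[of r] by (cases "reg_tape r") (auto simp: word_tape_Nil)
      thus ?thesis by (auto simp: represents_def)
    qed
    moreover have "run ?c (word_tape (f x), ?\<sigma>) (7 * length (f x) + 4 + (poly p (length (f x)) +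
        (6 * length (h x) + 4))) (word_tape (h x), \<sigma>(out := []))"
    proof (intro run_Seq)
      show "run (load inp) (word_tape (f x), ?\<sigma>) (7 * length (f x) + 4)
          (word_tape [], ?\<sigma>(inp := map bit_sym (rev (f x))))"
        by (rule run_load) simp
      show "run (store out) (word_tape [], \<sigma>) (6 * length (h x) + 4) (word_tape (h x), \<sigma>(out := []))"
        by (rule run_store) (rule \<sigma>(2))
    qed (rule \<sigma>(1))
    ultimately obtain t tps where t: "t \<le> 7 * length (f x) + 4 + (poly p (length (f x)) +
        (6 * length (h x) + 4))" "exec ?c ?tps t tps" "represents tps (word_tape (h x), \<sigma>(out := []))"
      unfolding run_def by blast
    obtain tps' where tps': "tps = word_tape (h x) # tps'"
      using t(3) by (cases tps) (auto simp: represents_def)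
    have "t \<le> poly ?p (length (f x))" using t(1) len[of x] by simp
    moreover have "init_config (com_tm ?k G ?c) (f x) = (0, ?tps)"
      by (simp add: init_config_def com_tm_def)
    ultimately show ?thesis using exec_com_tm[OF t(2), of ?k G] tps'
      by (auto simp: com_tm_def)
  qed
  ultimately show ?thesis by (intro polytime_compose[OF f])
qed

section \<open>Loops over unary numbers\<close>

primrec pushes :: "('r :: finite \<times> nat) list \<Rightarrow> com" where
  "pushes [] = skip"
| "pushes (p # ps) = push (fst p) (snd p) ;; pushes ps"

definition pushed :: "('r \<times> nat) list \<Rightarrow> 'r \<Rightarrow> nat list" where
  "pushed ps r = rev (map snd (filter (\<lambda>p. fst p = r) ps))"

lemma run_pushes:
  "run (pushes ps) (tp, \<sigma>) (2 * length ps + 1) (tp, \<lambda>r. pushed ps r @ \<sigma> r)"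
proof (induction ps arbitrary: \<sigma>)
  case Nil
  show ?case by (simp add: pushed_def) (rule run_weaken[OF run_skip], auto)
next
  case (Cons p ps)
  show ?case
    by (simp, rule run_weaken[OF run_Seq[OF run_push Cons.IH]]) (auto simp: pushed_def)
qed

text \<open>A unary number is a block of 2s, the symbol of \<open>True\<close>. Pushing a fixed
  string per unit is the one loop from which clearing, parsing, copying and multiplication by
  constants are derived.\<close>

definition drain :: "'r :: finite \<Rightarrow> ('r \<times> nat) list \<Rightarrow> com" where
  "drain a ps = WhileR (\<lambda>t. t a = 2) (pop a ;; pushes ps)"

lemma run_drain:
  assumes "a \<notin> fst ` set ps" "\<sigma> a = replicate n 2 @ rest" "top_of rest \<noteq> 2"
  shows "run (drain a ps) (tp, \<sigma>) (n * (2 * length ps + 3) + 1)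
    (tp, \<lambda>r. if r = a then rest else concat (replicate n (pushed ps r)) @ \<sigma> r)"
proof -
  let ?\<sigma> = "\<lambda>i r. if r = a then replicate (n - i) 2 @ rest else concat (replicate i (pushed ps r)) @ \<sigma> r"
  have "run (drain a ps) (tp, ?\<sigma> 0) (n * Suc (1 + (2 * length ps + 1)) + 1) (tp, ?\<sigma> n)"
    unfolding drain_def
  proof (rule run_WhileR[where tp = "\<lambda>_. tp"])
    fix i assume "i < n"
    hence n: "n - i = Suc (n - Suc i)" by simp
    show "top_of (?\<sigma> i a) = 2" by (simp add: n)
    have "pushed ps a = []" using assms(1) by (auto simp: pushed_def filter_empty_conv)
    thus "run (pop a ;; pushes ps) (tp, ?\<sigma> i) (1 + (2 * length ps + 1)) (tp, ?\<sigma> (Suc i))"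
      by (intro run_weaken[OF run_Seq[OF run_pop run_pushes]]) (auto simp: n fun_eq_iff)
  qed (use assms in auto)
  moreover have "?\<sigma> 0 = \<sigma>" using assms by auto
  ultimately show ?thesis by (auto elim!: run_weaken simp: algebra_simps)
qed

lemma run_clear:
  assumes "set (\<sigma> a) \<subseteq> {2}" "length (\<sigma> a) \<le> L"
  shows "run (drain a []) (tp, \<sigma>) (3 * L + 1) (tp, \<sigma>(a := []))"
proof -
  have "\<sigma> a = replicate (length (\<sigma> a)) 2 @ []" using assms(1) by (auto intro: replicate_eqI)
  from run_drain[of a "[]" \<sigma> "length (\<sigma> a)" "[]" tp, OF _ this] show ?thesis
    by (rule run_weaken) (use assms in \<open>auto simp: fun_eq_iff pushed_def\<close>)
qed

definition read_num :: "'r :: finite \<Rightarrow> ('r \<times> nat) list \<Rightarrow> com" where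
  "read_num a ps = drain a ps ;; pop a"

lemma run_read_num:
  assumes "a \<notin> fst ` set ps" "\<sigma> a = replicate n 2 @ 1 # rest" "n \<le> L" "length ps \<le> 2"
  shows "run (read_num a ps) (tp, \<sigma>) (7 * L + 2)
    (tp, \<lambda>r. if r = a then rest else concat (replicate n (pushed ps r)) @ \<sigma> r)"
proof -
  \<comment> \<open>A round with p pushes costs 2 p + 3, hence at most 7 here.\<close>
  have "n * (2 * length ps + 3) \<le> L * 7" using assms by (intro mult_mono) auto
  thus ?thesis unfolding read_num_def
    by (intro run_weaken[OF run_Seq[OF run_drain[of a ps \<sigma> n "1 # rest" tp, OF assms(1,2)] run_pop]]) (auto simp: fun_eq_iff)
qed

definition move_all :: "'r :: finite \<Rightarrow> 'r \<Rightarrow> com" where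
  "move_all a b = WhileR (\<lambda>t. t a \<noteq> 0) (push_top a b ;; pop a)"

lemma run_move_all:
  assumes "a \<noteq> b" "0 \<notin> set (\<sigma> a)" "length (\<sigma> a) \<le> L"
  shows "run (move_all a b) (tp, \<sigma>) (4 * L + 1) (tp, \<sigma>(a := [], b := rev (\<sigma> a) @ \<sigma> b))"
proof -
  let ?n = "length (\<sigma> a)"
  let ?\<sigma> = "\<lambda>i. \<sigma>(a := drop i (\<sigma> a), b := rev (take i (\<sigma> a)) @ \<sigma> b)"
  have "run (move_all a b) (tp, ?\<sigma> 0) (?n * Suc (2 + 1) + 1) (tp, ?\<sigma> ?n)"
    unfolding move_all_def
  proof (rule run_WhileR[where tp = "\<lambda>_. tp"])
    fix i assume i: "i < ?n"
    hence d: "drop i (\<sigma> a) = \<sigma> a ! i # drop (Suc i) (\<sigma> a)" by (simp add: Cons_nth_drop_Suc)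
    have "\<sigma> a ! i \<noteq> 0" using assms(2) i by (metis nth_mem)
    thus "top_of (?\<sigma> i a) \<noteq> 0" using assms(1) by (simp add: d)
    show "run (push_top a b ;; pop a) (tp, ?\<sigma> i) (2 + 1) (tp, ?\<sigma> (Suc i))"
      by (rule run_weaken[OF run_Seq[OF run_push_top[OF assms(1)] run_pop]])
         (use assms(1) i in \<open>auto simp: d fun_eq_iff take_Suc_conv_app_nth\<close>)
  qed (use assms in auto)
  moreover have "?\<sigma> 0 = \<sigma>" using assms by auto
  ultimately show ?thesis using assms by (auto elim!: run_weaken simp: algebra_simps)
qed

text \<open>The non-destructive form of \<open>drain\<close>: the scratch register \<open>z\<close>
  collects the units and hands them back.\<close>

definition per_unit :: "'r :: finite \<Rightarrow> 'r \<Rightarrow> ('r \<times> nat) list \<Rightarrow> com" where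
  "per_unit z r ps = drain r ((z, 2) # ps) ;; drain z [(r, 2)]"

lemma run_per_unit:
  assumes "z \<noteq> r" "z \<notin> fst ` set ps" "r \<notin> fst ` set ps" "set (\<sigma> r) \<subseteq> {2}" "\<sigma> z = []"
    "length (\<sigma> r) \<le> L" "length ps \<le> 2"
  shows "run (per_unit z r ps) (tp, \<sigma>) (14 * L + 2)
    (tp, \<lambda>s. concat (replicate (length (\<sigma> r)) (pushed ps s)) @ \<sigma> s)"
proof -
  let ?n = "length (\<sigma> r)"
  have r: "\<sigma> r = replicate ?n 2 @ []" using assms(4) by (auto intro: replicate_eqI)
  have p: "pushed ps r = []" "pushed ps z = []"
    using assms(2,3) by (auto simp: pushed_def filter_empty_conv)
  have ones: "concat (replicate n [x]) = replicate n x" for n and x :: nat by (induction n) auto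
  have 1: "run (drain r ((z, 2) # ps)) (tp, \<sigma>) (9 * L + 1)
     (tp, (\<lambda>s. concat (replicate ?n (pushed ps s)) @ \<sigma> s)(r := [], z := replicate ?n 2))"
  proof (rule run_weaken[OF run_drain[of r "(z, 2) # ps" \<sigma> ?n "[]" tp, OF _ r]])
    have "?n * (2 * length ((z, 2) # ps) + 3) \<le> L * 9" using assms by (intro mult_mono) auto
    thus "?n * (2 * length ((z, 2) # ps) + 3) + 1 \<le> 9 * L + 1" by simp
    show "(tp, \<lambda>s. if s = r then [] else concat (replicate ?n (pushed ((z, 2) # ps) s)) @ \<sigma> s) =
      (tp, (\<lambda>s. concat (replicate ?n (pushed ps s)) @ \<sigma> s)(r := [], z := replicate ?n 2))"
      using assms p ones by (auto simp: fun_eq_iff pushed_def)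
  qed (use assms in auto)
  have 2: "run (drain z [(r, 2)]) (tp, (\<lambda>s. concat (replicate ?n (pushed ps s)) @ \<sigma> s)(r := [], z := replicate ?n 2))
     (5 * L + 1) (tp, \<lambda>s. concat (replicate ?n (pushed ps s)) @ \<sigma> s)"
  proof (rule run_weaken[OF run_drain[where n = ?n and rest = "[]"]])
    show "(tp, \<lambda>s. if s = z then [] else concat (replicate ?n (pushed [(r, 2)] s)) @
       ((\<lambda>s. concat (replicate ?n (pushed ps s)) @ \<sigma> s)(r := [], z := replicate ?n 2)) s) =
       (tp, \<lambda>s. concat (replicate ?n (pushed ps s)) @ \<sigma> s)"
      using assms p ones r by (auto simp: fun_eq_iff pushed_def)
  qed (use assms in auto)
  show ?thesis unfolding per_unit_def by (rule run_weaken[OF run_Seq[OF 1 2]]) auto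
qed

definition copy :: "'r :: finite \<Rightarrow> 'r \<Rightarrow> 'r \<Rightarrow> com" where
  "copy z r d = per_unit z r [(d, 2)]"

lemma run_copy:
  assumes "z \<noteq> r" "z \<noteq> d" "r \<noteq> d" "set (\<sigma> r) \<subseteq> {2}" "\<sigma> z = []" "length (\<sigma> r) \<le> L"
  shows "run (copy z r d) (tp, \<sigma>) (14 * L + 2) (tp, \<sigma>(d := \<sigma> r @ \<sigma> d))"
proof -
  have "concat (replicate n [x]) = replicate n x" for n and x :: nat by (induction n) auto
  moreover have "\<sigma> r = replicate (length (\<sigma> r)) 2" using assms(4) by (auto intro: replicate_eqI)
  ultimately have "(\<lambda>s. concat (replicate (length (\<sigma> r)) (pushed [(d, 2)] s)) @ \<sigma> s) = \<sigma>(d := \<sigma> r @ \<sigma> d)"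
    by (auto simp: fun_eq_iff pushed_def)
  thus ?thesis unfolding copy_def
    by (intro run_weaken[OF run_per_unit[where L = L]]) (use assms in auto)
qed

text \<open>Units are cancelled in pairs until one number is exhausted; the numbers are equal if
  both are, and the pairs kept in \<open>z\<close> restore them. The result is pushed on top of
  \<open>f\<close>, so two tests with the same flag form a disjunction.\<close>

definition eq_test :: "'r :: finite \<Rightarrow> 'r \<Rightarrow> 'r \<Rightarrow> 'r \<Rightarrow> com" where
  "eq_test z a b f =
     WhileR (\<lambda>t. t a = 2 \<and> t b = 2) (pop a ;; pop b ;; push z 2) ;;
     IfR (\<lambda>t. t a = 0 \<and> t b = 0) (push f 2) skip ;;
     drain z [(a, 2), (b, 2)]"

lemma run_eq_test:
  assumes dist: "distinct [z, a, b, f]" and a: "\<sigma> a = replicate n 2" and b: "\<sigma> b = replicate m 2"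
    and z: "\<sigma> z = []" and L: "n \<le> L"
  shows "run (eq_test z a b f) (tp, \<sigma>) (12 * L + 5) (tp, \<sigma>(f := (if n = m then [2] else []) @ \<sigma> f))"
proof -
  have ne: "z \<noteq> a" "z \<noteq> b" "z \<noteq> f" "a \<noteq> z" "b \<noteq> z" "f \<noteq> z" "a \<noteq> b" "b \<noteq> a" "a \<noteq> f" "f \<noteq> a" "b \<noteq> f" "f \<noteq> b"
    using dist by auto
  let ?k = "min n m"
  let ?\<sigma> = "\<lambda>i. \<sigma>(a := replicate (n - i) 2, b := replicate (m - i) 2, z := replicate i 2)"
  let ?\<tau> = "(?\<sigma> ?k)(f := (if n = m then [2] else []) @ \<sigma> f)"
  have 1: "run (WhileR (\<lambda>t. t a = 2 \<and> t b = 2) (pop a ;; pop b ;; push z 2)) (tp, ?\<sigma> 0)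
      (?k * Suc (1 + (1 + 2)) + 1) (tp, ?\<sigma> ?k)"
  proof (rule run_WhileR[where tp = "\<lambda>_. tp"])
    fix i assume "i < ?k"
    hence n: "n - i = Suc (n - Suc i)" "m - i = Suc (m - Suc i)" by auto
    show "top_of (?\<sigma> i a) = 2 \<and> top_of (?\<sigma> i b) = 2" using ne by (simp add: n)
    show "run (pop a ;; pop b ;; push z 2) (tp, ?\<sigma> i) (1 + (1 + 2)) (tp, ?\<sigma> (Suc i))"
      by (rule run_weaken[OF run_Seq[OF run_pop run_Seq[OF run_pop run_push]]])
         (use ne in \<open>auto simp: n fun_eq_iff\<close>)
  next
    show "\<not> (top_of (?\<sigma> ?k a) = 2 \<and> top_of (?\<sigma> ?k b) = 2)"
      using ne by (cases "n \<le> m") auto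
  qed
  have 2: "run (IfR (\<lambda>t. t a = 0 \<and> t b = 0) (push f 2) skip) (tp, ?\<sigma> ?k) (Suc 2) (tp, ?\<tau>)"
  proof (rule run_IfR)
    have t: "top_of (replicate j 2) = 0 \<longleftrightarrow> j = 0" for j by (cases j) auto
    assume "top_of (?\<sigma> ?k a) = 0 \<and> top_of (?\<sigma> ?k b) = 0"
    hence "n = m" using ne by (auto simp: t)
    thus "run (push f 2) (tp, ?\<sigma> ?k) 2 (tp, ?\<tau>)"
      by (intro run_weaken[OF run_push]) (use ne in \<open>auto simp: fun_eq_iff\<close>)
  next
    assume "\<not> (top_of (?\<sigma> ?k a) = 0 \<and> top_of (?\<sigma> ?k b) = 0)"
    hence "n \<noteq> m" using ne by auto
    thus "run skip (tp, ?\<sigma> ?k) 2 (tp, ?\<tau>)"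
      by (intro run_weaken[OF run_skip]) (use ne in \<open>auto simp: fun_eq_iff\<close>)
  qed
  have 3: "run (drain z [(a, 2), (b, 2)]) (tp, ?\<tau>) (?k * 7 + 1)
      (tp, \<sigma>(f := (if n = m then [2] else []) @ \<sigma> f))"
  proof (rule run_weaken[OF run_drain[where n = ?k and rest = "[]"]])
    have ones: "concat (replicate j [x]) = replicate j x" for j and x :: nat by (induction j) auto
    show "(tp, \<lambda>r. if r = z then [] else concat (replicate ?k (pushed [(a, 2), (b, 2)] r)) @ ?\<tau> r) =
      (tp, \<sigma>(f := (if n = m then [2] else []) @ \<sigma> f))"
      using ne a b z by (auto simp: fun_eq_iff pushed_def ones simp flip: replicate_add)
  qed (use ne in auto)
  have "?\<sigma> 0 = \<sigma>" using a b z by (auto simp: fun_eq_iff)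
  from run_Seq[OF 1 run_Seq[OF 2 3]] show ?thesis unfolding eq_test_def \<open>?\<sigma> 0 = \<sigma>\<close>
    by (rule run_weaken) (use L in auto)
qed

text \<open>A repetition unrolled in the program text. It is used with multiples of the constant K,
  which belongs to the program and not to its input.\<close>

primrec rep_com :: "nat \<Rightarrow> com \<Rightarrow> com" where
  "rep_com 0 c = skip"
| "rep_com (Suc n) c = c ;; rep_com n c"

lemma run_rep_com:
  assumes "\<And>i. i < n \<Longrightarrow> run c (tp, \<sigma> i) T (tp, \<sigma> (Suc i))"
  shows "run (rep_com n c) (tp, \<sigma> 0) (n * T + 1) (tp, \<sigma> n)"
  using assms
proof (induction n arbitrary: \<sigma>)
  case 0
  show ?case by (simp add: run_skip[simplified])
next
  case (Suc n)
  have "run (rep_com n c) (tp, \<sigma> (Suc 0)) (n * T + 1) (tp, \<sigma> (Suc n))"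
    using Suc.IH[of "\<lambda>i. \<sigma> (Suc i)"] Suc.prems by simp
  from run_Seq[OF Suc.prems[of 0] this] show ?case by (simp add: add.assoc)
qed

lemma wf_com_rep_com [simp]: "wf_com (Suc k) G c \<Longrightarrow> wf_com (Suc k) G (rep_com n c)"
  by (induction n) auto

lemma wf_com_drain [simp]:
  "0 < G \<Longrightarrow> \<forall>p \<in> set ps. snd p < G \<Longrightarrow> wf_com (Suc CARD('r)) G (drain (r :: 'r :: finite) ps)"
proof -
  assume "0 < G" "\<forall>p \<in> set ps. snd p < G"
  hence "wf_com (Suc CARD('r)) G (pushes ps)" by (induction ps) auto
  thus ?thesis using \<open>0 < G\<close> by (simp add: drain_def)
qed

section \<open>The program of the reduction\<close>

abbreviation syms :: "bool list \<Rightarrow> nat list" where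
  "syms \<equiv> map bit_sym"

lemma syms_enc_nat [simp]: "syms (enc_nat n) = replicate n 2 @ [1]"
  by (simp add: enc_nat_def bit_sym_def)

lemma bit_sym_simps [simp]: "bit_sym True = 2" "bit_sym False = 1" "bit_sym b \<noteq> 0"
  by (auto simp: bit_sym_def)

lemma enc_list_Nil [simp]: "enc_list e [] = [False]"
  and enc_list_Cons [simp]: "enc_list e (x # xs) = True # e x @ enc_list e xs"
  by (auto simp: enc_list_def)

definition edge_ends :: "ulc_edge \<Rightarrow> bool list" where
  "edge_ends = (\<lambda>(u, v, \<pi>). enc_nat u @ enc_nat v)"

definition enc_edge :: "ulc_edge \<Rightarrow> bool list" where
  "enc_edge = (\<lambda>(u, v, \<pi>). enc_nat u @ enc_nat v @ enc_list enc_nat \<pi>)"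

text \<open>How the second edge meets the first one: \<open>3\<close> in its first vertex, \<open>4\<close> in its second vertex
  only, \<open>5\<close> not at all.\<close>

definition meet :: "ulc_edge \<Rightarrow> ulc_edge \<Rightarrow> nat" where
  "meet = (\<lambda>(u, v, \<pi>) (u', v', \<pi>').
     if u = u' \<or> u = v' then 3 else if v = u' \<or> v = v' then 4 else 5)"

text \<open>The value 0 for edges without a common vertex makes their two words agree in the
  crossing cell. It is also the padding letter; that 0 is a label too does no harm, since the labels
  are read off only where edges meet.\<close>

definition letter :: "nat \<Rightarrow> nat \<Rightarrow> nat \<Rightarrow> nat" where
  "letter a b k = (if k = 3 then a else if k = 4 then b else 0)"

definition edge_word :: "ulc_edge list \<Rightarrow> nat \<Rightarrow> ulc_edge \<Rightarrow> nat \<Rightarrow> nat list" where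
  "edge_word es n e a = map (letter a (snd (snd e) ! a)) (map (meet e) es) @ replicate n 0"

definition edge_words :: "nat \<Rightarrow> ulc_edge list \<Rightarrow> nat \<Rightarrow> nat list list" where
  "edge_words K es i = concat (map (\<lambda>a. [edge_word es (K * length es + i) (es ! i) a,
     edge_word es (Suc K * length es + i) (es ! i) a]) [0..<length (snd (snd (es ! i)))])"

text \<open>Row i meets column j at index j of the row and index i of the column, so all crossings
  lie in the first m letters. The lengths are (K + 1) m + i for rows and (K + 2) m + i for columns,
  with i < m: the quotient by m tells the direction and the remainder the constraint.\<close>

definition row_slot :: "nat \<Rightarrow> nat \<Rightarrow> nat \<Rightarrow> slot" where
  "row_slot K m i =
     \<lparr>slot_dir = Horizontal, slot_row = i, slot_col = 0, slot_len = Suc K * m + i\<rparr>"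

definition col_slot :: "nat \<Rightarrow> nat \<Rightarrow> nat \<Rightarrow> slot" where
  "col_slot K m i =
     \<lparr>slot_dir = Vertical, slot_row = 0, slot_col = i, slot_len = Suc (Suc K) * m + i\<rparr>"

definition edge_slots :: "nat \<Rightarrow> nat \<Rightarrow> nat \<Rightarrow> slot list" where
  "edge_slots K m i = [row_slot K m i, col_slot K m i]"

text \<open>The reversals match the program, which visits the constraints in their order but builds
  its output from the end. The longest slot, the last column, has (K + 3) m - 1 cells, whence the
  size of the grid.\<close>

definition edge_crossword :: "nat \<Rightarrow> ulc_edge list \<Rightarrow> crossword" where
  "edge_crossword K es = \<lparr>cw_rows = (K + 3) * length es, cw_cols = (K + 3) * length es,
     cw_dict = rev (concat (map (edge_words K es) [0..<length es])),
     cw_slots = rev (concat (map (edge_slots K (length es)) [0..<length es]))\<rparr>"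

text \<open>\<open>RIn\<close> is the reversed input, \<open>In1\<close> and \<open>In2\<close> are
  two copies of it. \<open>Ed\<close> lists the ends of all edges and \<open>Bk\<close> buffers the
  part already read. \<open>RU\<close>, \<open>RV\<close> are the ends of the current edge,
  \<open>RX\<close>, \<open>RY\<close> those of the edge it is compared with, \<open>FU\<close>,
  \<open>FV\<close> the flags of the comparison. \<open>Mk\<close> holds the results of
  \<open>meet\<close>, with \<open>Mk2\<close> as buffer. \<open>Av\<close> is the current label and
  \<open>Pv\<close> its image; \<open>Nm\<close> is the number of constraints, \<open>Ix\<close> a
  constraint index, \<open>Jx\<close> a countdown, \<open>RZ\<close> scratch.\<close>

datatype reg = RIn | In1 | In2 | Bk | Ed | RU | RV | RX | RY | RZ | FU | FV | Mk | Mk2 | Pv | Av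
  | Nm | Jx | Ix | Out

instance reg :: finite
proof
  have "UNIV = {RIn, In1, In2, Bk, Ed, RU, RV, RX, RY, RZ, FU, FV, Mk, Mk2, Pv, Av, Nm, Jx, Ix, Out}"
    using reg.exhaust by auto
  thus "finite (UNIV :: reg set)" by (metis finite.emptyI finite.insertI)
qed

subsection \<open>Comparing edges\<close>

text \<open>The ends read from \<open>Ed\<close> are also written, terminators included, to
  \<open>Bk\<close>, from which the list is restored for the next edge. Testing \<open>FU\<close>
  before \<open>FV\<close> reproduces the precedence in \<open>meet\<close>.\<close>

definition compare_edge :: com where
  "compare_edge =
     read_num Ed [(RX, 2), (Bk, 2)] ;; push Bk 1 ;; read_num Ed [(RY, 2), (Bk, 2)] ;; push Bk 1 ;;
     eq_test RZ RU RX FU ;; eq_test RZ RU RY FU ;; eq_test RZ RV RX FV ;; eq_test RZ RV RY FV ;;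
     IfR (\<lambda>t. t FU \<noteq> 0) (push Mk 3) (IfR (\<lambda>t. t FV \<noteq> 0) (push Mk 4) (push Mk 5)) ;;
     drain FU [] ;; drain FV [] ;; drain RX [] ;; drain RY []"

lemma concat_replicate_singleton [simp]: "concat (replicate n [x]) = replicate n x"
  by (induction n) auto

lemma concat_replicate_Nil [simp]: "concat (replicate n []) = []"
  by (induction n) auto

lemma set_replicate_subset [simp]: "set (replicate n x) \<subseteq> {x}"
  by auto

lemma run_compare_edge:
  assumes "\<sigma> Ed = syms (edge_ends e') @ rest" "\<sigma> RX = []" "\<sigma> RY = []" "\<sigma> RZ = []" "\<sigma> FU = []" "\<sigma> FV = []"
    and "\<sigma> RU = replicate (fst e) 2" "\<sigma> RV = replicate (fst (snd e)) 2"
    and L: "fst e \<le> L" "fst (snd e) \<le> L" "fst e' \<le> L" "fst (snd e') \<le> L"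
  shows "run compare_edge (tp, \<sigma>) (68 * L + 50)
    (tp, \<sigma>(Ed := rest, Bk := rev (syms (edge_ends e')) @ \<sigma> Bk, Mk := meet e e' # \<sigma> Mk))"
proof -
  obtain u v p u' v' p' where e: "e = (u, v, p)" "e' = (u', v', p')" by (metis prod.collapse)
  note a = assms[unfolded e edge_ends_def, simplified]
  let ?s1 = "\<sigma>(Ed := replicate v' 2 @ 1 # rest, RX := replicate u' 2, Bk := replicate u' 2 @ \<sigma> Bk)"
  let ?s2 = "?s1(Bk := 1 # replicate u' 2 @ \<sigma> Bk)"
  let ?s3 = "?s2(Ed := rest, RY := replicate v' 2, Bk := replicate v' 2 @ 1 # replicate u' 2 @ \<sigma> Bk)"
  let ?s4 = "?s3(Bk := 1 # replicate v' 2 @ 1 # replicate u' 2 @ \<sigma> Bk)"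
  let ?fu = "(if u = v' then [2] else []) @ (if u = u' then [2] else [])"
  let ?fv = "(if v = v' then [2] else []) @ (if v = u' then [2] else [])"
  let ?s5 = "?s4(FU := if u = u' then [2] else [])"
  let ?s6 = "?s5(FU := ?fu)"
  let ?s7 = "?s6(FV := if v = u' then [2] else [])"
  let ?s8 = "?s7(FV := ?fv)"
  let ?s9 = "?s8(Mk := meet e e' # \<sigma> Mk)"
  have 1: "run (read_num Ed [(RX, 2), (Bk, 2)]) (tp, \<sigma>) (7 * L + 2) (tp, ?s1)"
    by (rule run_weaken[OF run_read_num[where n = u' and rest = "replicate v' 2 @ 1 # rest" and L = L]])
       (use a in \<open>auto simp: fun_eq_iff pushed_def\<close>)
  have 2: "run (push Bk 1) (tp, ?s1) 2 (tp, ?s2)"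
    by (rule run_weaken[OF run_push]) (auto simp: fun_eq_iff)
  have 3: "run (read_num Ed [(RY, 2), (Bk, 2)]) (tp, ?s2) (7 * L + 2) (tp, ?s3)"
    by (rule run_weaken[OF run_read_num[where n = v' and rest = rest and L = L]])
       (use a in \<open>auto simp: fun_eq_iff pushed_def\<close>)
  have 4: "run (push Bk 1) (tp, ?s3) 2 (tp, ?s4)"
    by (rule run_weaken[OF run_push]) (auto simp: fun_eq_iff)
  have 5: "run (eq_test RZ RU RX FU) (tp, ?s4) (12 * L + 5) (tp, ?s5)"
    by (rule run_weaken[OF run_eq_test[where n = u and m = u' and L = L]]) (use a in \<open>auto simp: fun_eq_iff\<close>)
  have 6: "run (eq_test RZ RU RY FU) (tp, ?s5) (12 * L + 5) (tp, ?s6)"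
    by (rule run_weaken[OF run_eq_test[where n = u and m = v' and L = L]]) (use a in \<open>auto simp: fun_eq_iff\<close>)
  have 7: "run (eq_test RZ RV RX FV) (tp, ?s6) (12 * L + 5) (tp, ?s7)"
    by (rule run_weaken[OF run_eq_test[where n = v and m = u' and L = L]]) (use a in \<open>auto simp: fun_eq_iff\<close>)
  have 8: "run (eq_test RZ RV RY FV) (tp, ?s7) (12 * L + 5) (tp, ?s8)"
    by (rule run_weaken[OF run_eq_test[where n = v and m = v' and L = L]]) (use a in \<open>auto simp: fun_eq_iff\<close>)
  have 9: "run (IfR (\<lambda>t. t FU \<noteq> 0) (push Mk 3) (IfR (\<lambda>t. t FV \<noteq> 0) (push Mk 4) (push Mk 5))) (tp, ?s8)
      (Suc (Suc 2)) (tp, ?s9)"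
  proof (rule run_IfR)
    assume "top_of (?s8 FU) \<noteq> 0"
    hence "meet e e' = 3" by (auto simp: e meet_def split: if_splits)
    thus "run (push Mk 3) (tp, ?s8) (Suc 2) (tp, ?s9)"
      by (intro run_weaken[OF run_push]) (auto simp: fun_eq_iff)
  next
    assume nu: "\<not> top_of (?s8 FU) \<noteq> 0"
    show "run (IfR (\<lambda>t. t FV \<noteq> 0) (push Mk 4) (push Mk 5)) (tp, ?s8) (Suc 2) (tp, ?s9)"
    proof (rule run_IfR)
      assume "top_of (?s8 FV) \<noteq> 0"
      hence "meet e e' = 4" using nu by (auto simp: e meet_def split: if_splits)
      thus "run (push Mk 4) (tp, ?s8) 2 (tp, ?s9)"
        by (intro run_weaken[OF run_push]) (auto simp: fun_eq_iff)
    next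
      assume "\<not> top_of (?s8 FV) \<noteq> 0"
      hence "meet e e' = 5" using nu by (auto simp: e meet_def split: if_splits)
      thus "run (push Mk 5) (tp, ?s8) 2 (tp, ?s9)"
        by (intro run_weaken[OF run_push]) (auto simp: fun_eq_iff)
    qed
  qed
  \<comment> \<open>Two tests write to each flag, so it holds at most two marks.\<close>
  have 10: "run (drain FU []) (tp, ?s9) (3 * 2 + 1) (tp, ?s9(FU := []))"
    by (rule run_clear) auto
  have 11: "run (drain FV []) (tp, ?s9(FU := [])) (3 * 2 + 1) (tp, ?s9(FU := [], FV := []))"
    by (rule run_clear) auto
  have 12: "run (drain RX []) (tp, ?s9(FU := [], FV := [])) (3 * L + 1) (tp, ?s9(FU := [], FV := [], RX := []))"
    by (rule run_clear) (use a in auto)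
  have 13: "run (drain RY []) (tp, ?s9(FU := [], FV := [], RX := [])) (3 * L + 1)
      (tp, ?s9(FU := [], FV := [], RX := [], RY := []))"
    by (rule run_clear) (use a in auto)
  show ?thesis unfolding compare_edge_def
    by (rule run_weaken[OF run_Seq[OF 1 run_Seq[OF 2 run_Seq[OF 3 run_Seq[OF 4 run_Seq[OF 5
        run_Seq[OF 6 run_Seq[OF 7 run_Seq[OF 8 run_Seq[OF 9 run_Seq[OF 10 run_Seq[OF 11
        run_Seq[OF 12 13]]]]]]]]]]]]])
       (use a in \<open>auto simp: fun_eq_iff edge_ends_def e\<close>)
qed

definition compare_edges :: com where
  "compare_edges = WhileR (\<lambda>t. t Ed \<noteq> 0) compare_edge ;; move_all Bk Ed"

lemma edge_ends_neq_Nil: "top_of (syms (edge_ends e) @ xs) \<noteq> 0"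
  by (cases e; cases "fst e") (auto simp: edge_ends_def)

lemma length_edge_ends: "fst e \<le> L \<Longrightarrow> fst (snd e) \<le> L \<Longrightarrow> length (edge_ends e) \<le> 2 * L + 2"
  by (cases e) (auto simp: edge_ends_def enc_nat_def)

lemma length_concat_le:
  "(\<And>x. x \<in> set xs \<Longrightarrow> length (f x) \<le> B) \<Longrightarrow> length (concat (map f xs)) \<le> length xs * B"
proof (induction xs)
  case (Cons x xs)
  have "length (f x) \<le> B" "length (concat (map f xs)) \<le> length xs * B" using Cons by auto
  thus ?case by simp
qed simp

text \<open>\<open>L\<close> will be the length of the input, which bounds every number in it
  because numbers are encoded in unary.\<close>

definition small_edge :: "nat \<Rightarrow> ulc_edge \<Rightarrow> bool" where
  "small_edge L e \<longleftrightarrow> fst e \<le> L \<and> fst (snd e) \<le> L \<and> length (snd (snd e)) \<le> L \<and>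
     (\<forall>b \<in> set (snd (snd e)). b \<le> L)"

text \<open>\<open>Mk\<close> ends up with the comparison to the last edge on top, which is the
  order in which letters are wanted when a word is written backwards.\<close>

lemma run_compare_edges:
  assumes "\<sigma> Ed = syms (concat (map edge_ends es))" "\<sigma> Bk = []" "\<sigma> RX = []" "\<sigma> RY = []" "\<sigma> RZ = []"
    "\<sigma> FU = []" "\<sigma> FV = []" "\<sigma> RU = replicate (fst e) 2" "\<sigma> RV = replicate (fst (snd e)) 2" "\<sigma> Mk = []"
    and L: "small_edge L e" "\<forall>e' \<in> set es. small_edge L e'" "length es \<le> L"
  shows "run compare_edges (tp, \<sigma>) (L * (76 * L + 59) + 2) (tp, \<sigma>(Mk := rev (map (meet e) es)))"
proof -
  let ?m = "length es"
  let ?\<sigma> = "\<lambda>j. \<sigma>(Ed := syms (concat (map edge_ends (drop j es))),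
    Bk := rev (syms (concat (map edge_ends (take j es)))), Mk := rev (map (meet e) (take j es)))"
  have 1: "run (WhileR (\<lambda>t. t Ed \<noteq> 0) compare_edge) (tp, ?\<sigma> 0) (?m * Suc (68 * L + 50) + 1) (tp, ?\<sigma> ?m)"
  proof (rule run_WhileR[where tp = "\<lambda>_. tp"])
    fix j assume j: "j < ?m"
    hence d: "drop j es = es ! j # drop (Suc j) es" by (simp add: Cons_nth_drop_Suc)
    show "top_of (?\<sigma> j Ed) \<noteq> 0" using edge_ends_neq_Nil by (simp add: d)
    have "small_edge L (es ! j)" using L j by auto
    thus "run compare_edge (tp, ?\<sigma> j) (68 * L + 50) (tp, ?\<sigma> (Suc j))"
      by (intro run_weaken[OF run_compare_edge[where e = e and e' = "es ! j" and L = L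
            and rest = "syms (concat (map edge_ends (drop (Suc j) es)))"]])
         (use assms j in \<open>auto simp: d small_edge_def fun_eq_iff take_Suc_conv_app_nth\<close>)
  qed simp
  have "length (concat (map edge_ends es)) \<le> ?m * (2 * L + 2)"
    by (rule length_concat_le, rule length_edge_ends) (use L in \<open>auto simp: small_edge_def\<close>)
  also have "\<dots> \<le> L * (2 * L + 2)" using L by (intro mult_right_mono) auto
  finally have 2: "run (move_all Bk Ed) (tp, ?\<sigma> ?m) (4 * (L * (2 * L + 2)) + 1)
      (tp, \<sigma>(Mk := rev (map (meet e) es)))"
    by (intro run_weaken[OF run_move_all]) (use assms in \<open>auto simp: fun_eq_iff rev_map\<close>)
  have 0: "?\<sigma> 0 = \<sigma>" using assms by (auto simp: fun_eq_iff)
  have "?m * Suc (68 * L + 50) \<le> L * Suc (68 * L + 50)" using L by (intro mult_right_mono) auto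
  thus ?thesis unfolding compare_edges_def
    by (intro run_weaken[OF run_Seq[OF 1[unfolded 0] 2]]) (auto simp: algebra_simps)
qed

subsection \<open>Emitting words\<close>

text \<open>The output is produced from its end to its beginning, so that its first symbol comes to lie
  on top.\<close>

definition emit_zeros :: "reg \<Rightarrow> com" where
  "emit_zeros r = per_unit RZ r [(Out, 1), (Out, 2)]"

definition emit_letter :: com where
  "emit_letter = push Out 1 ;;
     IfR (\<lambda>t. t Mk = 3) (copy RZ Av Out) (IfR (\<lambda>t. t Mk = 4) (copy RZ Pv Out) skip) ;;
     push Out 2 ;; push_top Mk Mk2 ;; pop Mk"

text \<open>Written backwards: the terminator, the k m + i padding zeros, then the letters from last
  to first. The marks are kept in \<open>Mk2\<close> and moved back, as both words of a label and
  all later labels use them again.\<close>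

definition emit_word :: "nat \<Rightarrow> com" where
  "emit_word k = push Out 1 ;; rep_com k (emit_zeros Nm) ;; emit_zeros Ix ;;
     WhileR (\<lambda>t. t Mk \<noteq> 0) emit_letter ;; move_all Mk2 Mk ;; push Out 2"

abbreviation syms_letters :: "nat list \<Rightarrow> nat list" where
  "syms_letters ls \<equiv> concat (map (\<lambda>l. 2 # replicate l 2 @ [1]) ls)"

lemma syms_word: "syms (enc_list enc_nat w) = syms_letters w @ [1]"
  by (induction w) auto

lemma run_emit_zeros:
  assumes "r \<in> {Nm, Ix}" "\<sigma> r = replicate n 2" "\<sigma> RZ = []" "n \<le> L"
  shows "run (emit_zeros r) (tp, \<sigma>) (14 * L + 2)
    (tp, \<sigma>(Out := syms_letters (replicate n 0) @ \<sigma> Out))"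
  unfolding emit_zeros_def
  by (rule run_weaken[OF run_per_unit[where L = L]])
     (use assms in \<open>auto simp: fun_eq_iff pushed_def\<close>)

lemma run_emit_letter:
  assumes "\<sigma> Mk = k # rest" "\<sigma> Av = replicate a 2" "\<sigma> Pv = replicate b 2" "\<sigma> RZ = []" "a \<le> L" "b \<le> L"
  shows "run emit_letter (tp, \<sigma>) (14 * L + 11)
    (tp, \<sigma>(Out := syms_letters [letter a b k] @ \<sigma> Out, Mk := rest, Mk2 := k # \<sigma> Mk2))"
proof -
  let ?s1 = "\<sigma>(Out := 1 # \<sigma> Out)"
  let ?s2 = "\<sigma>(Out := replicate (letter a b k) 2 @ 1 # \<sigma> Out)"
  have 1: "run (IfR (\<lambda>t. t Mk = 3) (copy RZ Av Out) (IfR (\<lambda>t. t Mk = 4) (copy RZ Pv Out) skip))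
      (tp, ?s1) (Suc (Suc (14 * L + 2))) (tp, ?s2)"
  proof (rule run_IfR)
    assume "top_of (?s1 Mk) = 3"
    thus "run (copy RZ Av Out) (tp, ?s1) (Suc (14 * L + 2)) (tp, ?s2)"
      by (intro run_weaken[OF run_copy[where L = L]])
         (use assms in \<open>auto simp: letter_def fun_eq_iff\<close>)
  next
    assume n3: "top_of (?s1 Mk) \<noteq> 3"
    show "run (IfR (\<lambda>t. t Mk = 4) (copy RZ Pv Out) skip) (tp, ?s1) (Suc (14 * L + 2)) (tp, ?s2)"
    proof (rule run_IfR)
      assume "top_of (?s1 Mk) = 4"
      thus "run (copy RZ Pv Out) (tp, ?s1) (14 * L + 2) (tp, ?s2)"
        by (intro run_weaken[OF run_copy[where L = L]])
           (use assms in \<open>auto simp: letter_def fun_eq_iff\<close>)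
    next
      assume "top_of (?s1 Mk) \<noteq> 4"
      thus "run skip (tp, ?s1) (14 * L + 2) (tp, ?s2)"
        by (intro run_weaken[OF run_skip]) (use assms n3 in \<open>auto simp: letter_def fun_eq_iff\<close>)
    qed
  qed
  show ?thesis unfolding emit_letter_def
    by (rule run_weaken[OF run_Seq[OF run_push run_Seq[OF 1 run_Seq[OF run_push
      run_Seq[OF run_push_top run_pop]]]]]) (use assms in \<open>auto simp: fun_eq_iff\<close>)
qed

lemma run_emit_word:
  assumes "\<sigma> Mk = rev ks" "0 \<notin> set ks" "\<sigma> Mk2 = []" "\<sigma> Av = replicate a 2" "\<sigma> Pv = replicate b 2"
    "\<sigma> RZ = []" "\<sigma> Nm = replicate m 2" "\<sigma> Ix = replicate i 2"
    and L: "a \<le> L" "b \<le> L" "m \<le> L" "i \<le> L" "length ks \<le> L"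
  shows "run (emit_word k) (tp, \<sigma>) (k * (14 * L + 2) + L * (14 * L + 30) + 9)
    (tp, \<sigma>(Out := syms (True # enc_list enc_nat
       (map (letter a b) ks @ replicate (k * m + i) 0)) @ \<sigma> Out))"
proof -
  let ?o = "\<lambda>xs. \<sigma>(Out := xs @ 1 # \<sigma> Out)"
  let ?z = "\<lambda>n. syms_letters (replicate n 0)"
  have "run (rep_com k (emit_zeros Nm)) (tp, ?o (?z (0 * m))) (k * (14 * L + 2) + 1) (tp, ?o (?z (k * m)))"
  proof (rule run_rep_com)
    fix j
    show "run (emit_zeros Nm) (tp, ?o (?z (j * m))) (14 * L + 2) (tp, ?o (?z (Suc j * m)))"
      by (rule run_weaken[OF run_emit_zeros[where n = m and L = L]])
         (use assms in \<open>auto simp: fun_eq_iff replicate_add\<close>)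
  qed
  hence 1: "run (rep_com k (emit_zeros Nm)) (tp, \<sigma>(Out := 1 # \<sigma> Out)) (k * (14 * L + 2) + 1) (tp, ?o (?z (k * m)))"
    by simp
  have 2: "run (emit_zeros Ix) (tp, ?o (?z (k * m))) (14 * L + 2) (tp, ?o (?z (k * m + i)))"
    by (rule run_weaken[OF run_emit_zeros[where n = i and L = L]])
       (use assms in \<open>auto simp: fun_eq_iff replicate_add add.commute[of _ i]\<close>)
  let ?n = "length ks"
  let ?l = "\<lambda>j. syms_letters (map (letter a b) (rev (take j (rev ks)))) @ ?z (k * m + i)"
  let ?\<sigma> = "\<lambda>j. (?o (?l j))(Mk := drop j (rev ks), Mk2 := rev (take j (rev ks)))"
  have 3: "run (WhileR (\<lambda>t. t Mk \<noteq> 0) emit_letter) (tp, ?\<sigma> 0) (?n * Suc (14 * L + 11) + 1) (tp, ?\<sigma> ?n)"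
  proof (rule run_WhileR[where tp = "\<lambda>_. tp"])
    fix j assume j: "j < ?n"
    hence d: "drop j (rev ks) = rev ks ! j # drop (Suc j) (rev ks)" by (simp add: Cons_nth_drop_Suc)
    have "rev ks ! j \<noteq> 0" using assms(2) j by (metis length_rev nth_mem set_rev)
    thus "top_of (?\<sigma> j Mk) \<noteq> 0" by (simp add: d)
    show "run emit_letter (tp, ?\<sigma> j) (14 * L + 11) (tp, ?\<sigma> (Suc j))"
      by (rule run_weaken[OF run_emit_letter[where k = "rev ks ! j" and a = a and b = b and L = L
            and rest = "drop (Suc j) (rev ks)"]])
         (use assms j in \<open>auto simp: d fun_eq_iff take_Suc_conv_app_nth\<close>)
  qed simp
  have 0: "?\<sigma> 0 = ?o (?z (k * m + i))" using assms by (auto simp: fun_eq_iff)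
  have 4: "run (move_all Mk2 Mk) (tp, ?\<sigma> ?n) (4 * L + 1) (tp, ?o (?l ?n))"
    by (rule run_weaken[OF run_move_all[where L = L]]) (use assms in \<open>auto simp: fun_eq_iff\<close>)
  have "?n * Suc (14 * L + 11) \<le> L * Suc (14 * L + 11)" using L by (intro mult_right_mono) auto
  thus ?thesis unfolding emit_word_def
    by (intro run_weaken[OF run_Seq[OF run_push run_Seq[OF 1 run_Seq[OF 2 run_Seq[OF 3[unfolded 0]
          run_Seq[OF 4 run_push]]]]]])
       (auto simp: fun_eq_iff syms_word algebra_simps)
qed

subsection \<open>Emitting slots\<close>

text \<open>\<open>enc_slot\<close> backwards, the row slot before the column slot. The two adjacent
  pushes of 1 terminate the zero column and the row index of the row slot; in the column slot the
  second terminator follows the column index, since there the row is 0. The last push for each slot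
  is the list marker.\<close>

definition emit_edge_slots :: "nat \<Rightarrow> com" where
  "emit_edge_slots K =
     push Out 1 ;; rep_com (Suc K) (copy RZ Nm Out) ;; copy RZ Ix Out ;; push Out 1 ;; push Out 1 ;;
     copy RZ Ix Out ;; push Out 1 ;; push Out 2 ;;
     push Out 1 ;; rep_com (Suc (Suc K)) (copy RZ Nm Out) ;; copy RZ Ix Out ;; push Out 1 ;;
     copy RZ Ix Out ;; push Out 1 ;; push Out 2 ;; push Out 2"

lemma run_copy_Out:
  assumes "r \<in> {Nm, Ix}" "\<sigma> r = replicate n 2" "\<sigma> RZ = []" "n \<le> L"
  shows "run (copy RZ r Out) (tp, \<sigma>) (14 * L + 2) (tp, \<sigma>(Out := replicate n 2 @ \<sigma> Out))"
  by (rule run_weaken[OF run_copy[where L = L]]) (use assms in auto)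

lemma run_copies_Out:
  assumes "\<sigma> Nm = replicate m 2" "\<sigma> RZ = []" "m \<le> L"
  shows "run (rep_com k (copy RZ Nm Out)) (tp, \<sigma>) (k * (14 * L + 2) + 1)
    (tp, \<sigma>(Out := replicate (k * m) 2 @ \<sigma> Out))"
proof -
  have "run (rep_com k (copy RZ Nm Out)) (tp, \<sigma>(Out := replicate (0 * m) 2 @ \<sigma> Out)) (k * (14 * L + 2) + 1)
    (tp, \<sigma>(Out := replicate (k * m) 2 @ \<sigma> Out))"
    by (rule run_rep_com, rule run_weaken[OF run_copy_Out[where n = m and L = L]])
       (use assms in \<open>auto simp: fun_eq_iff replicate_add\<close>)
  thus ?thesis by simp
qed

lemma run_emit_edge_slots:
  assumes a: "\<sigma> Nm = replicate m 2" "\<sigma> Ix = replicate i 2" "\<sigma> RZ = []" and L: "m \<le> L" "i \<le> L"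
  shows "run (emit_edge_slots K) (tp, \<sigma>) ((2 * K + 7) * (14 * L + 2) + 22)
    (tp, \<sigma>(Out := syms (concat (map (\<lambda>s. True # enc_slot s) (rev (edge_slots K m i)))) @ \<sigma> Out))"
proof -
  have Nm: "run (rep_com k (copy RZ Nm Out)) (tp, \<sigma>(Out := xs)) (k * (14 * L + 2) + 1)
    (tp, \<sigma>(Out := replicate (k * m) 2 @ xs))" for k xs
    by (rule run_weaken[OF run_copies_Out[where m = m and L = L]]) (use assms in auto)
  have Ix: "run (copy RZ Ix Out) (tp, \<sigma>(Out := xs)) (14 * L + 2) (tp, \<sigma>(Out := replicate i 2 @ xs))" for xs
    by (rule run_weaken[OF run_copy_Out[where n = i and L = L]]) (use assms in auto)
  have p: "run (push Out s) (tp, \<sigma>(Out := xs)) 2 (tp, \<sigma>(Out := s # xs))" for s xs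
    by (rule run_weaken[OF run_push]) auto
  have "run (emit_edge_slots K) (tp, \<sigma>(Out := \<sigma> Out))
    (2 + (Suc K * (14 * L + 2) + 1 + (14 * L + 2 + (2 + (2 + (14 * L + 2 + (2 + (2 +
     (2 + (Suc (Suc K) * (14 * L + 2) + 1 + (14 * L + 2 + (2 + (14 * L + 2 + (2 + (2 + 2)))))))))))))))
    (tp, \<sigma>(Out := 2 # 2 # 1 # replicate i 2 @ 1 # replicate i 2 @ replicate (Suc (Suc K) * m) 2 @ 1 #
       2 # 1 # replicate i 2 @ 1 # 1 # replicate i 2 @ replicate (Suc K * m) 2 @ 1 # \<sigma> Out))"
    unfolding emit_edge_slots_def by (rule run_Seq p Nm Ix)+
  thus ?thesis unfolding fun_upd_triv
    by (rule run_weaken)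
       (auto simp: algebra_simps edge_slots_def row_slot_def col_slot_def enc_slot_def fun_eq_iff replicate_add replicate_app_Cons_same)
qed

definition emit_slots :: "nat \<Rightarrow> com" where
  "emit_slots K = push Out 1 ;; copy RZ Nm Jx ;;
     WhileR (\<lambda>t. t Jx = 2) (pop Jx ;; emit_edge_slots K ;; push Ix 2) ;; drain Ix []"

lemma run_emit_slots:
  assumes a: "\<sigma> Nm = replicate m 2" "\<sigma> Ix = []" "\<sigma> Jx = []" "\<sigma> RZ = []" and L: "m \<le> L"
  shows "run (emit_slots K) (tp, \<sigma>) (L * ((2 * K + 7) * (14 * L + 2) + 43) + 7)
    (tp, \<sigma>(Out := syms (enc_list enc_slot (rev (concat (map (edge_slots K m) [0..<m])))) @ \<sigma> Out))"
proof -
  let ?s = "\<lambda>i. syms (concat (map (\<lambda>s. True # enc_slot s) (rev (concat (map (edge_slots K m) [0..<i])))))"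
  let ?\<sigma> = "\<lambda>i. \<sigma>(Jx := replicate (m - i) 2, Ix := replicate i 2, Out := ?s i @ 1 # \<sigma> Out)"
  let ?B = "(2 * K + 7) * (14 * L + 2) + 22"
  have 1: "run (copy RZ Nm Jx) (tp, \<sigma>(Out := 1 # \<sigma> Out)) (14 * L + 2) (tp, ?\<sigma> 0)"
    by (rule run_weaken[OF run_copy[where L = L]]) (use assms in \<open>auto simp: fun_eq_iff\<close>)
  have 2: "run (WhileR (\<lambda>t. t Jx = 2) (pop Jx ;; emit_edge_slots K ;; push Ix 2)) (tp, ?\<sigma> 0)
      (m * Suc (1 + (?B + 2)) + 1) (tp, ?\<sigma> m)"
  proof (rule run_WhileR[where tp = "\<lambda>_. tp"])
    fix i assume i: "i < m"
    hence n: "m - i = Suc (m - Suc i)" by simp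
    show "top_of (?\<sigma> i Jx) = 2" by (simp add: n)
    have "run (emit_edge_slots K) (tp, (?\<sigma> i)(Jx := replicate (m - Suc i) 2)) ?B
      (tp, (?\<sigma> i)(Jx := replicate (m - Suc i) 2, Out := ?s (Suc i) @ 1 # \<sigma> Out))"
      by (rule run_weaken[OF run_emit_edge_slots[where m = m and i = i and L = L and K = K]])
         (use assms i in \<open>auto simp: fun_eq_iff\<close>)
    note slots = this
    show "run (pop Jx ;; emit_edge_slots K ;; push Ix 2) (tp, ?\<sigma> i) (1 + (?B + 2)) (tp, ?\<sigma> (Suc i))"
    proof (rule run_Seq)
      show "run (pop Jx) (tp, ?\<sigma> i) 1 (tp, (?\<sigma> i)(Jx := replicate (m - Suc i) 2))"
        by (rule run_weaken[OF run_pop]) (auto simp: n)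
      show "run (emit_edge_slots K ;; push Ix 2) (tp, (?\<sigma> i)(Jx := replicate (m - Suc i) 2)) (?B + 2)
          (tp, ?\<sigma> (Suc i))"
        by (rule run_weaken[OF run_Seq[OF slots run_push]]) (auto simp: fun_eq_iff)
    qed
  qed auto
  have 3: "run (drain Ix []) (tp, ?\<sigma> m) (3 * L + 1) (tp, (?\<sigma> m)(Ix := []))"
    by (rule run_clear) (use L in auto)
  have "m * Suc (1 + (?B + 2)) \<le> L * Suc (1 + (?B + 2))" using L by (intro mult_right_mono) auto
  thus ?thesis unfolding emit_slots_def
    by (intro run_weaken[OF run_Seq[OF run_push run_Seq[OF 1 run_Seq[OF 2 3]]]])
       (use a in \<open>auto simp: fun_eq_iff algebra_simps enc_list_def\<close>)
qed

subsection \<open>Emitting the dictionary\<close>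

text \<open>Draining stops at the first symbol other than 2; the marks 3, 4, 5 in \<open>Mk\<close>
  call for a loop that stops only at the blank.\<close>

definition clear :: "reg \<Rightarrow> com" where
  "clear r = WhileR (\<lambda>t. t r \<noteq> 0) (pop r)"

lemma run_clear_all:
  assumes "0 \<notin> set (\<sigma> r)" "length (\<sigma> r) \<le> L"
  shows "run (clear r) (tp, \<sigma>) (2 * L + 1) (tp, \<sigma>(r := []))"
proof -
  let ?n = "length (\<sigma> r)"
  let ?\<sigma> = "\<lambda>i. \<sigma>(r := drop i (\<sigma> r))"
  have "run (clear r) (tp, ?\<sigma> 0) (?n * Suc 1 + 1) (tp, ?\<sigma> ?n)"
    unfolding clear_def
  proof (rule run_WhileR[where tp = "\<lambda>_. tp"])
    fix i assume i: "i < ?n"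
    hence d: "drop i (\<sigma> r) = \<sigma> r ! i # drop (Suc i) (\<sigma> r)" by (simp add: Cons_nth_drop_Suc)
    have "\<sigma> r ! i \<noteq> 0" using assms(1) i by (metis nth_mem)
    thus "top_of (?\<sigma> i r) \<noteq> 0" by (simp add: d)
    show "run (pop r) (tp, ?\<sigma> i) 1 (tp, ?\<sigma> (Suc i))"
      by (rule run_weaken[OF run_pop]) (auto simp: d)
  qed simp
  thus ?thesis by (simp, elim run_weaken) (use assms in auto)
qed

definition emit_label :: "nat \<Rightarrow> com" where
  "emit_label K = pop In1 ;; read_num In1 [(Pv, 2)] ;; emit_word K ;; emit_word (Suc K) ;;
     drain Pv [] ;; push Av 2"

text \<open>What the words \<open>ws\<close>, emitted one after the other, leave on top of
  \<open>Out\<close>: a list encoding still without its terminator, latest word first.\<close>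

definition enc_words :: "nat list list \<Rightarrow> bool list" where
  "enc_words ws = concat (map (\<lambda>w. True # enc_list enc_nat w) (rev ws))"

lemma enc_words_simps [simp]:
  "enc_words [] = []" "enc_words (ws @ ws') = enc_words ws' @ enc_words ws"
  "enc_words [w] = True # enc_list enc_nat w" "enc_words [w, w'] = enc_words [w'] @ enc_words [w]"
  by (auto simp: enc_words_def)

definition label_time :: "nat \<Rightarrow> nat \<Rightarrow> nat" where
  "label_time K L = (2 * K + 1) * (14 * L + 2) + 2 * L * (14 * L + 35) + 30"

lemma run_emit_label:
  assumes "\<sigma> In1 = 2 # replicate b 2 @ 1 # rest" "\<sigma> Pv = []"
    "\<sigma> Mk = rev ks" "0 \<notin> set ks" "\<sigma> Mk2 = []" "\<sigma> Av = replicate a 2"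
    "\<sigma> RZ = []" "\<sigma> Nm = replicate m 2" "\<sigma> Ix = replicate i 2"
    and L: "a \<le> L" "b \<le> L" "m \<le> L" "i \<le> L" "length ks \<le> L"
  shows "run (emit_label K) (tp, \<sigma>) (label_time K L)
    (tp, \<sigma>(In1 := rest, Av := 2 # \<sigma> Av, Out := syms (enc_words
       [map (letter a b) ks @ replicate (K * m + i) 0,
        map (letter a b) ks @ replicate (Suc K * m + i) 0]) @ \<sigma> Out))"
proof -
  let ?w = "\<lambda>k. syms (True # enc_list enc_nat (map (letter a b) ks @ replicate (k * m + i) 0))"
  let ?s2 = "\<sigma>(In1 := rest, Pv := replicate b 2)"
  have 1: "run (read_num In1 [(Pv, 2)]) (tp, \<sigma>(In1 := tl (\<sigma> In1))) (7 * L + 2) (tp, ?s2)"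
    by (rule run_weaken[OF run_read_num[where n = b and rest = rest and L = L]])
       (use assms in \<open>auto simp: fun_eq_iff pushed_def\<close>)
  have w: "run (emit_word k) (tp, ?s2(Out := xs)) (k * (14 * L + 2) + L * (14 * L + 30) + 9)
      (tp, ?s2(Out := ?w k @ xs))" for k xs
    by (rule run_weaken[OF run_emit_word[where ks = ks and a = a and b = b and m = m and i = i and L = L]])
       (use assms in \<open>auto simp: fun_eq_iff\<close>)
  have 2: "run (emit_word K) (tp, ?s2) (K * (14 * L + 2) + L * (14 * L + 30) + 9) (tp, ?s2(Out := ?w K @ \<sigma> Out))"
    using w[of K "\<sigma> Out"] by (simp add: fun_upd_idem)
  have 3: "run (drain Pv []) (tp, ?s2(Out := ?w (Suc K) @ ?w K @ \<sigma> Out)) (3 * L + 1)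
     (tp, (?s2(Out := ?w (Suc K) @ ?w K @ \<sigma> Out))(Pv := []))"
    by (rule run_clear) (use L in auto)
  show ?thesis unfolding emit_label_def
    by (rule run_weaken[OF run_Seq[OF run_pop run_Seq[OF 1 run_Seq[OF 2 run_Seq[OF w run_Seq[OF 3 run_push]]]]]])
       (use assms in \<open>auto simp: fun_eq_iff label_time_def algebra_simps\<close>)
qed

text \<open>The comparisons with all edges are made once and serve every label. \<open>Av\<close>
  counts the labels in step with the values of the permutation read from \<open>In1\<close>, so
  \<open>Pv\<close> always holds the image of \<open>Av\<close>.\<close>

definition emit_edge :: "nat \<Rightarrow> com" where
  "emit_edge K = pop In1 ;; read_num In1 [(RU, 2)] ;; read_num In1 [(RV, 2)] ;; compare_edges ;;
     WhileR (\<lambda>t. t In1 = 2) (emit_label K) ;; pop In1 ;; drain Av [] ;; clear Mk ;; drain RU [] ;;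
     drain RV [] ;; push Ix 2"

definition edge_time :: "nat \<Rightarrow> nat \<Rightarrow> nat" where
  "edge_time K L = L * (76 * L + 59) + L * Suc (label_time K L) + 25 * L + 30"

definition idle :: "(reg \<Rightarrow> nat list) \<Rightarrow> bool" where
  "idle \<sigma> \<longleftrightarrow> (\<forall>r \<in> {Bk, RU, RV, RX, RY, RZ, FU, FV, Mk, Mk2, Pv, Av, Jx}. \<sigma> r = [])"

lemma meet_neq_0 [simp]: "meet e e' \<noteq> 0" "0 < meet e e'" "0 \<noteq> meet e e'"
  by (cases e; cases e'; simp add: meet_def)+

lemma run_emit_edge:
  assumes idle: "idle \<sigma>"
    and a: "\<sigma> In1 = 2 # syms (enc_edge (es ! i)) @ rest" "\<sigma> Ed = syms (concat (map edge_ends es))"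
    "\<sigma> Nm = replicate (length es) 2" "\<sigma> Ix = replicate i 2"
    and L: "\<forall>e \<in> set es. small_edge L e" "length es \<le> L" "i < length es"
  shows "run (emit_edge K) (tp, \<sigma>) (edge_time K L)
    (tp, \<sigma>(In1 := rest, Ix := 2 # \<sigma> Ix, Out := syms (enc_words (edge_words K es i)) @ \<sigma> Out))"
proof -
  obtain u v p where e: "es ! i = (u, v, p)" by (metis prod.collapse)
  have se: "small_edge L (es ! i)" using L by auto
  hence Le: "u \<le> L" "v \<le> L" "length p \<le> L" "\<And>j. j < length p \<Longrightarrow> p ! j \<le> L"
    using se by (auto simp: small_edge_def e)
  note id = idle[unfolded idle_def, simplified]
  let ?E = "syms (enc_list enc_nat p) @ rest"
  let ?ks = "map (meet (es ! i)) es"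
  let ?m = "length es"
  have In1: "tl (\<sigma> In1) = replicate u 2 @ 1 # replicate v 2 @ 1 # ?E" by (simp add: a e enc_edge_def)
  let ?s1 = "\<sigma>(In1 := replicate u 2 @ 1 # replicate v 2 @ 1 # ?E)"
  let ?s2 = "\<sigma>(In1 := replicate v 2 @ 1 # ?E, RU := replicate u 2)"
  let ?s3 = "\<sigma>(In1 := ?E, RU := replicate u 2, RV := replicate v 2)"
  let ?s4 = "?s3(Mk := rev ?ks)"
  have 1: "run (read_num In1 [(RU, 2)]) (tp, ?s1) (7 * L + 2) (tp, ?s2)"
    by (rule run_weaken[OF run_read_num[where n = u and rest = "replicate v 2 @ 1 # ?E" and L = L]])
       (use Le id in \<open>auto simp: fun_eq_iff pushed_def\<close>)
  have 2: "run (read_num In1 [(RV, 2)]) (tp, ?s2) (7 * L + 2) (tp, ?s3)"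
    by (rule run_weaken[OF run_read_num[where n = v and rest = "?E" and L = L]])
       (use Le id in \<open>auto simp: fun_eq_iff pushed_def\<close>)
  have 3: "run compare_edges (tp, ?s3) (L * (76 * L + 59) + 2) (tp, ?s4)"
    by (rule run_weaken[OF run_compare_edges[where es = es and e = "es ! i" and L = L]])
       (use L a id se in \<open>auto simp: e\<close>)
  let ?f = "\<lambda>a. [edge_word es (K * ?m + i) (es ! i) a, edge_word es (Suc K * ?m + i) (es ! i) a]"
  let ?o = "\<lambda>j. syms (enc_words (concat (map ?f [0..<j]))) @ \<sigma> Out"
  let ?\<sigma> = "\<lambda>j. ?s4(In1 := syms (enc_list enc_nat (drop j p)) @ rest, Av := replicate j 2, Out := ?o j)"
  have 4: "run (WhileR (\<lambda>t. t In1 = 2) (emit_label K)) (tp, ?\<sigma> 0) (length p * Suc (label_time K L) + 1)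
     (tp, ?\<sigma> (length p))"
  proof (rule run_WhileR[where tp = "\<lambda>_. tp"])
    fix j assume j: "j < length p"
    hence d: "drop j p = p ! j # drop (Suc j) p" by (simp add: Cons_nth_drop_Suc)
    show "top_of (?\<sigma> j In1) = 2" by (simp add: d)
    show "run (emit_label K) (tp, ?\<sigma> j) (label_time K L) (tp, ?\<sigma> (Suc j))"
      by (rule run_weaken[OF run_emit_label[where a = j and b = "p ! j" and ks = ?ks and m = ?m and i = i
            and L = L and rest = "syms (enc_list enc_nat (drop (Suc j) p)) @ rest"]])
         (use L Le j id a in \<open>auto simp: d fun_eq_iff edge_word_def e\<close>)
  qed simp
  have 0: "?\<sigma> 0 = ?s4" using id by (auto simp: fun_eq_iff)
  let ?t1 = "(?\<sigma> (length p))(In1 := rest)"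
  have 5: "run (pop In1) (tp, ?\<sigma> (length p)) 1 (tp, ?t1)"
    by (rule run_weaken[OF run_pop]) (auto simp: fun_eq_iff)
  have 6: "run (drain Av []) (tp, ?t1) (3 * L + 1) (tp, ?t1(Av := []))"
    by (rule run_clear) (use Le in auto)
  have 7: "run (clear Mk) (tp, ?t1(Av := [])) (2 * L + 1) (tp, ?t1(Av := [], Mk := []))"
    by (rule run_clear_all) (use L in auto)
  have 8: "run (drain RU []) (tp, ?t1(Av := [], Mk := [])) (3 * L + 1) (tp, ?t1(Av := [], Mk := [], RU := []))"
    by (rule run_clear) (use Le in auto)
  have 9: "run (drain RV []) (tp, ?t1(Av := [], Mk := [], RU := [])) (3 * L + 1)
      (tp, ?t1(Av := [], Mk := [], RU := [], RV := []))"
    by (rule run_clear) (use Le in auto)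
  have "length p * Suc (label_time K L) \<le> L * Suc (label_time K L)"
    using Le by (intro mult_right_mono) auto
  moreover have "?o (length p) = syms (enc_words (edge_words K es i)) @ \<sigma> Out"
    by (simp add: edge_words_def e)
  ultimately show ?thesis unfolding emit_edge_def
    by (intro run_weaken[OF run_Seq[OF run_pop[of In1 tp \<sigma>, unfolded In1] run_Seq[OF 1 run_Seq[OF 2 run_Seq[OF 3
          run_Seq[OF 4[unfolded 0] run_Seq[OF 5 run_Seq[OF 6 run_Seq[OF 7 run_Seq[OF 8 run_Seq[OF 9 run_push]]]]]]]]]]])
       (use id in \<open>auto simp: fun_eq_iff edge_time_def algebra_simps\<close>)
qed

definition emit_dict :: "nat \<Rightarrow> com" where
  "emit_dict K = push Out 1 ;; WhileR (\<lambda>t. t In1 = 2) (emit_edge K)"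

lemma run_emit_dict:
  assumes idle: "idle \<sigma>"
    and a: "\<sigma> In1 = syms (enc_list enc_edge es)" "\<sigma> Ed = syms (concat (map edge_ends es))"
    "\<sigma> Nm = replicate (length es) 2" "\<sigma> Ix = []"
    and L: "\<forall>e \<in> set es. small_edge L e" "length es \<le> L"
  shows "run (emit_dict K) (tp, \<sigma>) (L * Suc (edge_time K L) + 3)
    (tp, \<sigma>(In1 := [1], Ix := replicate (length es) 2, Out := syms (enc_list (enc_list enc_nat)
       (rev (concat (map (edge_words K es) [0..<length es])))) @ \<sigma> Out))"
proof -
  let ?m = "length es"
  let ?\<sigma> = "\<lambda>i. \<sigma>(In1 := syms (enc_list enc_edge (drop i es)), Ix := replicate i 2,
     Out := syms (enc_words (concat (map (edge_words K es) [0..<i]))) @ 1 # \<sigma> Out)"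
  have 1: "run (push Out 1) (tp, \<sigma>) 2 (tp, ?\<sigma> 0)"
    by (rule run_weaken[OF run_push]) (use a in \<open>auto simp: fun_eq_iff\<close>)
  have 2: "run (WhileR (\<lambda>t. t In1 = 2) (emit_edge K)) (tp, ?\<sigma> 0) (?m * Suc (edge_time K L) + 1) (tp, ?\<sigma> ?m)"
  proof (rule run_WhileR[where tp = "\<lambda>_. tp"])
    fix i assume i: "i < ?m"
    hence d: "drop i es = es ! i # drop (Suc i) es" by (simp add: Cons_nth_drop_Suc)
    show "top_of (?\<sigma> i In1) = 2" by (simp add: d)
    show "run (emit_edge K) (tp, ?\<sigma> i) (edge_time K L) (tp, ?\<sigma> (Suc i))"
      by (rule run_weaken[OF run_emit_edge[where es = es and i = i and L = L
            and rest = "syms (enc_list enc_edge (drop (Suc i) es))"]])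
         (use L i idle a in \<open>auto simp: d fun_eq_iff idle_def\<close>)
  qed simp
  have "?m * Suc (edge_time K L) \<le> L * Suc (edge_time K L)" using L by (intro mult_right_mono) auto
  thus ?thesis unfolding emit_dict_def
    by (intro run_weaken[OF run_Seq[OF 1 2]]) (auto simp: fun_eq_iff enc_list_def enc_words_def)
qed

subsection \<open>Reading the instance\<close>

definition scan_edge :: com where
  "scan_edge = pop In2 ;; read_num In2 [(Bk, 2)] ;; push Bk 1 ;; read_num In2 [(Bk, 2)] ;; push Bk 1 ;;
     WhileR (\<lambda>t. t In2 = 2) (pop In2 ;; read_num In2 []) ;; pop In2 ;; push Nm 2"

lemma run_scan_edge:
  assumes a: "\<sigma> In2 = 2 # syms (enc_edge e) @ rest" and L: "small_edge L e"
  shows "run scan_edge (tp, \<sigma>) (L * (7 * L + 4) + 14 * L + 13)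
    (tp, \<sigma>(In2 := rest, Bk := rev (syms (edge_ends e)) @ \<sigma> Bk, Nm := 2 # \<sigma> Nm))"
proof -
  obtain u v p where e: "e = (u, v, p)" by (metis prod.collapse)
  have Le: "u \<le> L" "v \<le> L" "length p \<le> L" "\<And>j. j < length p \<Longrightarrow> p ! j \<le> L"
    using L by (auto simp: small_edge_def e)
  let ?E = "syms (enc_list enc_nat p) @ rest"
  let ?s0 = "\<sigma>(In2 := replicate u 2 @ 1 # replicate v 2 @ 1 # ?E)"
  let ?s1 = "\<sigma>(In2 := replicate v 2 @ 1 # ?E, Bk := replicate u 2 @ \<sigma> Bk)"
  let ?s2 = "?s1(Bk := 1 # replicate u 2 @ \<sigma> Bk)"
  let ?s3 = "\<sigma>(In2 := ?E, Bk := replicate v 2 @ 1 # replicate u 2 @ \<sigma> Bk)"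
  let ?s4 = "\<sigma>(In2 := ?E, Bk := 1 # replicate v 2 @ 1 # replicate u 2 @ \<sigma> Bk)"
  have 0: "run (pop In2) (tp, \<sigma>) 1 (tp, ?s0)"
    by (rule run_weaken[OF run_pop]) (auto simp: a e enc_edge_def)
  have 1: "run (read_num In2 [(Bk, 2)]) (tp, ?s0) (7 * L + 2) (tp, ?s1)"
    by (rule run_weaken[OF run_read_num[where n = u and rest = "replicate v 2 @ 1 # ?E" and L = L]])
       (use Le in \<open>auto simp: fun_eq_iff pushed_def\<close>)
  have 2: "run (push Bk 1) (tp, ?s1) 2 (tp, ?s2)"
    by (rule run_weaken[OF run_push]) auto
  have 3: "run (read_num In2 [(Bk, 2)]) (tp, ?s2) (7 * L + 2) (tp, ?s3)"
    by (rule run_weaken[OF run_read_num[where n = v and rest = "?E" and L = L]])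
       (use Le in \<open>auto simp: fun_eq_iff pushed_def\<close>)
  have 4: "run (push Bk 1) (tp, ?s3) 2 (tp, ?s4)"
    by (rule run_weaken[OF run_push]) auto
  let ?\<sigma> = "\<lambda>j. ?s4(In2 := syms (enc_list enc_nat (drop j p)) @ rest)"
  have 5: "run (WhileR (\<lambda>t. t In2 = 2) (pop In2 ;; read_num In2 [])) (tp, ?\<sigma> 0)
      (length p * Suc (1 + (7 * L + 2)) + 1) (tp, ?\<sigma> (length p))"
  proof (rule run_WhileR[where tp = "\<lambda>_. tp"])
    fix j assume j: "j < length p"
    hence d: "drop j p = p ! j # drop (Suc j) p" by (simp add: Cons_nth_drop_Suc)
    show "top_of (?\<sigma> j In2) = 2" by (simp add: d)
    show "run (pop In2 ;; read_num In2 []) (tp, ?\<sigma> j) (1 + (7 * L + 2)) (tp, ?\<sigma> (Suc j))"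
      by (rule run_weaken[OF run_Seq[OF run_pop run_read_num[where n = "p ! j" and L = L
              and rest = "syms (enc_list enc_nat (drop (Suc j) p)) @ rest"]]])
         (use Le j in \<open>auto simp: d fun_eq_iff pushed_def\<close>)
  qed simp
  have 50: "?\<sigma> 0 = ?s4" by (auto simp: fun_eq_iff)
  have "length p * Suc (1 + (7 * L + 2)) \<le> L * Suc (1 + (7 * L + 2))"
    using Le by (intro mult_right_mono) auto
  thus ?thesis unfolding scan_edge_def
    by (intro run_weaken[OF run_Seq[OF 0 run_Seq[OF 1 run_Seq[OF 2 run_Seq[OF 3 run_Seq[OF 4
            run_Seq[OF 5[unfolded 50] run_Seq[OF run_pop run_push]]]]]]]])
       (auto simp: fun_eq_iff e edge_ends_def algebra_simps)
qed

text \<open>Every word refers to all edges, and every slot length to their number. A first pass,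
  over the copy \<open>In2\<close>, therefore collects the ends and the count before
  \<open>In1\<close> is consumed to write the dictionary.\<close>

definition scan :: com where
  "scan = WhileR (\<lambda>t. t In2 = 2) scan_edge ;; move_all Bk Ed"

definition scan_time :: "nat \<Rightarrow> nat" where
  "scan_time L = L * Suc (L * (7 * L + 4) + 14 * L + 13) + 1 + (4 * (L * (2 * L + 2)) + 1)"

lemma run_scan:
  assumes a: "\<sigma> In2 = syms (enc_list enc_edge es)" "\<sigma> Bk = []" "\<sigma> Ed = []" "\<sigma> Nm = []"
    and L: "\<forall>e \<in> set es. small_edge L e" "length es \<le> L"
  shows "run scan (tp, \<sigma>) (scan_time L)
    (tp, \<sigma>(In2 := [1], Ed := syms (concat (map edge_ends es)), Nm := replicate (length es) 2))"
proof -
  let ?m = "length es"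
  let ?\<sigma> = "\<lambda>i. \<sigma>(In2 := syms (enc_list enc_edge (drop i es)), Nm := replicate i 2,
     Bk := rev (syms (concat (map edge_ends (take i es)))))"
  let ?B = "L * (7 * L + 4) + 14 * L + 13"
  have 1: "run (WhileR (\<lambda>t. t In2 = 2) scan_edge) (tp, ?\<sigma> 0) (?m * Suc ?B + 1) (tp, ?\<sigma> ?m)"
  proof (rule run_WhileR[where tp = "\<lambda>_. tp"])
    fix i assume i: "i < ?m"
    hence d: "drop i es = es ! i # drop (Suc i) es" by (simp add: Cons_nth_drop_Suc)
    show "top_of (?\<sigma> i In2) = 2" by (simp add: d)
    show "run scan_edge (tp, ?\<sigma> i) ?B (tp, ?\<sigma> (Suc i))"
      by (rule run_weaken[OF run_scan_edge[where e = "es ! i" and L = L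
            and rest = "syms (enc_list enc_edge (drop (Suc i) es))"]])
         (use L i in \<open>auto simp: d fun_eq_iff take_Suc_conv_app_nth\<close>)
  qed simp
  have 0: "?\<sigma> 0 = \<sigma>" using a by (auto simp: fun_eq_iff)
  have "length (concat (map edge_ends es)) \<le> ?m * (2 * L + 2)"
    by (rule length_concat_le, rule length_edge_ends) (use L in \<open>auto simp: small_edge_def\<close>)
  also have "\<dots> \<le> L * (2 * L + 2)" using L by (intro mult_right_mono) auto
  finally have 2: "run (move_all Bk Ed) (tp, ?\<sigma> ?m) (4 * (L * (2 * L + 2)) + 1)
      (tp, \<sigma>(In2 := [1], Ed := syms (concat (map edge_ends es)), Nm := replicate ?m 2))"
    by (intro run_weaken[OF run_move_all]) (use a in \<open>auto simp: fun_eq_iff rev_map\<close>)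
  have "?m * Suc ?B \<le> L * Suc ?B" using L by (intro mult_right_mono) auto
  thus ?thesis unfolding scan_def scan_time_def
    by (intro run_weaken[OF run_Seq[OF 1[unfolded 0] 2]]) auto
qed

definition split_input :: com where
  "split_input = WhileR (\<lambda>t. t RIn \<noteq> 0) (push_top RIn In1 ;; push_top RIn In2 ;; pop RIn)"

lemma run_split_input:
  assumes a: "\<sigma> RIn = syms (rev x)" "\<sigma> In1 = []" "\<sigma> In2 = []"
  shows "run split_input (tp, \<sigma>) (6 * length x + 1) (tp, \<sigma>(RIn := [], In1 := syms x, In2 := syms x))"
proof -
  let ?n = "length x"
  let ?\<sigma> = "\<lambda>i. \<sigma>(RIn := syms (drop i (rev x)), In1 := syms (rev (take i (rev x))),
     In2 := syms (rev (take i (rev x))))"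
  have 1: "run split_input (tp, ?\<sigma> 0) (?n * Suc (2 + (2 + 1)) + 1) (tp, ?\<sigma> ?n)"
    unfolding split_input_def
  proof (rule run_WhileR[where tp = "\<lambda>_. tp"])
    fix i assume i: "i < ?n"
    hence d: "drop i (rev x) = rev x ! i # drop (Suc i) (rev x)" by (simp add: Cons_nth_drop_Suc)
    show "top_of (?\<sigma> i RIn) \<noteq> 0" by (simp add: d)
    show "run (push_top RIn In1 ;; push_top RIn In2 ;; pop RIn) (tp, ?\<sigma> i) (2 + (2 + 1)) (tp, ?\<sigma> (Suc i))"
      by (rule run_weaken[OF run_Seq[OF run_push_top run_Seq[OF run_push_top run_pop]]])
         (use i in \<open>auto simp: d fun_eq_iff take_Suc_conv_app_nth\<close>)
  qed simp
  have "?\<sigma> 0 = \<sigma>" using a by (auto simp: fun_eq_iff)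
  with 1 have "run split_input (tp, \<sigma>) (?n * Suc (2 + (2 + 1)) + 1) (tp, ?\<sigma> ?n)" by simp
  thus ?thesis by (rule run_weaken) (auto simp: fun_eq_iff)
qed

subsection \<open>The whole program\<close>

definition emit_dims :: "nat \<Rightarrow> com" where
  "emit_dims K = push Out 1 ;; rep_com (K + 3) (copy RZ Nm Out) ;;
     push Out 1 ;; rep_com (K + 3) (copy RZ Nm Out)"

text \<open>The readings in front skip the vertex and label counts in both copies, leaving the edge
  lists. The slots come before the dictionary and the dimensions because the output grows from its
  end.\<close>

definition reduction_program :: "nat \<Rightarrow> com" where
  "reduction_program K =
     split_input ;; read_num In1 [] ;; read_num In1 [] ;; read_num In2 [] ;; read_num In2 [] ;;
     scan ;; emit_slots K ;; emit_dict K ;; emit_dims K"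

definition reduction_time :: "nat \<Rightarrow> nat \<Rightarrow> nat" where
  "reduction_time K L = 34 * L + scan_time L + L * ((2 * K + 7) * (14 * L + 2) + 43)
     + L * Suc (edge_time K L) + 2 * (K + 3) * (14 * L + 2) + 40"

lemma run_reduction_program:
  assumes x: "x = enc_nat n @ enc_nat R @ enc_list enc_edge es"
    and L: "\<forall>e \<in> set es. small_edge L e" "length es \<le> L" "n \<le> L" "R \<le> L" "length x \<le> L"
  shows "\<exists>\<sigma>. run (reduction_program K) (tp, (\<lambda>_. [])(RIn := syms (rev x))) (reduction_time K L) (tp, \<sigma>) \<and>
    \<sigma> Out = syms (enc_crossword (edge_crossword K es))"
proof -
  let ?m = "length es"
  let ?E = "syms (enc_list enc_edge es)"
  let ?e = "(\<lambda>_. []) :: reg \<Rightarrow> nat list"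
  let ?s1 = "?e(In1 := syms x, In2 := syms x)"
  let ?s2 = "?s1(In1 := replicate R 2 @ 1 # ?E)"
  let ?s3 = "?s1(In1 := ?E)"
  let ?s4 = "?s3(In2 := replicate R 2 @ 1 # ?E)"
  let ?s5 = "?s3(In2 := ?E)"
  let ?s6 = "?e(In1 := ?E, In2 := [1], Ed := syms (concat (map edge_ends es)), Nm := replicate ?m 2)"
  let ?o7 = "syms (enc_list enc_slot (rev (concat (map (edge_slots K ?m) [0..<?m]))))"
  let ?s7 = "?s6(Out := ?o7)"
  let ?o8 = "syms (enc_list (enc_list enc_nat) (rev (concat (map (edge_words K es) [0..<?m])))) @ ?o7"
  let ?s8 = "?s6(In1 := [1], Ix := replicate ?m 2, Out := ?o8)"
  have 1: "run split_input (tp, ?e(RIn := syms (rev x))) (6 * L + 1) (tp, ?s1)"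
    by (rule run_weaken[OF run_split_input[where x = x]]) (use L in auto)
  have 2: "run (read_num In1 []) (tp, ?s1) (7 * L + 2) (tp, ?s2)"
    by (rule run_weaken[OF run_read_num[where n = n and rest = "replicate R 2 @ 1 # ?E" and L = L]])
       (use x L in \<open>auto simp: fun_eq_iff pushed_def\<close>)
  have 3: "run (read_num In1 []) (tp, ?s2) (7 * L + 2) (tp, ?s3)"
    by (rule run_weaken[OF run_read_num[where n = R and rest = "?E" and L = L]])
       (use x L in \<open>auto simp: fun_eq_iff pushed_def\<close>)
  have 4: "run (read_num In2 []) (tp, ?s3) (7 * L + 2) (tp, ?s4)"
    by (rule run_weaken[OF run_read_num[where n = n and rest = "replicate R 2 @ 1 # ?E" and L = L]])
       (use x L in \<open>auto simp: fun_eq_iff pushed_def\<close>)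
  have 5: "run (read_num In2 []) (tp, ?s4) (7 * L + 2) (tp, ?s5)"
    by (rule run_weaken[OF run_read_num[where n = R and rest = "?E" and L = L]])
       (use x L in \<open>auto simp: fun_eq_iff pushed_def\<close>)
  have 6: "run scan (tp, ?s5) (scan_time L) (tp, ?s6)"
    by (rule run_weaken[OF run_scan[where es = es and L = L]]) (use L in \<open>auto simp: fun_eq_iff\<close>)
  have 7: "run (emit_slots K) (tp, ?s6) (L * ((2 * K + 7) * (14 * L + 2) + 43) + 7) (tp, ?s7)"
    by (rule run_weaken[OF run_emit_slots[where m = ?m and L = L]]) (use L in \<open>auto simp: fun_eq_iff\<close>)
  have 8: "run (emit_dict K) (tp, ?s7) (L * Suc (edge_time K L) + 3) (tp, ?s8)"
    by (rule run_weaken[OF run_emit_dict[where es = es and L = L]])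
       (use L in \<open>auto simp: fun_eq_iff idle_def\<close>)
  have Nm: "run (rep_com (K + 3) (copy RZ Nm Out)) (tp, ?s8(Out := xs)) ((K + 3) * (14 * L + 2) + 1)
    (tp, ?s8(Out := replicate ((K + 3) * ?m) 2 @ xs))" for xs
    by (rule run_weaken[OF run_copies_Out[where m = ?m and L = L]]) (use L in auto)
  have p: "run (push Out s) (tp, ?s8(Out := xs)) 2 (tp, ?s8(Out := s # xs))" for s xs
    by (rule run_weaken[OF run_push]) auto
  let ?d = "replicate ((K + 3) * ?m) 2"
  have 9: "run (emit_dims K) (tp, ?s8(Out := ?o8)) (2 + ((K + 3) * (14 * L + 2) + 1 + (2 + ((K + 3) * (14 * L + 2) + 1))))
      (tp, ?s8(Out := ?d @ 1 # ?d @ 1 # ?o8))"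
    unfolding emit_dims_def by (rule run_Seq p Nm)+
  have 80: "?s8(Out := ?o8) = ?s8" by simp
  have "run (reduction_program K) (tp, ?e(RIn := syms (rev x))) (reduction_time K L)
      (tp, ?s8(Out := ?d @ 1 # ?d @ 1 # ?o8))"
    unfolding reduction_program_def
    by (rule run_weaken[OF run_Seq[OF 1 run_Seq[OF 2 run_Seq[OF 3 run_Seq[OF 4 run_Seq[OF 5 run_Seq[OF 6
            run_Seq[OF 7 run_Seq[OF 8 9[unfolded 80]]]]]]]]]])
       (auto simp: reduction_time_def algebra_simps)
  moreover have "?d @ 1 # ?d @ 1 # ?o8 = syms (enc_crossword (edge_crossword K es))"
    by (simp add: enc_crossword_def edge_crossword_def)
  ultimately show ?thesis
    by (intro exI[of _ "?s8(Out := ?d @ 1 # ?d @ 1 # ?o8)"] conjI) (simp_all only: fun_upd_same)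
qed

text \<open>The six symbols are the blank, the two bits and the results 3, 4, 5 of
  \<open>meet\<close>; 3 is also the mark of \<open>load\<close>.\<close>

lemma wf_reduction_program: "wf_com (Suc CARD(reg)) 6 (reduction_program K)"
  by (simp add: reduction_program_def split_input_def read_num_def scan_def scan_edge_def move_all_def
      emit_slots_def copy_def per_unit_def emit_edge_slots_def emit_dict_def emit_edge_def
      compare_edges_def compare_edge_def eq_test_def emit_label_def emit_word_def emit_zeros_def
      emit_letter_def clear_def emit_dims_def)

section \<open>Length of the output and polynomial bounds\<close>

lemma length_enc_nat [simp]: "length (enc_nat n) = Suc n"
  by (simp add: enc_nat_def)

lemma length_enc_list_ge: "length xs \<le> length (enc_list e xs)"
  by (induction xs) auto

lemma length_enc_list_member: "x \<in> set xs \<Longrightarrow> length (e x) \<le> length (enc_list e xs)"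
  by (induction xs) auto

lemma length_enc_list_le:
  "(\<And>x. x \<in> set xs \<Longrightarrow> length (e x) \<le> B) \<Longrightarrow> length (enc_list e xs) \<le> length xs * Suc B + 1"
proof (induction xs)
  case (Cons x xs)
  have "length (e x) \<le> B" "length (enc_list e xs) \<le> length xs * Suc B + 1" using Cons by auto
  thus ?case by simp
qed simp

lemma small_edge_enc: "length (enc_edge e) \<le> L \<Longrightarrow> small_edge L e"
proof -
  obtain u v p where e: "e = (u, v, p)" by (metis prod.collapse)
  assume L: "length (enc_edge e) \<le> L"
  have "b \<le> L" if "b \<in> set p" for b
    using length_enc_list_member[OF that, of enc_nat] L by (simp add: e enc_edge_def)
  thus ?thesis using L length_enc_list_ge[of p enc_nat] by (simp add: e enc_edge_def small_edge_def)
qed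

lemma length_enc_slot: "length (enc_slot s) = slot_row s + slot_col s + slot_len s + 4"
  by (simp add: enc_slot_def)

text \<open>The summands are the two dimensions, the dictionary and the slots. There are two words
  per edge and label, hence at most L (2 L), each of at most (K + 3) L letters costing L + 2 bits;
  of the 2 L slots each costs at most (K + 4) L + 4 bits.\<close>

lemma length_edge_crossword:
  assumes L: "\<forall>e \<in> set es. small_edge L e" "length es \<le> L"
  shows "length (enc_crossword (edge_crossword K es)) \<le>
    2 * ((K + 3) * L + 1) + (L * (2 * L) * Suc ((K + 3) * L * (L + 2) + 1) + 1)
      + (2 * L * Suc ((K + 4) * L + 4) + 1)"
proof -
  let ?m = "length es"
  have words: "length (edge_words K es i) \<le> 2 * L \<and> (\<forall>w \<in> set (edge_words K es i).
      length w \<le> (K + 3) * L \<and> (\<forall>l \<in> set w. l \<le> L))" if i: "i < ?m" for i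
  proof -
    obtain u v p where e: "es ! i = (u, v, p)" by (metis prod.collapse)
    have s: "small_edge L (es ! i)" using L i by auto
    hence p: "length p \<le> L" "\<And>j. j < length p \<Longrightarrow> p ! j \<le> L" by (auto simp: small_edge_def e)
    have "a \<le> L" if "a < length p" for a using that p(1) by simp
    note p = p this
    have l: "length (edge_word es n (es ! i) a) \<le> (K + 3) * L \<and> (\<forall>l \<in> set (edge_word es n (es ! i) a). l \<le> L)"
      if "n \<le> Suc K * ?m + i" "a < length p" for n a
    proof -
      have "Suc K * ?m + i + ?m \<le> (K + 3) * ?m" using i by (simp add: algebra_simps)
      also have "\<dots> \<le> (K + 3) * L" using L(2) by (intro mult_left_mono) auto
      finally have "?m + n \<le> (K + 3) * L" using that(1) by linarith
      moreover have "l \<le> L" if "l \<in> set (edge_word es n (es ! i) a)" for l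
        using that p \<open>a < length p\<close> by (auto simp: edge_word_def letter_def e split: if_splits)
      ultimately show ?thesis by (auto simp: edge_word_def)
    qed
    have "length (edge_words K es i) = 2 * length p"
      unfolding edge_words_def by (simp add: e length_concat o_def sum_list_triv)
    moreover have "length w \<le> (K + 3) * L \<and> (\<forall>l \<in> set w. l \<le> L)" if w: "w \<in> set (edge_words K es i)" for w
    proof -
      obtain a where "a < length p" "w = edge_word es (K * ?m + i) (es ! i) a \<or>
          w = edge_word es (Suc K * ?m + i) (es ! i) a"
        using w by (auto simp: edge_words_def e)
      thus ?thesis using l[of "K * ?m + i" a] l[of "Suc K * ?m + i" a] by auto
    qed
    ultimately show ?thesis using p(1) by simp
  qed
  let ?ws = "rev (concat (map (edge_words K es) [0..<?m]))"
  have "length ?ws \<le> ?m * (2 * L)"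
    using length_concat_le[of "[0..<?m]" "edge_words K es" "2 * L"] words by simp
  also have "\<dots> \<le> L * (2 * L)" using L by (intro mult_right_mono) auto
  finally have nws: "length ?ws \<le> L * (2 * L)" .
  have w: "length (enc_list enc_nat w) \<le> (K + 3) * L * (L + 2) + 1" if "w \<in> set ?ws" for w
  proof -
    have "length w \<le> (K + 3) * L" "\<forall>l \<in> set w. l \<le> L" using that words by fastforce+
    hence "length (enc_list enc_nat w) \<le> length w * Suc (L + 1) + 1"
      by (intro length_enc_list_le) auto
    also have "\<dots> \<le> (K + 3) * L * Suc (L + 1) + 1"
      using \<open>length w \<le> (K + 3) * L\<close> by (intro add_right_mono mult_right_mono) auto
    finally show ?thesis by simp
  qed
  have "length (enc_list (enc_list enc_nat) ?ws) \<le> length ?ws * Suc ((K + 3) * L * (L + 2) + 1) + 1"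
    by (intro length_enc_list_le w)
  also have "\<dots> \<le> L * (2 * L) * Suc ((K + 3) * L * (L + 2) + 1) + 1"
    using nws by (intro add_right_mono mult_right_mono) auto
  finally have 1: "length (enc_list (enc_list enc_nat) ?ws) \<le> L * (2 * L) * Suc ((K + 3) * L * (L + 2) + 1) + 1" .
  let ?ss = "rev (concat (map (edge_slots K ?m) [0..<?m]))"
  have "length ?ss = 2 * ?m" by (simp add: edge_slots_def row_slot_def col_slot_def length_concat o_def sum_list_triv)
  moreover have "length (enc_slot s) \<le> (K + 4) * L + 4" if s: "s \<in> set ?ss" for s
  proof -
    obtain i where i: "i < ?m" "s \<in> set (edge_slots K ?m i)" using s by auto
    have "length (enc_slot s) \<le> (K + 4) * ?m + 4"
      using i by (auto simp: edge_slots_def row_slot_def col_slot_def length_enc_slot algebra_simps)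
    also have "\<dots> \<le> (K + 4) * L + 4" using L(2) by (intro add_right_mono mult_left_mono) auto
    finally show ?thesis .
  qed
  hence "length (enc_list enc_slot ?ss) \<le> length ?ss * Suc ((K + 4) * L + 4) + 1"
    by (intro length_enc_list_le)
  ultimately have "length (enc_list enc_slot ?ss) \<le> 2 * ?m * Suc ((K + 4) * L + 4) + 1" by simp
  also have "\<dots> \<le> 2 * L * Suc ((K + 4) * L + 4) + 1"
    using L(2) by (intro add_right_mono mult_right_mono) auto
  finally have 2: "length (enc_list enc_slot ?ss) \<le> 2 * L * Suc ((K + 4) * L + 4) + 1" .
  have "length (enc_crossword (edge_crossword K es)) =
      2 * ((K + 3) * ?m + 1) + length (enc_list (enc_list enc_nat) ?ws) + length (enc_list enc_slot ?ss)"
    by (simp add: enc_crossword_def edge_crossword_def)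
  moreover have "2 * ((K + 3) * ?m + 1) \<le> 2 * ((K + 3) * L + 1)"
    using L(2) by (intro mult_left_mono add_right_mono) auto
  ultimately show ?thesis using 1 2 by (simp only: add_mono)
qed

text \<open>Lets the nested time bounds be recognized as polynomials by their shape, without ever
  writing down coefficients.\<close>

definition poly_fun :: "(nat \<Rightarrow> nat) \<Rightarrow> bool" where
  "poly_fun f \<longleftrightarrow> (\<exists>p :: nat poly. f = poly p)"

lemma poly_fun_intros:
  "poly_fun (\<lambda>n. c)" "poly_fun (\<lambda>n. n)"
  "poly_fun f \<Longrightarrow> poly_fun g \<Longrightarrow> poly_fun (\<lambda>n. f n + g n)"
  "poly_fun f \<Longrightarrow> poly_fun g \<Longrightarrow> poly_fun (\<lambda>n. f n * g n)"
  "poly_fun f \<Longrightarrow> poly_fun (\<lambda>n. Suc (f n))"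
proof -
  show "poly_fun (\<lambda>n. c)" by (auto simp: poly_fun_def fun_eq_iff intro: exI[of _ "[:c:]"])
  show "poly_fun (\<lambda>n. n)" by (auto simp: poly_fun_def fun_eq_iff intro: exI[of _ "[:0, 1:]"])
  assume "poly_fun f"
  then obtain p where p: "f = poly p" by (auto simp: poly_fun_def)
  show "poly_fun (\<lambda>n. Suc (f n))"
    by (auto simp: poly_fun_def fun_eq_iff p intro: exI[of _ "p + 1"])
  assume "poly_fun g"
  then obtain q where q: "g = poly q" by (auto simp: poly_fun_def)
  show "poly_fun (\<lambda>n. f n + g n)"
    by (auto simp: poly_fun_def fun_eq_iff p q intro: exI[of _ "p + q"])
  show "poly_fun (\<lambda>n. f n * g n)"
    by (auto simp: poly_fun_def fun_eq_iff p q intro: exI[of _ "p * q"])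
qed

text \<open>\<open>I\<close> need not be computable: the program sees only the encoding
  \<open>f x\<close>, whose length serves as the size parameter of all bounds.\<close>

theorem polytime_edge_crossword:
  assumes f: "polytime f" and I: "\<And>x. f x = enc_ulc (I x)"
  shows "polytime (\<lambda>x. enc_crossword (edge_crossword K (ulc_edges (I x))))"
proof -
  have "poly_fun (reduction_time K)"
    unfolding reduction_time_def scan_time_def edge_time_def label_time_def by (intro poly_fun_intros)
  then obtain p where p: "reduction_time K = poly p" by (auto simp: poly_fun_def)
  let ?B = "\<lambda>L. 2 * ((K + 3) * L + 1) + (L * (2 * L) * Suc ((K + 3) * L * (L + 2) + 1) + 1)
      + (2 * L * Suc ((K + 4) * L + 4) + 1)"
  have "poly_fun ?B" by (intro poly_fun_intros)
  then obtain q where q: "?B = poly q" by (auto simp: poly_fun_def)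
  have fx: "f x = enc_nat (ulc_verts (I x)) @ enc_nat (ulc_labels (I x)) @ enc_list enc_edge (ulc_edges (I x))" for x
    by (simp add: I enc_ulc_def enc_edge_def)
  have L: "\<forall>e \<in> set (ulc_edges (I x)). small_edge (length (f x)) e" "length (ulc_edges (I x)) \<le> length (f x)"
    "ulc_verts (I x) \<le> length (f x)" "ulc_labels (I x) \<le> length (f x)" for x
    using length_enc_list_ge[of "ulc_edges (I x)" enc_edge]
    by (auto simp: fx intro!: small_edge_enc dest!: length_enc_list_member[where e = enc_edge])
  show ?thesis
  proof (rule polytime_register_program[OF f _ wf_reduction_program[of K], where p = p and q = q and inp = RIn and out = Out])
    fix x
    show "\<exists>\<sigma>. run (reduction_program K) (word_tape [], (\<lambda>_. [])(RIn := syms (rev (f x)))) (poly p (length (f x)))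
        (word_tape [], \<sigma>) \<and> \<sigma> Out = syms (enc_crossword (edge_crossword K (ulc_edges (I x))))"
      unfolding p[symmetric] by (rule run_reduction_program[OF fx L order_refl])
    show "length (enc_crossword (edge_crossword K (ulc_edges (I x)))) \<le> poly q (length (f x))"
      unfolding q[symmetric] by (rule length_edge_crossword[OF L(1,2)])
  qed simp
qed

section \<open>The crossword of a label cover instance\<close>

lemma slot_cells_row: "slot_cells (row_slot K m i) = {i} \<times> {..<Suc K * m + i}"
  by (auto simp: slot_cells_def slot_cell_def row_slot_def)

lemma slot_cells_col: "slot_cells (col_slot K m i) = {..<Suc (Suc K) * m + i} \<times> {i}"
  by (auto simp: slot_cells_def slot_cell_def col_slot_def)

lemma slot_eq_iffs [simp]:
  "row_slot K m i = row_slot K m j \<longleftrightarrow> i = j" "col_slot K m i = col_slot K m j \<longleftrightarrow> i = j"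
  "row_slot K m i \<noteq> col_slot K m j" "col_slot K m j \<noteq> row_slot K m i"
  by (auto simp: row_slot_def col_slot_def)

lemma slot_len_simps [simp]:
  "slot_len (row_slot K m i) = Suc K * m + i" "slot_len (col_slot K m i) = Suc (Suc K) * m + i"
  by (auto simp: row_slot_def col_slot_def)

lemma slot_cell_simps [simp]:
  "slot_cell (row_slot K m i) p = (i, p)" "slot_cell (col_slot K m i) p = (p, i)"
  by (auto simp: row_slot_def col_slot_def slot_cell_def)

lemma slot_dir_simps [simp]:
  "slot_dir (row_slot K m i) = Horizontal" "slot_dir (col_slot K m i) = Vertical"
  "slot_row (row_slot K m i) = i" "slot_col (col_slot K m i) = i"
  by (auto simp: row_slot_def col_slot_def)

lemma distinct_edge_slots: "distinct (concat (map (edge_slots K m) [0..<n]))"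
  by (induction n) (auto simp: edge_slots_def)

lemma set_edge_slots:
  "set (cw_slots (edge_crossword K es)) =
    row_slot K (length es) ` {..<length es} \<union> col_slot K (length es) ` {..<length es}"
  by (auto simp: edge_crossword_def edge_slots_def)

lemma edge_dict_iff:
  "w \<in> set (cw_dict (edge_crossword K es)) \<longleftrightarrow>
    (\<exists>i < length es. \<exists>a < length (snd (snd (es ! i))). \<exists>k \<in> {K, Suc K}.
       w = edge_word es (k * length es + i) (es ! i) a)"
  by (simp add: edge_crossword_def edge_words_def atLeast0LessThan del: mult_Suc) blast

lemma length_edge_word [simp]: "length (edge_word es n e a) = length es + n"
  by (simp add: edge_word_def)

lemma edge_word_nth:
  "j < length es \<Longrightarrow> edge_word es n e a ! j = letter a (snd (snd e) ! a) (meet e (es ! j))"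
  by (simp add: edge_word_def nth_append)

lemma add_mult_cancel_small:
  fixes m i j k l :: nat
  assumes "k * m + i = l * m + j" "i < m" "j < m"
  shows "k = l" "i = j"
proof -
  have "(k * m + i) div m = k" using assms(2) by simp
  moreover have "(l * m + j) div m = l" using assms(3) by simp
  ultimately show "k = l" using assms(1) by metis
  thus "i = j" using assms(1) by simp
qed

text \<open>A word made for constraint j has length (k + 1) m + j with j < m, so division by m
  recovers both k and j from the length of the slot.\<close>

lemma dict_row:
  assumes "w \<in> set (cw_dict (edge_crossword K es))" "i < length es"
    "length w = slot_len (row_slot K (length es) i)"
  obtains a where "a < length (snd (snd (es ! i)))" "w = edge_word es (K * length es + i) (es ! i) a"
proof -
  obtain k j a where w: "w = edge_word es (k * length es + j) (es ! j) a" "j < length es"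
    "a < length (snd (snd (es ! j)))" using assms(1) unfolding edge_dict_iff by blast
  have "Suc k * length es + j = Suc K * length es + i" using assms(3) by (simp add: w)
  from add_mult_cancel_small[OF this w(2) assms(2)] show ?thesis using that w by auto
qed

lemma dict_col:
  assumes "w \<in> set (cw_dict (edge_crossword K es))" "i < length es"
    "length w = slot_len (col_slot K (length es) i)"
  obtains a where "a < length (snd (snd (es ! i)))" "w = edge_word es (Suc K * length es + i) (es ! i) a"
proof -
  obtain k j a where w: "w = edge_word es (k * length es + j) (es ! j) a" "j < length es"
    "a < length (snd (snd (es ! j)))" using assms(1) unfolding edge_dict_iff by blast
  have "Suc k * length es + j = Suc (Suc K) * length es + i" using assms(3) by (simp add: w)
  from add_mult_cancel_small[OF this w(2) assms(2)] show ?thesis using that w by auto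
qed

text \<open>Two common vertices would make the edges equal, the order of the ends excluding opposite
  orientations. Hence \<open>w\<close> is the only common vertex and the one that
  \<open>meet\<close> points to.\<close>

lemma letter_meet_shared:
  assumes "fst e < fst (snd e)" "fst e' < fst (snd e')"
    "\<not> (fst e = fst e' \<and> fst (snd e) = fst (snd e'))"
    "w = fst e \<or> w = fst (snd e)" "w = fst e' \<or> w = fst (snd e')"
  shows "letter x y (meet e e') = (if w = fst e then x else y)"
proof -
  obtain u v p u' v' p' where "e = (u, v, p)" "e' = (u', v', p')" by (metis prod.collapse)
  thus ?thesis using assms by (auto simp: letter_def meet_def)
qed

locale ulc_crossword =
  fixes I :: ulc and K :: nat
  assumes wf: "wf_ulc I"
begin

abbreviation "es \<equiv> ulc_edges I"
abbreviation "m \<equiv> length es"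
abbreviation "src i \<equiv> fst (es ! i)"
abbreviation "dst i \<equiv> fst (snd (es ! i))"
abbreviation "perm i \<equiv> snd (snd (es ! i))"
abbreviation "C \<equiv> edge_crossword K es"

lemma m_pos: "m > 0"
  using wf by (auto simp: wf_ulc_def)

lemma edge_wf:
  assumes "i < m"
  shows "src i < dst i" "dst i < ulc_verts I" "length (perm i) = ulc_labels I"
    "\<And>a. a < ulc_labels I \<Longrightarrow> perm i ! a < ulc_labels I"
proof -
  obtain u v p where e: "es ! i = (u, v, p)" by (metis prod.collapse)
  have "(u, v, p) \<in> set es" using assms e by (metis nth_mem)
  hence "u < v \<and> v < ulc_verts I \<and> length p = ulc_labels I \<and>
      bij_betw (\<lambda>i. p ! i) {..<ulc_labels I} {..<ulc_labels I}"
    using wf unfolding wf_ulc_def by blast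
  thus "src i < dst i" "dst i < ulc_verts I" "length (perm i) = ulc_labels I"
    "\<And>a. a < ulc_labels I \<Longrightarrow> perm i ! a < ulc_labels I"
    using e by (auto dest: bij_betwE)
qed

lemma edges_eq:
  assumes "i < m" "j < m" "src i = src j" "dst i = dst j"
  shows "i = j"
proof -
  have "distinct (map (\<lambda>(u, v, \<pi>). (u, v)) es)" using wf by (simp add: wf_ulc_def)
  moreover have "map (\<lambda>(u, v, \<pi>). (u, v)) es ! i = map (\<lambda>(u, v, \<pi>). (u, v)) es ! j"
    using assms by (simp add: case_prod_beta)
  ultimately show ?thesis using nth_eq_iff_index_eq assms(1,2) by (metis length_map)
qed

lemma distinct_edges: "distinct es"
  using wf by (simp add: wf_ulc_def distinct_map)

lemma card_edges: "card (set es) = m"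
  by (rule distinct_card[OF distinct_edges])

definition satisfied :: "(nat \<Rightarrow> nat) \<Rightarrow> nat set" where
  "satisfied f = {i. i < m \<and> f (dst i) = perm i ! f (src i)}"

lemma ulc_fraction_satisfied: "ulc_fraction I f = real (card (satisfied f)) / real m"
proof -
  have "{(u, v, \<pi>). (u, v, \<pi>) \<in> set es \<and> f v = \<pi> ! f u} =
      {e \<in> set es. f (fst (snd e)) = snd (snd e) ! f (fst e)}" by auto
  also have "\<dots> = (\<lambda>i. es ! i) ` satisfied f"
    unfolding satisfied_def set_conv_nth by blast
  finally have "{(u, v, \<pi>). (u, v, \<pi>) \<in> set es \<and> f v = \<pi> ! f u} = (\<lambda>i. es ! i) ` satisfied f" .
  moreover have "inj_on (\<lambda>i. es ! i) (satisfied f)"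
    using distinct_edges by (auto simp: inj_on_def satisfied_def nth_eq_iff_index_eq)
  ultimately show ?thesis by (simp add: ulc_fraction_def card_edges card_image)
qed

lemma wf_C: "wf_crossword {..ulc_labels I} C"
proof -
  have "set w \<subseteq> {..ulc_labels I}" if "w \<in> set (cw_dict C)" for w
  proof -
    obtain k i a where "i < m" "a < length (perm i)" "w = edge_word es (k * m + i) (es ! i) a"
      using \<open>w \<in> set (cw_dict C)\<close> unfolding edge_dict_iff by blast
    thus ?thesis using edge_wf(3,4)[of i] by (force simp: edge_word_def letter_def)
  qed
  moreover have "cw_slots C \<noteq> []" using m_pos set_edge_slots[of K es] by (auto simp: lessThan_empty_iff)
  moreover have "distinct (cw_slots C)"
    using distinct_edge_slots by (simp add: edge_crossword_def)
  moreover have "slot_len s \<ge> 1 \<and> slot_cells s \<subseteq> {..<cw_rows C} \<times> {..<cw_cols C}"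
    if "s \<in> set (cw_slots C)" for s
    using that m_pos unfolding set_edge_slots
    by (auto simp: slot_cells_row slot_cells_col edge_crossword_def algebra_simps)
  moreover have "slot_cells s \<inter> slot_cells t = {}"
    if "s \<in> set (cw_slots C)" "t \<in> set (cw_slots C)" "s \<noteq> t" "slot_dir s = slot_dir t" for s t
    using that unfolding set_edge_slots by (auto simp: slot_cells_row slot_cells_col)
  ultimately show ?thesis unfolding wf_crossword_def by blast
qed

lemma distinct_lengths_C: "distinct_lengths C"
proof -
  have "Suc K * m + i \<noteq> Suc (Suc K) * m + j" if "i < m" "j < m" for i j
    using add_mult_cancel_small(1)[of "Suc K" m i "Suc (Suc K)" j] that by auto
  thus ?thesis unfolding distinct_lengths_def set_edge_slots inj_on_def by (auto dest: sym)
qed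

section \<open>Counting cells\<close>

lemma cw_cells_C: "cw_cells C = (\<Union>i<m. slot_cells (row_slot K m i)) \<union> (\<Union>i<m. slot_cells (col_slot K m i))"
  by (auto simp: cw_cells_def set_edge_slots)

lemma finite_slot_cells: "finite (slot_cells s)"
  by (simp add: slot_cells_def)

text \<open>Only the \<open>m * m\<close> cells of the top left square lie in two slots.\<close>

lemma card_cw_cells: "(2 * K + 2) * m * m \<le> card (cw_cells C)"
proof -
  let ?r = "\<Union>i<m. slot_cells (row_slot K m i)" and ?c = "\<Union>i<m. slot_cells (col_slot K m i)"
  have "card ?r = (\<Sum>i<m. card (slot_cells (row_slot K m i)))"
    by (rule card_UN_disjoint) (auto simp: slot_cells_row)
  also have "\<dots> = (\<Sum>i<m. Suc K * m + i)" by (simp add: slot_cells_row card_cartesian_product)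
  also have "\<dots> \<ge> (\<Sum>i<m. Suc K * m)" by (rule sum_mono) simp
  finally have r: "card ?r \<ge> m * (Suc K * m)" by simp
  have "card ?c = (\<Sum>i<m. card (slot_cells (col_slot K m i)))"
    by (rule card_UN_disjoint) (auto simp: slot_cells_col)
  also have "\<dots> = (\<Sum>i<m. Suc (Suc K) * m + i)" by (simp add: slot_cells_col card_cartesian_product)
  also have "\<dots> \<ge> (\<Sum>i<m. Suc (Suc K) * m)" by (rule sum_mono) simp
  finally have c: "card ?c \<ge> m * (Suc (Suc K) * m)" by simp
  have "?r \<inter> ?c \<subseteq> {..<m} \<times> {..<m}" by (auto simp: slot_cells_row slot_cells_col)
  hence "card (?r \<inter> ?c) \<le> m * m"
    using card_mono[of "{..<m} \<times> {..<m}" "?r \<inter> ?c"] by (simp add: card_cartesian_product)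
  moreover have "card ?r + card ?c = card (?r \<union> ?c) + card (?r \<inter> ?c)"
    by (rule card_Un_Int) (auto simp: finite_slot_cells)
  \<comment> \<open>Dropping the summands i from the lengths leaves K + 1 and K + 2 times m^2; the
    overlap takes away at most one m^2, and 2 K + 2 remains.\<close>
  ultimately have "m * (Suc K * m) + m * (Suc (Suc K) * m) \<le> card (cw_cells C) + m * m"
    using r c unfolding cw_cells_C by linarith
  thus ?thesis by (simp add: algebra_simps)
qed

lemma card_cells_le:
  assumes "A \<subseteq> {..<m}" "B \<subseteq> {..<m}"
  shows "card ((\<Union>i\<in>A. slot_cells (row_slot K m i)) \<union> (\<Union>i\<in>B. slot_cells (col_slot K m i)))
    \<le> (card A + card B) * ((K + 3) * m)"
proof -
  have fin: "finite A" "finite B" using assms(1,2) by (meson finite_lessThan finite_subset)+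
  have "card (\<Union>i\<in>A. slot_cells (row_slot K m i)) \<le> (\<Sum>i\<in>A. card (slot_cells (row_slot K m i)))"
    by (rule card_UN_le[OF fin(1)])
  also have "\<dots> \<le> (\<Sum>i\<in>A. (K + 3) * m)"
    using assms by (intro sum_mono) (auto simp: slot_cells_row card_cartesian_product algebra_simps)
  finally have 1: "card (\<Union>i\<in>A. slot_cells (row_slot K m i)) \<le> card A * ((K + 3) * m)" by simp
  have "card (\<Union>i\<in>B. slot_cells (col_slot K m i)) \<le> (\<Sum>i\<in>B. card (slot_cells (col_slot K m i)))"
    by (rule card_UN_le[OF fin(2)])
  also have "\<dots> \<le> (\<Sum>i\<in>B. (K + 3) * m)"
  proof (rule sum_mono)
    fix i assume "i \<in> B"
    hence "i < m" using assms by auto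
    thus "card (slot_cells (col_slot K m i)) \<le> (K + 3) * m"
      by (simp add: slot_cells_col card_cartesian_product algebra_simps)
  qed
  finally have 2: "card (\<Union>i\<in>B. slot_cells (col_slot K m i)) \<le> card B * ((K + 3) * m)" by simp
  show ?thesis using card_Un_le 1 2 by (smt (verit) add_mult_distrib add_mono le_trans)
qed

text \<open>Serves both directions: \<open>X\<close> is the set of unfilled cells in the Yes case
  and of filled cells in the No case.\<close>

lemma fraction_cells_le:
  assumes "A \<subseteq> {..<m}" "B \<subseteq> {..<m}"
    and "real (card A + card B) \<le> c * real m"
    and X: "X \<subseteq> (\<Union>i\<in>A. slot_cells (row_slot K m i)) \<union> (\<Union>i\<in>B. slot_cells (col_slot K m i))"
  shows "real (card X) / real (card (cw_cells C)) \<le> c * (K + 3) / (2 * K + 2)"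
proof -
  have fin: "finite A" "finite B" using assms(1,2) by (meson finite_lessThan finite_subset)+
  have "card X \<le> (card A + card B) * ((K + 3) * m)"
    using card_mono[OF _ X] card_cells_le[OF assms(1,2)] fin finite_slot_cells by fastforce
  hence "real (card X) \<le> real ((card A + card B) * ((K + 3) * m))" by (rule of_nat_mono)
  also have "\<dots> \<le> (c * real m) * real ((K + 3) * m)"
    unfolding of_nat_mult[of "card A + card B"] using assms(3) by (intro mult_right_mono) auto
  finally have 1: "real (card X) \<le> c * (K + 3) * (real m * real m)" by (simp add: algebra_simps)
  have "real ((2 * K + 2) * m * m) \<le> real (card (cw_cells C))"
    using card_cw_cells by (rule of_nat_mono)
  hence 2: "(2 * K + 2) * (real m * real m) \<le> real (card (cw_cells C))" by (simp add: algebra_simps)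
  have mm: "real m * real m > 0" using m_pos by simp
  have "0 \<le> c * real m" using assms(3) by (meson of_nat_0_le_iff order_trans)
  hence c: "c \<ge> 0" using m_pos by (simp add: zero_le_mult_iff)
  have "real (card X) / real (card (cw_cells C)) \<le>
      c * (K + 3) * (real m * real m) / ((2 * K + 2) * (real m * real m))"
    using 1 2 mm c by (intro frac_le) auto
  also have "\<dots> = c * (K + 3) / (2 * K + 2)" using mm by (intro mult_divide_mult_cancel_right) auto
  finally show ?thesis .
qed

text \<open>Both sides are the value of \<open>f\<close> at the common vertex, or 0 if there is
  none. For opposite orientations of one edge they would name different vertices; the order on the
  vertices excludes this.\<close>

lemma letter_meet:
  assumes "i < m" "j < m" "f (dst i) = perm i ! f (src i)" "f (dst j) = perm j ! f (src j)"
  shows "letter (f (src i)) (perm i ! f (src i)) (meet (es ! i) (es ! j)) =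
    letter (f (src j)) (perm j ! f (src j)) (meet (es ! j) (es ! i))"
  using edge_wf(1)[OF assms(1)] edge_wf(1)[OF assms(2)]
  unfolding assms(3,4)[symmetric] by (auto simp: letter_def meet_def case_prod_beta)

text \<open>At most \<delta> m constraints fail, and exactly their slots are left empty, 2 \<delta>
  m in number at worst. Agreement in the crossings is \<open>letter_meet\<close>.\<close>

lemma yes_case:
  assumes a: "ulc_assignment I f" and fr: "ulc_fraction I f \<ge> 1 - \<delta>" and K: "K \<ge> 1" and "\<delta> \<ge> 0"
  shows "\<exists>s. valid_solution C s \<and> filled_fraction C s \<ge> 1 - 2 * \<delta>"
proof -
  let ?S = "satisfied f"
  let ?w = "\<lambda>k i. edge_word es (k * m + i) (es ! i) (f (src i))"
  define s where "s t = (case slot_dir t of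
      Horizontal \<Rightarrow> if slot_row t \<in> ?S then Some (?w K (slot_row t)) else None
    | Vertical \<Rightarrow> if slot_col t \<in> ?S then Some (?w (Suc K) (slot_col t)) else None)" for t :: slot
  have row: "s (row_slot K m i) = (if i \<in> ?S then Some (?w K i) else None)" for i
    by (simp add: s_def)
  have col: "s (col_slot K m i) = (if i \<in> ?S then Some (?w (Suc K) i) else None)" for i
    by (simp add: s_def)
  have S: "i < m" "f (dst i) = perm i ! f (src i)" if "i \<in> ?S" for i
    using that by (auto simp: satisfied_def)
  have lab: "f (src i) < length (perm i)" if "i < m" for i
    using a edge_wf[OF that] by (auto simp: ulc_assignment_def)
  have dict: "?w K i \<in> set (cw_dict C)" "?w (Suc K) i \<in> set (cw_dict C)" if "i < m" for i
    using that lab[OF that] unfolding edge_dict_iff by blast+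
  have cross: "?w K i ! j = ?w (Suc K) j ! i" if "i \<in> ?S" "j \<in> ?S" for i j
    using letter_meet[OF S(1)[OF that(1)] S(1)[OF that(2)] S(2)[OF that(1)] S(2)[OF that(2)]] S(1) that
    by (simp add: edge_word_nth)
  have "valid_solution C s"
    unfolding valid_solution_def
  proof (intro conjI ballI allI impI)
    fix t w assume t: "t \<in> set (cw_slots C)" "s t = Some w"
    from t(1) consider i where "i < m" "t = row_slot K m i" | i where "i < m" "t = col_slot K m i"
      unfolding set_edge_slots by blast
    thus "w \<in> set (cw_dict C)" "length w = slot_len t"
      using t(2) dict by (cases; auto simp: row col split: if_splits)+
  next
    fix t t' w w' p q
    assume t: "t \<in> set (cw_slots C)" "t' \<in> set (cw_slots C)"
      and h: "s t = Some w \<and> s t' = Some w' \<and> p < slot_len t \<and> q < slot_len t' \<and>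
        slot_cell t p = slot_cell t' q"
    from t(1) consider (r) i where "t = row_slot K m i" | (c) i where "t = col_slot K m i"
      unfolding set_edge_slots by blast
    thus "w ! p = w' ! q"
    proof cases
      case (r i)
      from t(2) consider (r') j where "t' = row_slot K m j" | (c') j where "t' = col_slot K m j"
        unfolding set_edge_slots by blast
      thus ?thesis
        by cases (use h cross in \<open>auto simp: r row col split: if_splits\<close>)
    next
      case (c i)
      from t(2) consider (r') j where "t' = row_slot K m j" | (c') j where "t' = col_slot K m j"
        unfolding set_edge_slots by blast
      thus ?thesis
        by cases (use h cross in \<open>auto simp: c row col split: if_splits\<close>)
    qed
  qed
  moreover have "filled_fraction C s \<ge> 1 - 2 * \<delta>"
  proof -
    let ?U = "{..<m} - ?S"
    let ?T = "card (cw_cells C)"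
    have sub: "?S \<subseteq> {..<m}" using S by auto
    \<comment> \<open>A cell of an empty slot may still be covered by a filled slot crossing it, so
      only an inclusion holds.\<close>
    have "cw_cells C - filled_cells C s \<subseteq>
        (\<Union>i\<in>?U. slot_cells (row_slot K m i)) \<union> (\<Union>i\<in>?U. slot_cells (col_slot K m i))"
    proof
      fix x assume x: "x \<in> cw_cells C - filled_cells C s"
      then obtain t where t: "t \<in> set (cw_slots C)" "x \<in> slot_cells t" "s t = None"
        unfolding cw_cells_def filled_cells_def by blast
      from t(1) consider i where "i < m" "t = row_slot K m i" | i where "i < m" "t = col_slot K m i"
        unfolding set_edge_slots by blast
      thus "x \<in> (\<Union>i\<in>?U. slot_cells (row_slot K m i)) \<union> (\<Union>i\<in>?U. slot_cells (col_slot K m i))"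
        using t(2,3) by cases (auto simp: row col split: if_splits)
    qed
    moreover have "real (card ?U + card ?U) \<le> 2 * \<delta> * real m"
    proof -
      have "(1 - \<delta>) * real m \<le> real (card ?S)"
        using fr m_pos by (simp add: ulc_fraction_satisfied pos_le_divide_eq)
      moreover have "card ?U = m - card ?S" "card ?S \<le> m"
        using sub card_mono[OF _ sub] by (simp_all add: card_Diff_subset finite_subset)
      ultimately show ?thesis by (simp add: of_nat_diff algebra_simps)
    qed
    ultimately have "real (card (cw_cells C - filled_cells C s)) / real ?T \<le> 2 * \<delta> * (K + 3) / (2 * K + 2)"
      by (intro fraction_cells_le[of ?U ?U]) auto
    \<comment> \<open>Here K \<ge> 1 enters, as K + 3 \<le> 2 K + 2.\<close>
    also have "\<dots> \<le> 2 * \<delta>"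
    proof -
      have "2 * \<delta> * (K + 3) \<le> 2 * \<delta> * (2 * K + 2)" using K \<open>\<delta> \<ge> 0\<close> by (intro mult_left_mono) auto
      thus ?thesis by (simp add: divide_le_eq)
    qed
    finally have le: "real (card (cw_cells C - filled_cells C s)) / real ?T \<le> 2 * \<delta>" .
    have fin: "finite (cw_cells C)" by (simp add: cw_cells_def finite_slot_cells)
    have subset: "filled_cells C s \<subseteq> cw_cells C" by (auto simp: filled_cells_def cw_cells_def)
    hence "card (cw_cells C - filled_cells C s) = ?T - card (filled_cells C s)"
      "card (filled_cells C s) \<le> ?T"
      using fin by (auto simp: card_Diff_subset finite_subset card_mono)
    moreover have "?T > 0" using card_cw_cells m_pos by (auto intro: gr0I)
    ultimately show ?thesis using le unfolding filled_fraction_def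
      by (simp add: of_nat_diff diff_divide_distrib)
  qed
  ultimately show ?thesis by blast
qed

lemma doubly_filled:
  fixes s :: "slot \<Rightarrow> nat list option"
  assumes s: "valid_solution C s" and D: "D = {i. i < m \<and> s (row_slot K m i) \<noteq> None \<and> s (col_slot K m i) \<noteq> None}"
    and fr: "\<And>f. ulc_assignment I f \<Longrightarrow> ulc_fraction I f \<le> \<delta>" and "\<delta> \<ge> 0"
  shows "real (card D) \<le> \<delta> * real m"
proof (cases "D = {}")
  case True
  thus ?thesis using \<open>\<delta> \<ge> 0\<close> by simp
next
  case False
  have word: "w \<in> set (cw_dict C)" "length w = slot_len t" if "t \<in> set (cw_slots C)" "s t = Some w" for t w
    using s that unfolding valid_solution_def by blast+
  have "\<exists>a. a < ulc_labels I \<and> s (row_slot K m i) = Some (edge_word es (K * m + i) (es ! i) a)"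
    if "i \<in> D" for i
  proof -
    have i: "i < m" using that D by simp
    obtain w where w: "s (row_slot K m i) = Some w" using \<open>i \<in> D\<close> D by auto
    have "row_slot K m i \<in> set (cw_slots C)" using i by (simp add: set_edge_slots)
    from word[OF this w] show ?thesis
      using dict_row[of w K es i] i w edge_wf(3)[OF i] by metis
  qed
  then obtain a where a: "\<And>i. i \<in> D \<Longrightarrow> a i < ulc_labels I"
    "\<And>i. i \<in> D \<Longrightarrow> s (row_slot K m i) = Some (edge_word es (K * m + i) (es ! i) (a i))" by metis
  have "\<exists>b. s (col_slot K m i) = Some (edge_word es (Suc K * m + i) (es ! i) b)"
    if "i \<in> D" for i
  proof -
    have i: "i < m" using that D by simp
    obtain w where w: "s (col_slot K m i) = Some w" using \<open>i \<in> D\<close> D by auto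
    have "col_slot K m i \<in> set (cw_slots C)" using i by (simp add: set_edge_slots)
    from word[OF this w] show ?thesis
      using dict_col[of w K es i] i w by metis
  qed
  then obtain b where b: "\<And>i. i \<in> D \<Longrightarrow> s (col_slot K m i) = Some (edge_word es (Suc K * m + i) (es ! i) (b i))"
    by metis
  have Dm: "i < m" if "i \<in> D" for i using that D by simp
  have cross: "letter (a i) (perm i ! a i) (meet (es ! i) (es ! j)) =
      letter (b j) (perm j ! b j) (meet (es ! j) (es ! i))" if "i \<in> D" "j \<in> D" for i j
  proof -
    have ij: "i < m" "j < m" using that Dm by auto
    have "row_slot K m i \<in> set (cw_slots C)" "col_slot K m j \<in> set (cw_slots C)"
      using ij by (simp_all add: set_edge_slots)
    moreover have "j < slot_len (row_slot K m i)" "i < slot_len (col_slot K m j)" using ij by auto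
    moreover have "slot_cell (row_slot K m i) j = slot_cell (col_slot K m j) i" by simp
    ultimately have "edge_word es (K * m + i) (es ! i) (a i) ! j = edge_word es (Suc K * m + j) (es ! j) (b j) ! i"
      using s a(2)[OF that(1)] b[OF that(2)] unfolding valid_solution_def by blast
    thus ?thesis using ij by (simp add: edge_word_nth)
  qed
  \<comment> \<open>An edge meets itself in its first vertex, so the diagonal cell shows the label
    itself, once as chosen by the row word and once by the column word.\<close>
  have ab: "a i = b i" if "i \<in> D" for i
    using cross[OF that that] by (simp add: letter_def meet_def case_prod_beta)
  \<comment> \<open>The value that the word of constraint i prescribes for an end \<open>w\<close>
    of its edge.\<close>
  define lab where "lab i w = (if w = src i then a i else perm i ! a i)" for i w
  have consistent: "lab i w = lab j w"
    if ij: "i \<in> D" "j \<in> D" and w: "w = src i \<or> w = dst i" "w = src j \<or> w = dst j" for i j w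
  proof (cases "i = j")
    case False
    have lt: "src i < dst i" "src j < dst j" using edge_wf(1) Dm ij by auto
    have "\<not> (src i = src j \<and> dst i = dst j)" using edges_eq[of i j] False Dm ij by blast
    hence "letter (a i) (perm i ! a i) (meet (es ! i) (es ! j)) = lab i w"
      "letter (a j) (perm j ! a j) (meet (es ! j) (es ! i)) = lab j w"
      unfolding lab_def using w by (intro letter_meet_shared lt; auto)+
    thus ?thesis using cross[OF ij] ab[OF ij(2)] by simp
  qed simp
  \<comment> \<open>Any constraint of D through \<open>w\<close> may be chosen, by
    \<open>consistent\<close>; vertices outside all these edges get 0.\<close>
  define f where "f w = (if \<exists>i\<in>D. w = src i \<or> w = dst i
      then lab (SOME i. i \<in> D \<and> (w = src i \<or> w = dst i)) w else 0)" for w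
  have f: "f w = lab i w" if "i \<in> D" "w = src i \<or> w = dst i" for i w
  proof -
    let ?j = "SOME i. i \<in> D \<and> (w = src i \<or> w = dst i)"
    have j: "?j \<in> D" "w = src ?j \<or> w = dst ?j"
      using someI[of "\<lambda>i. i \<in> D \<and> (w = src i \<or> w = dst i)" i] that by blast+
    have "lab ?j w = lab i w" by (rule consistent[OF j(1) that(1) j(2) that(2)])
    moreover have "\<exists>i\<in>D. w = src i \<or> w = dst i" using that by blast
    hence "f w = lab ?j w" unfolding f_def by (rule if_P)
    ultimately show ?thesis by (rule trans[rotated])
  qed
  \<comment> \<open>A filled slot exhibits a label, which makes the default 0 legal. For empty D
    there might be no label and no assignment, hence the case distinction.\<close>
  have R: "ulc_labels I > 0" using a(1) False by force
  have "f w < ulc_labels I" for w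
  proof (cases "\<exists>i\<in>D. w = src i \<or> w = dst i")
    case True
    then obtain i where i: "i \<in> D" "w = src i \<or> w = dst i" by blast
    thus ?thesis using f[OF i] a(1)[OF i(1)] edge_wf(4)[OF Dm[OF i(1)]] by (simp add: lab_def)
  next
    case False
    thus ?thesis using R unfolding f_def by simp
  qed
  hence "ulc_fraction I f \<le> \<delta>" by (intro fr) (simp add: ulc_assignment_def)
  moreover have "D \<subseteq> satisfied f"
  proof
    fix i assume i: "i \<in> D"
    have "f (src i) = a i" "f (dst i) = perm i ! a i"
      using f[OF i] edge_wf(1)[OF Dm[OF i]] by (auto simp: lab_def)
    thus "i \<in> satisfied f" using Dm[OF i] by (simp add: satisfied_def)
  qed
  hence "card D \<le> card (satisfied f)" by (intro card_mono) (auto simp: satisfied_def)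
  ultimately show ?thesis
    using m_pos by (simp add: ulc_fraction_satisfied pos_divide_le_eq)
qed

lemma no_case:
  fixes s :: "slot \<Rightarrow> nat list option"
  assumes s: "valid_solution C s"
    and fr: "\<And>f. ulc_assignment I f \<Longrightarrow> ulc_fraction I f \<le> \<delta>" and "\<delta> \<ge> 0"
  shows "filled_fraction C s \<le> (1 + \<delta>) * (K + 3) / (2 * K + 2)"
proof -
  let ?A = "{i. i < m \<and> s (row_slot K m i) \<noteq> None}" and ?B = "{i. i < m \<and> s (col_slot K m i) \<noteq> None}"
  have "?A \<inter> ?B = {i. i < m \<and> s (row_slot K m i) \<noteq> None \<and> s (col_slot K m i) \<noteq> None}" by auto
  hence "real (card (?A \<inter> ?B)) \<le> \<delta> * real m" using doubly_filled[OF s _ fr \<open>\<delta> \<ge> 0\<close>] by blast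
  moreover have "card ?A + card ?B = card (?A \<union> ?B) + card (?A \<inter> ?B)" by (rule card_Un_Int) auto
  moreover have "card (?A \<union> ?B) \<le> m"
    using card_mono[of "{..<m}" "?A \<union> ?B"] by auto
  ultimately have "real (card ?A + card ?B) \<le> (1 + \<delta>) * real m" by (simp add: algebra_simps)
  moreover have "filled_cells C s \<subseteq>
      (\<Union>i\<in>?A. slot_cells (row_slot K m i)) \<union> (\<Union>i\<in>?B. slot_cells (col_slot K m i))"
    unfolding filled_cells_def set_edge_slots by auto
  ultimately show ?thesis unfolding filled_fraction_def
    by (intro fraction_cells_le[of ?A ?B]) auto
qed

end

section \<open>Transfer of hardness and choice of the parameters\<close>

lemma np_hard_to_distinguish_mono:
  assumes "np_hard_to_distinguish Y N" "Y \<subseteq> Y'" "N \<subseteq> N'"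
  shows "np_hard_to_distinguish Y' N'"
  unfolding np_hard_to_distinguish_def
proof
  fix L assume "L \<in> NP"
  then obtain f where "polytime f" "\<And>x. (x \<in> L \<longrightarrow> f x \<in> Y) \<and> (x \<notin> L \<longrightarrow> f x \<in> N)"
    using assms(1) unfolding np_hard_to_distinguish_def by blast
  thus "\<exists>f. polytime f \<and> (\<forall>x. (x \<in> L \<longrightarrow> f x \<in> Y') \<and> (x \<notin> L \<longrightarrow> f x \<in> N'))"
    using assms(2,3) by blast
qed

theorem theorem22:
  assumes "unique_games_conjecture"
  shows "\<forall>\<epsilon> :: real. 0 < \<epsilon> \<and> \<epsilon> < 1 / 4 \<longrightarrow>
    (\<exists>\<Sigma> :: nat set. finite \<Sigma> \<and>
       np_hard_to_distinguish
         (enc_crossword ` crossword_yes \<Sigma> \<epsilon>)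
         (enc_crossword ` crossword_no \<Sigma> \<epsilon>) \<and>
       np_hard_to_distinguish
         (enc_crossword ` {C \<in> crossword_yes \<Sigma> \<epsilon>. distinct_lengths C})
         (enc_crossword ` {C \<in> crossword_no \<Sigma> \<epsilon>. distinct_lengths C}))"
proof (intro allI impI)
  fix \<epsilon> :: real assume \<epsilon>: "0 < \<epsilon> \<and> \<epsilon> < 1 / 4"
  \<comment> \<open>In the Yes case 2 \<delta> of the cells are lost, two slots per violated
    constraint.\<close>
  define \<delta> where "\<delta> = \<epsilon> / 2"
  have \<delta>: "\<delta> > 0" using \<epsilon> by (simp add: \<delta>_def)
  obtain R where R: "np_hard_to_distinguish (enc_ulc ` ulc_yes R \<delta>) (enc_ulc ` ulc_no R \<delta>)"
    using assms \<delta> unfolding unique_games_conjecture_def by blast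
  obtain K :: nat where K: "4 / \<epsilon> \<le> real K" using real_arch_simple by blast
  have "1 \<le> 4 / \<epsilon>" using \<epsilon> by simp
  hence K1: "K \<ge> 1" using K by linarith
  let ?Y = "{C \<in> crossword_yes {..R} \<epsilon>. distinct_lengths C}"
  let ?N = "{C \<in> crossword_no {..R} \<epsilon>. distinct_lengths C}"
  have yes: "edge_crossword K (ulc_edges I) \<in> ?Y" if I: "I \<in> ulc_yes R \<delta>" for I
  proof -
    interpret ulc_crossword I K using I by unfold_locales (simp add: ulc_yes_def)
    obtain f where f: "ulc_assignment I f" "ulc_fraction I f \<ge> 1 - \<delta>" and l: "ulc_labels I = R"
      using I by (auto simp: ulc_yes_def)
    have "\<exists>s. valid_solution C s \<and> filled_fraction C s \<ge> 1 - \<epsilon>"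
      using yes_case[OF f K1 less_imp_le[OF \<delta>]] by (simp add: \<delta>_def)
    thus ?thesis using wf_C distinct_lengths_C l by (simp add: crossword_yes_def)
  qed
  have no: "edge_crossword K (ulc_edges I) \<in> ?N" if I: "I \<in> ulc_no R \<delta>" for I
  proof -
    interpret ulc_crossword I K using I by unfold_locales (simp add: ulc_no_def)
    have fr: "\<And>f. ulc_assignment I f \<Longrightarrow> ulc_fraction I f \<le> \<delta>" and l: "ulc_labels I = R"
      using I by (auto simp: ulc_no_def)
    have "(1 + \<delta>) * (K + 3) / (2 * K + 2) \<le> 1 / 2 + \<epsilon>"
    proof -
      \<comment> \<open>Expanded, the inequality below reads 2 \<le> (3/2) \<epsilon> K + \<epsilon>
        / 2, so the choice of K leaves room to spare.\<close>
      have "4 \<le> \<epsilon> * real K" using K \<epsilon> by (simp add: pos_divide_le_eq mult.commute)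
      moreover have "\<epsilon> * \<epsilon> \<ge> 0" by simp
      ultimately have "(1 + \<delta>) * (K + 3) \<le> (1 / 2 + \<epsilon>) * (2 * K + 2)"
        using \<epsilon> by (simp add: \<delta>_def algebra_simps)
      thus ?thesis by (simp add: pos_divide_le_eq)
    qed
    hence "filled_fraction C s \<le> 1 / 2 + \<epsilon>" if "valid_solution C s" for s
      using no_case[OF that fr less_imp_le[OF \<delta>]] by (meson order_trans)
    thus ?thesis using wf_C distinct_lengths_C l by (simp add: crossword_no_def)
  qed
  have hard: "np_hard_to_distinguish (enc_crossword ` ?Y) (enc_crossword ` ?N)"
    unfolding np_hard_to_distinguish_def
  proof
    fix L assume "L \<in> NP"
    then obtain f where f: "polytime f"
      "\<And>x. (x \<in> L \<longrightarrow> f x \<in> enc_ulc ` ulc_yes R \<delta>) \<and> (x \<notin> L \<longrightarrow> f x \<in> enc_ulc ` ulc_no R \<delta>)"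
      using R unfolding np_hard_to_distinguish_def by blast
    \<comment> \<open>One instance per x, chosen by cases on membership in L, so that a single
      function describes the reduction on both sides.\<close>
    have "\<exists>I. f x = enc_ulc I \<and> (x \<in> L \<longrightarrow> I \<in> ulc_yes R \<delta>) \<and> (x \<notin> L \<longrightarrow> I \<in> ulc_no R \<delta>)" for x
      using f(2)[of x] by blast
    then obtain I where I: "\<And>x. f x = enc_ulc (I x)" "\<And>x. x \<in> L \<Longrightarrow> I x \<in> ulc_yes R \<delta>"
      "\<And>x. x \<notin> L \<Longrightarrow> I x \<in> ulc_no R \<delta>" by metis
    let ?g = "\<lambda>x. enc_crossword (edge_crossword K (ulc_edges (I x)))"
    have "polytime ?g" using f(1) I(1) by (rule polytime_edge_crossword)
    moreover have "(x \<in> L \<longrightarrow> ?g x \<in> enc_crossword ` ?Y) \<and> (x \<notin> L \<longrightarrow> ?g x \<in> enc_crossword ` ?N)" for x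
      using yes[OF I(2)] no[OF I(3)] by blast
    ultimately show "\<exists>g. polytime g \<and> (\<forall>x. (x \<in> L \<longrightarrow> g x \<in> enc_crossword ` ?Y) \<and>
        (x \<notin> L \<longrightarrow> g x \<in> enc_crossword ` ?N))" by blast
  qed
  hence "np_hard_to_distinguish (enc_crossword ` crossword_yes {..R} \<epsilon>)
      (enc_crossword ` crossword_no {..R} \<epsilon>)"
    by (rule np_hard_to_distinguish_mono) auto
  thus "\<exists>\<Sigma> :: nat set. finite \<Sigma> \<and>
       np_hard_to_distinguish (enc_crossword ` crossword_yes \<Sigma> \<epsilon>) (enc_crossword ` crossword_no \<Sigma> \<epsilon>) \<and>
       np_hard_to_distinguish (enc_crossword ` {C \<in> crossword_yes \<Sigma> \<epsilon>. distinct_lengths C})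
         (enc_crossword ` {C \<in> crossword_no \<Sigma> \<epsilon>. distinct_lengths C})"
    using hard by (intro exI[of _ "{..R}"]) simp
qed

end
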